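(* For all integers $n\geq 0$, $a_3(7^2n+39)\equiv 0 \pmod{7^2}$.
   Context: For an integer $k\geq 1$ let $f_k:=\prod_{n\geq 1}(1-q^{kn})$. For an integer $c\geq 1$, the generalized cubic partition function $a_c(n)$ is defined by the generating function $\sum_{n\geq 0}a_c(n)q^n=\dfrac{1}{f_1f_2^{c-1}}$; in particular $\sum_{n\geq0}a_3(n)q^n=\dfrac{1}{f_1f_2^2}$. *)

theory Defs
  imports "HOL-Computational_Algebra.Formal_Power_Series"
begin

text \<open>f_k = prod_{n>=1} (1 - q^{kn}) as a formal power series over the rationals.
  The coefficient of q^m of the infinite product equals that of the finite
  partial product over n = 1..m (for k >= 1 the later factors do not affect it).\<close>
definition eta_f :: "nat \<Rightarrow> rat fps" where
  "eta_f k = Abs_fps (\<lambda>m. fps_nth (\<Prod>n\<in>{1..m}. (1 - fps_X ^ (k * n))) m)"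

definition a_gen :: "nat \<Rightarrow> nat \<Rightarrow> rat" where
  "a_gen c n = fps_nth (inverse (eta_f 1 * eta_f 2 ^ (c - 1))) n"

end

theory Submission
  imports Defs "HOL-Computational_Algebra.Polynomial"
begin

text \<open>
  Write \<open>f\<^sub>k\<close> for the product of the \<open>1 - q\<^bsup>kn\<^esup>\<close>, \<open>A = 1/(f\<^sub>1 f\<^sub>2\<^sup>2)\<close>, \<open>\<theta> = q d/dq\<close>, \<open>U\<close> for the
  operator extracting the coefficients of index \<open>7n+4\<close>, and \<open>f\<^sub>2\<^sup>7 = f\<^sub>1\<^sub>4 + 7S\<close> with \<open>S\<close> integral.
  Expanding \<open>A f\<^sub>1\<^sub>4\<^sup>2\<close> in powers of \<open>7\<close> gives \<open>f\<^sub>2\<^sup>2 U(A) = f\<^sub>2 U(H) - 7 U(S H)\<close> modulo \<open>49\<close>, where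
  \<open>H = f\<^sub>2\<^sup>5/f\<^sub>1\<close> is the product of Gauss' series for \<open>f\<^sub>2\<^sup>2/f\<^sub>1\<close> and Jacobi's series for \<open>f\<^sub>2\<^sup>3\<close>.
  As \<open>-2\<close> is not a square modulo \<open>7\<close>, only multiples of \<open>7\<close> in both sums contribute to \<open>U(H)\<close>, so
  \<open>U(H) = -7 q\<^sup>2 H(q\<^sup>7)\<close>. Hence \<open>U(A) = 7R\<close>, and \<open>R\<close> is only needed modulo \<open>7\<close>.

  Modulo \<open>7\<close> one has \<open>\<theta>\<^sup>6 (S/f\<^sub>1\<^sub>4) = \<theta>\<^sup>5 (\<theta> f\<^sub>2/f\<^sub>2)\<close>, so the remaining term is \<open>U\<close> of the product of \<open>A\<close> and
  the fifth derivative of a logarithmic derivative. The theta series for \<open>f\<^sub>1\<close>, \<open>f\<^sub>1\<^sup>3\<close>, \<open>f\<^sub>1\<^sup>2/f\<^sub>2\<close> and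
  \<open>f\<^sub>2\<^sup>2/f\<^sub>1\<close> satisfy third order differential equations modulo \<open>7\<close> (because \<open>x\<^sup>6 = 1\<close> for units); together
  these show that all modular forms involved are Laurent polynomials in one series \<open>a\<close> of weight
  two with \<open>a \<theta> a = 1 - a\<^sup>6\<close>. An explicit polynomial identity in \<open>a\<close> then writes the product as a
  derivative plus eta quotients in \<open>q\<^sup>7\<close>, and what \<open>U\<close> leaves has vanishing coefficients at
  \<open>7n+5\<close> because \<open>f\<^sub>1\<^sup>6\<close> is a derivative modulo \<open>7\<close>.
\<close>

section \<open>Power series, dilations and sections\<close>

text \<open>Infinite products and sums are handled through truncations only:
  \<open>agree_eqI\<close> recovers equality from agreement for every \<open>M\<close>, so no limits
  of series occur.\<close>

definition agree :: "nat \<Rightarrow> 'a fps \<Rightarrow> 'a fps \<Rightarrow> bool" where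
  "agree M F G \<longleftrightarrow> (\<forall>m\<le>M. fps_nth F m = fps_nth G m)"

lemma agree_refl [simp]: "agree M F F"
  by (simp add: agree_def)

lemma agree_sym: "agree M F G \<Longrightarrow> agree M G F"
  by (simp add: agree_def)

lemma agree_trans [trans]: "agree M F G \<Longrightarrow> agree M G H \<Longrightarrow> agree M F H"
  by (simp add: agree_def)

lemma agree_eqI: "(\<And>M. agree M F G) \<Longrightarrow> F = G"
  by (auto simp: agree_def fps_eq_iff)

lemma agree_mult:
  fixes F G F' G' :: "'a::comm_ring_1 fps"
  assumes "agree M F F'" "agree M G G'"
  shows "agree M (F * G) (F' * G')"
  using assms by (auto simp: agree_def fps_mult_nth intro!: sum.cong)

lemma agree_power:
  fixes F G :: "'a::comm_ring_1 fps"
  shows "agree M F G \<Longrightarrow> agree M (F ^ n) (G ^ n)"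
  by (induction n) (auto intro: agree_mult)

lemma agree_sum:
  fixes F G :: "'b \<Rightarrow> 'a::comm_ring_1 fps"
  assumes "\<And>x. x \<in> A \<Longrightarrow> agree M (F x) (G x)"
  shows "agree M (sum F A) (sum G A)"
  using assms by (auto simp: agree_def fps_sum_nth intro!: sum.cong)

lemma agree_prod_one:
  fixes h :: "'b \<Rightarrow> 'a::comm_ring_1 fps"
  assumes "\<And>x. x \<in> A \<Longrightarrow> agree M (h x) 1"
  shows "agree M (prod h A) 1"
  using assms
proof (induction A rule: infinite_finite_induct)
  case (insert x A)
  then have "agree M (h x * prod h A) (1 * 1)"
    by (intro agree_mult) auto
  then show ?case using insert by simp
qed auto

lemma agree_cancel:
  fixes F G E :: "'a::field fps"
  assumes "agree M (F * E) (G * E)" "fps_nth E 0 \<noteq> 0"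
  shows "agree M F G"
proof -
  have "E * inverse E = 1" using assms(2) by (simp add: inverse_mult_eq_1')
  moreover have "agree M (F * E * inverse E) (G * E * inverse E)"
    by (intro agree_mult assms) auto
  ultimately show ?thesis by (simp add: mult.assoc)
qed

lemma agree_one_plus_monomial:
  fixes c :: "'a::comm_ring_1 fps"
  assumes "M < d"
  shows "agree M (1 + c * fps_X ^ d) 1"
  using assms by (auto simp: agree_def fps_X_power_mult_right_nth)

lemma agree_one_minus_monomial:
  assumes "M < d"
  shows "agree M (1 - fps_X ^ d :: 'a::comm_ring_1 fps) 1"
  using agree_one_plus_monomial[OF assms, of "-1::'a fps"] by simp

section \<open>Euler products\<close>

definition eta_part :: "nat \<Rightarrow> nat \<Rightarrow> 'a::comm_ring_1 fps" where
  "eta_part k n = (\<Prod>j\<in>{1..n}. 1 - fps_X ^ (k * j))"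

text \<open>The same diagonal encoding as \<open>eta_f\<close>, but over any commutative ring: the
  proof moves between the integers, the rationals and a field of characteristic seven.\<close>

definition eta :: "nat \<Rightarrow> 'a::comm_ring_1 fps" where
  "eta k = Abs_fps (\<lambda>m. fps_nth (eta_part k m) m)"

lemma eta_f_eq_eta: "eta_f k = eta k"
  by (simp add: eta_f_def eta_def eta_part_def)

lemma agree_eta_part_mono:
  assumes "k \<ge> 1" "M \<le> n" "n \<le> n'"
  shows "agree M (eta_part k n' :: 'a::comm_ring_1 fps) (eta_part k n)"
proof -
  have "{1..n'} = {1..n} \<union> {n<..n'}" using assms by auto
  then have "eta_part k n' = (eta_part k n * (\<Prod>j\<in>{n<..n'}. 1 - fps_X ^ (k * j)) :: 'a fps)"
    unfolding eta_part_def by (simp add: prod.union_disjoint[symmetric] Int_def)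
  also have "agree M \<dots> (eta_part k n * 1)"
  proof (intro agree_mult agree_refl agree_prod_one agree_one_minus_monomial)
    fix j assume "j \<in> {n<..n'}"
    then have "M < j" using assms by auto
    also have "j \<le> k * j" using assms by simp
    finally show "M < k * j" .
  qed
  finally show ?thesis by simp
qed

lemma agree_eta_part_eta:
  assumes "k \<ge> 1" "M \<le> n"
  shows "agree M (eta_part k n) (eta k)"
  unfolding agree_def
proof (intro allI impI)
  fix m assume "m \<le> M"
  then have "agree m (eta_part k n :: 'a fps) (eta_part k m)"
    using assms by (intro agree_eta_part_mono) auto
  then show "fps_nth (eta_part k n :: 'a fps) m = fps_nth (eta k) m"
    by (simp add: agree_def eta_def)
qed

lemma eta_nth_0 [simp]: "fps_nth (eta k :: 'a::comm_ring_1 fps) 0 = 1"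
  by (simp add: eta_def eta_part_def)

lemma eta_nonzero [simp]: "eta k \<noteq> (0 :: 'a::comm_ring_1 fps)"
  by (metis eta_nth_0 fps_zero_nth zero_neq_one)

section \<open>Dilations, the derivation q d/dq and sections\<close>

definition dil :: "nat \<Rightarrow> 'a::idom fps \<Rightarrow> 'a fps" where
  "dil k F = F oo fps_X ^ k"

lemma dil_nth:
  assumes "k > 0"
  shows "fps_nth (dil k F) n = (if k dvd n then fps_nth F (n div k) else 0)"
proof -
  have "fps_nth (dil k F) n = (\<Sum>i\<in>{0..n}. fps_nth F i * (if n = k * i then 1 else 0))"
    by (simp add: dil_def fps_compose_nth flip: power_mult)
  also have "\<dots> = (\<Sum>i\<in>{0..n}. if k dvd n \<and> i = n div k then fps_nth F i else 0)"
    using assms by (intro sum.cong) auto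
  also have "\<dots> = (if k dvd n then fps_nth F (n div k) else 0)"
    by (cases "k dvd n") (auto simp: sum.delta)
  finally show ?thesis .
qed

lemma dil_nth_mult: "k > 0 \<Longrightarrow> fps_nth (dil k F) (k * n) = fps_nth F n"
  by (simp add: dil_nth)

lemma dil_add: "dil k (F + G) = dil k F + dil k G"
  by (simp add: dil_def fps_compose_add_distrib)

lemma dil_diff: "dil k (F - G) = dil k F - dil k G"
  by (simp add: dil_def fps_compose_sub_distrib)

lemma dil_uminus: "dil k (- F) = - dil k F"
  by (simp add: dil_def fps_compose_uminus)

lemma dil_mult: "k > 0 \<Longrightarrow> dil k (F * G) = dil k F * dil k G"
  by (simp add: dil_def fps_compose_mult_distrib)

lemma dil_power: "k > 0 \<Longrightarrow> dil k (F ^ n) = dil k F ^ n"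
  by (simp add: dil_def fps_compose_power)

lemma dil_one [simp]: "dil k 1 = 1"
  by (simp add: dil_def)

lemma dil_numeral [simp]: "dil k (numeral n) = numeral n"
  by (simp add: dil_def)

lemma dil_X_power: "k > 0 \<Longrightarrow> dil k (fps_X ^ n) = fps_X ^ (k * n)"
  by (simp add: dil_power) (simp add: dil_def power_mult)

lemma dil_X: "k > 0 \<Longrightarrow> dil k fps_X = fps_X ^ k"
  by (simp add: dil_def)

lemma dil_dil:
  assumes "k > 0" "l > 0"
  shows "dil k (dil l F) = dil (k * l) F"
proof -
  have "dil k (dil l F) = F oo (fps_X ^ l oo fps_X ^ k)"
    unfolding dil_def using assms by (subst fps_compose_assoc) simp_all
  then show ?thesis using dil_X_power[OF assms(1), of l, where 'a = 'a] by (simp add: dil_def)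
qed

lemma dil_eta:
  assumes "k > 0" "l > 0"
  shows "dil k (eta l) = eta (k * l)"
proof (rule fps_ext)
  fix m
  have dp: "dil k (eta_part l n) = (eta_part (k * l) n :: 'a fps)" for n
    using assms unfolding eta_part_def dil_def
    by (subst fps_compose_prod_distrib) 
       (simp_all add: fps_compose_sub_distrib mult.assoc flip: fps_compose_power power_mult)
  \<comment> \<open>Coefficient \<open>m\<close> of the dilation reads coefficient
    \<open>m div k\<close> of \<open>eta l\<close>, where the product of \<open>m\<close> factors is
    already exact.\<close>
  have "fps_nth (dil k (eta l)) m = (fps_nth (dil k (eta_part l m)) m :: 'a)"
    using agree_eta_part_eta[of l "m div k" m, where 'a = 'a] assms 
    by (auto simp: dil_nth agree_def)
  also have "\<dots> = fps_nth (eta (k * l)) m"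
    using dp by (simp add: eta_def)
  finally show "fps_nth (dil k (eta l)) m = (fps_nth (eta (k * l)) m :: 'a)" .
qed

definition euler :: "'a::comm_ring_1 fps \<Rightarrow> 'a fps" where
  "euler F = fps_X * fps_deriv F"

lemma euler_nth: "fps_nth (euler F) n = of_nat n * fps_nth F n"
  by (cases n) (simp_all add: euler_def)

lemma euler_add: "euler (F + G) = euler F + euler G"
  by (simp add: euler_def algebra_simps)

lemma euler_diff: "euler (F - G) = euler F - euler G"
  by (simp add: euler_def algebra_simps)

lemma euler_uminus: "euler (- F) = - euler F"
  by (simp add: euler_def)

lemma euler_mult: "euler (F * G) = euler F * G + F * euler G"
  by (simp add: euler_def algebra_simps)

lemma euler_numeral [simp]: "euler (numeral n) = 0"
  by (simp add: euler_def)

lemma euler_one [simp]: "euler 1 = 0"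
  by (simp add: euler_def)

lemma euler_zero [simp]: "euler 0 = 0"
  by (simp add: euler_def)

lemma euler_X [simp]: "euler fps_X = fps_X"
  by (simp add: euler_def)

lemma euler_power: "euler (F ^ n) = of_nat n * F ^ (n - 1) * euler F"
proof (induction n)
  case (Suc n)
  then show ?case by (cases n) (simp_all add: euler_mult algebra_simps)
qed simp

lemma euler_dil:
  assumes "k > 0"
  shows "euler (dil k F) = of_nat k * dil k (euler F)"
  using assms by (auto simp: fps_eq_iff euler_nth dil_nth elim!: dvdE)

text \<open>\<open>sec 4\<close> is the operator U of the overview. As
  \<open>49 * n + 39 = 7 * (7 * n + 5) + 4\<close>, the progression of the theorem is reached by
  \<open>sec 4\<close> followed by \<open>sec 5\<close>.\<close>

definition sec :: "nat \<Rightarrow> 'a fps \<Rightarrow> 'a fps" where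
  "sec r F = Abs_fps (\<lambda>n. fps_nth F (7 * n + r))"

lemma sec_nth [simp]: "fps_nth (sec r F) n = fps_nth F (7 * n + r)"
  by (simp add: sec_def)

lemma sec_add: "sec r (F + G) = sec r F + sec r G"
  by (simp add: fps_eq_iff)

lemma sec_diff: "sec r (F - G) = sec r F - sec r (G :: 'a::comm_ring_1 fps)"
  by (simp add: fps_eq_iff)

lemma sec_mult_numeral: "sec r (numeral k * F) = numeral k * sec r (F :: 'a::comm_ring_1 fps)"
  by (simp add: fps_eq_iff numeral_fps_const)

text \<open>Series in q^7 act as constants for the extraction of a residue class, since shifting an
  exponent by a multiple of 7 keeps its class.\<close>

lemma sec_mult_dil:
  assumes "r < 7"
  shows "sec r (F * dil 7 G) = sec r F * G"
proof (rule fps_ext)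
  fix n
  have "fps_nth (sec r (F * dil 7 G)) n =
    (\<Sum>i\<in>{0..7*n+r}. fps_nth F (7*n+r-i) * fps_nth (dil 7 G) i)"
    by (simp add: fps_mult_nth mult.commute[of F])(simp add: mult.commute)
  also have "\<dots> = (\<Sum>i\<in>(\<lambda>j. 7 * j) ` {0..n}. fps_nth F (7*n+r-i) * fps_nth (dil 7 G) i)"
  proof (rule sum.mono_neutral_right)
    show "\<forall>i\<in>{0..7*n+r} - (\<lambda>j. 7 * j) ` {0..n}. fps_nth F (7*n+r-i) * fps_nth (dil 7 G) i = 0"
    proof
      fix i assume i: "i \<in> {0..7*n+r} - (\<lambda>j. 7 * j) ` {0..n}"
      have "\<not> 7 dvd i"
      proof
        assume "7 dvd i"
        then obtain j where "i = 7 * j" ..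
        moreover from this have "j \<le> n" using i assms by auto
        ultimately show False using i by auto
      qed
      then show "fps_nth F (7*n+r-i) * fps_nth (dil 7 G) i = 0" by (simp add: dil_nth)
    qed
  qed auto
  also have "\<dots> = (\<Sum>j\<in>{0..n}. fps_nth F (7*n+r-7*j) * fps_nth G j)"
    by (subst sum.reindex) (auto simp: inj_on_def dil_nth)
  also have "\<dots> = (\<Sum>j\<in>{0..n}. fps_nth G j * fps_nth (sec r F) (n - j))"
  proof (rule sum.cong)
    fix j assume "j \<in> {0..n}"
    then have "7*n+r-7*j = 7*(n-j)+r" by auto
    then show "fps_nth F (7*n+r-7*j) * fps_nth G j = fps_nth G j * fps_nth (sec r F) (n - j)"
      by simp
  qed simp
  also have "\<dots> = fps_nth (sec r F * G) n"
    by (simp add: fps_mult_nth mult.commute[of "sec r F"])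
  finally show "fps_nth (sec r (F * dil 7 G)) n = fps_nth (sec r F * G) n" .
qed

section \<open>Theta series\<close>

fun gauss_binom :: "'a::comm_ring_1 \<Rightarrow> nat \<Rightarrow> nat \<Rightarrow> 'a" where
  "gauss_binom q n 0 = 1"
| "gauss_binom q 0 (Suc k) = 0"
| "gauss_binom q (Suc n) (Suc k) = gauss_binom q n (Suc k) + q ^ (n - k) * gauss_binom q n k"

lemma gauss_binom_eq_0: "n < k \<Longrightarrow> gauss_binom q n k = 0"
  by (induction q n k rule: gauss_binom.induct) auto

text \<open>The homogeneous form, with both \<open>y\<close> and \<open>z\<close>, allows a monomial
  for \<open>y\<close>; this avoids the negative powers of q in the symmetric triple
  product.\<close>

theorem gauss_binomial_theorem:
  fixes q y z :: "'a::comm_ring_1"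
  shows "(\<Prod>k<N. y + z * q ^ k) =
    (\<Sum>j\<le>N. q ^ (j choose 2) * gauss_binom q N j * z ^ j * y ^ (N - j))"
proof (induction N)
  case (Suc N)
  define t where "t N j = q ^ (j choose 2) * gauss_binom q N j * z ^ j * y ^ (N - j)" for N j
  have "(\<Prod>k<Suc N. y + z * q ^ k) = (\<Sum>j\<le>N. t N j) * (y + z * q ^ N)"
    using Suc by (simp add: t_def)
  also have "\<dots> = (\<Sum>j\<le>N. t N j * y) + (\<Sum>j\<le>N. t N j * z * q ^ N)"
    by (simp add: algebra_simps sum_distrib_left)
  also have "(\<Sum>j\<le>N. t N j * y) =
    (\<Sum>j\<le>Suc N. q ^ (j choose 2) * gauss_binom q N j * z ^ j * y ^ (Suc N - j))"
    by (simp add: gauss_binom_eq_0 t_def) (auto intro!: sum.cong simp: Suc_diff_le algebra_simps)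
  also have "\<dots> = y ^ Suc N +
    (\<Sum>j\<le>N. q ^ (Suc j choose 2) * gauss_binom q N (Suc j) * z ^ Suc j * y ^ (N - j))"
    by (subst sum.atMost_Suc_shift) (simp_all add: binomial_eq_0)
  also have "(\<Sum>j\<le>N. t N j * z * q ^ N) =
    (\<Sum>j\<le>N. q ^ (Suc j choose 2) * (q ^ (N - j) * gauss_binom q N j) * z ^ Suc j * y ^ (N - j))"
  proof (rule sum.cong)
    fix j assume j: "j \<in> {..N}"
    have "(Suc j choose 2) = j + (j choose 2)"
      by (simp add: numeral_2_eq_2)
    then have p: "q ^ (j choose 2) * q ^ N = q ^ (Suc j choose 2) * q ^ (N - j)"
      using j by (simp only: power_add[symmetric]) simp
    have "t N j * z * q ^ N =
        (q ^ (j choose 2) * q ^ N) * (gauss_binom q N j * (z ^ Suc j * y ^ (N - j)))"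
      by (simp add: t_def mult_ac)
    then show "t N j * z * q ^ N = q ^ (Suc j choose 2) * (q ^ (N - j) * gauss_binom q N j) *
        z ^ Suc j * y ^ (N - j)"
      unfolding p by (simp only: mult_ac)
  qed simp
  also have "y ^ Suc N +
      (\<Sum>j\<le>N. q ^ (Suc j choose 2) * gauss_binom q N (Suc j) * z ^ Suc j * y ^ (N - j)) +
      (\<Sum>j\<le>N. q ^ (Suc j choose 2) * (q ^ (N - j) * gauss_binom q N j) * z ^ Suc j * y ^ (N - j)) =
    y ^ Suc N + (\<Sum>j\<le>N. t (Suc N) (Suc j))"
    by (simp add: t_def sum.distrib[symmetric] algebra_simps)
  also have "\<dots> = (\<Sum>j\<le>Suc N. t (Suc N) j)"
    unfolding sum.atMost_Suc_shift by (simp add: t_def binomial_eq_0)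
  finally show ?case by (simp add: t_def)
qed (simp add: binomial_eq_0)

definition qpoch :: "'a::comm_ring_1 \<Rightarrow> nat \<Rightarrow> 'a" where
  "qpoch q n = (\<Prod>j\<in>{1..n}. 1 - q ^ j)"

lemma qpoch_Suc: "qpoch q (Suc n) = qpoch q n * (1 - q ^ Suc n)"
  by (simp add: qpoch_def)

lemma qpoch_0 [simp]: "qpoch q 0 = 1"
  by (simp add: qpoch_def)

lemma gauss_binom_self [simp]: "gauss_binom q n n = 1"
  by (induction n) (simp_all add: gauss_binom_eq_0)

lemma gauss_binom_qpoch:
  "k \<le> n \<Longrightarrow> gauss_binom q n k * (qpoch q k * qpoch q (n - k)) = qpoch q n"
proof (induction n arbitrary: k)
  case (Suc n)
  show ?case
  proof (cases k)
    case (Suc j)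
    show ?thesis
    proof (cases "j = n")
      case False
      with Suc Suc.prems have j: "j < n" by simp
      then have nj: "n - j = Suc (n - Suc j)" by simp
      have pw: "q ^ (n - j) * q ^ Suc j = q ^ Suc n"
        using j by (simp add: power_add[symmetric] del: power_Suc)
      have "gauss_binom q (Suc n) k * (qpoch q k * qpoch q (Suc n - k)) =
        (gauss_binom q n (Suc j) * (qpoch q (Suc j) * qpoch q (n - Suc j))) * (1 - q ^ (n - j))
        + (gauss_binom q n j * (qpoch q j * qpoch q (n - j))) * (q ^ (n - j) - q ^ (n - j) * q ^
            Suc j)"
        unfolding Suc by (simp add: nj qpoch_Suc algebra_simps)
      also have "\<dots> = qpoch q n * (1 - q ^ Suc n)"
        using j unfolding pw by (subst (1 2) Suc.IH) (auto simp: algebra_simps)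
      finally show ?thesis by (simp add: qpoch_Suc)
    next
      case True
      then show ?thesis using Suc by simp
    qed
  qed simp
qed simp

lemma qpoch_X_power: "qpoch (fps_X ^ b) n = eta_part b n"
  by (simp add: qpoch_def eta_part_def power_mult)

text \<open>Since \<open>k\<close>, \<open>n - k\<close> and \<open>n\<close> are at least
  \<open>M\<close>, all finite products in \<open>gauss_binom_qpoch\<close> agree with
  \<open>eta b\<close>, and one factor \<open>eta b\<close> cancels.\<close>

lemma agree_gauss_binom_eta:
  assumes "b \<ge> 1" "M \<le> k" "k + M \<le> n"
  shows "agree M (gauss_binom (fps_X ^ b) n k * eta b) (1 :: 'a::field fps)"
proof (rule agree_cancel)
  have "agree M (gauss_binom (fps_X ^ b) n k * (eta b * eta b))
          (gauss_binom (fps_X ^ b) n k * (eta_part b k * eta_part b (n - k)) :: 'a fps)"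
    using assms by (intro agree_mult agree_refl agree_sym[OF agree_eta_part_eta]) auto
  also have "\<dots> = eta_part b n"
    using gauss_binom_qpoch[of k n "fps_X ^ b :: 'a fps"] assms by (simp add: qpoch_X_power)
  also have "agree M \<dots> (eta b)" using assms by (intro agree_eta_part_eta) auto
  finally show "agree M (gauss_binom (fps_X ^ b) n k * eta b * eta b) (1 * eta b :: 'a fps)"
    by (simp add: mult.assoc)
qed simp

section \<open>Theta series and the triple product\<close>

text \<open>The formal sum of \<open>s i * q ^ e i\<close>. It has this meaning only if the fibres
  of \<open>e\<close> are finite, as a sum over an infinite set is 0 by default; hence the
  finiteness conditions and growth bounds below.\<close>

definition theta_series :: "('i \<Rightarrow> nat) \<Rightarrow> ('i \<Rightarrow> 'a::comm_ring_1) \<Rightarrow> 'a fps" where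
  "theta_series e s = Abs_fps (\<lambda>m. \<Sum>i | e i = m. s i)"

lemma theta_series_nth: "fps_nth (theta_series e s) m = (\<Sum>i | e i = m. s i)"
  by (simp add: theta_series_def)

lemma agree_theta_series:
  assumes "finite A" "\<And>i. e i \<le> M \<Longrightarrow> i \<in> A"
  shows "agree M (\<Sum>i\<in>A. fps_const (s i) * fps_X ^ e i) (theta_series e s)"
  unfolding agree_def
proof (intro allI impI)
  fix m assume m: "m \<le> M"
  have "fps_nth (\<Sum>i\<in>A. fps_const (s i) * fps_X ^ e i) m = (\<Sum>i\<in>A. if e i = m then s i else 0)"
    by (auto simp: fps_sum_nth intro!: sum.cong)
  also have "\<dots> = (\<Sum>i\<in>{i\<in>A. e i = m}. s i)"
    using assms by (simp add: sum.inter_filter)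
  also have "{i\<in>A. e i = m} = {i. e i = m}" using assms m by auto
  finally show "fps_nth (\<Sum>i\<in>A. fps_const (s i) * fps_X ^ e i) m = fps_nth (theta_series e s) m"
    by (simp add: theta_series_nth)
qed

lemma quadratic_exponent_bound:
  fixes e :: "int \<Rightarrow> nat"
  assumes "\<And>i. 2 * int (e i) = int b * i * (i - 1) + 2 * int a * i" "0 < a" "a < b"
  shows "\<bar>i\<bar> \<le> int (e i)"
proof (cases "i \<ge> 1")
  case True
  have "0 \<le> int b * i * (i - 1)" using True by simp
  moreover have "i * 1 \<le> i * int a" using True assms by (intro mult_left_mono) auto
  moreover have "2 * int (e i) = int b * i * (i - 1) + 2 * (i * int a)" by (simp add: assms)
  ultimately show ?thesis using True by linarith
next
  case False
  define k where "k = - i"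
  have k: "k \<ge> 0" using False by (simp add: k_def)
  have "2 * int (e i) = int b * k * (k + 1) - 2 * int a * k"
    unfolding assms(1) k_def by (simp add: algebra_simps)
  also have "\<dots> = k * (int b * (k - 1)) + 2 * (k * (int b - int a))"
    by (simp add: algebra_simps)
  finally have eq: "2 * int (e i) = k * (int b * (k - 1)) + 2 * (k * (int b - int a))" .
  have "0 \<le> k * (int b * (k - 1))"
    using k by (cases "k = 0") auto
  moreover have "k * 1 \<le> k * (int b - int a)" using k assms by (intro mult_left_mono) auto
  ultimately show ?thesis using eq k_def False by linarith
qed

text \<open>This is \<open>gauss_binomial_theorem\<close> with base q^b, \<open>y = q^(b n)\<close>,
  \<open>z = c q^a\<close> and \<open>2 n\<close> factors: the two halves become the two products,
  and a common monomial cancels. As \<open>c * c = 1\<close>, powers of \<open>c\<close> with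
  negative exponent can be written with an absolute value.\<close>

theorem jacobi_triple_product_finite:
  fixes c :: "'a::field" and e :: "int \<Rightarrow> nat"
  assumes e: "\<And>i. 2 * int (e i) = int b * i * (i - 1) + 2 * int a * i"
    and ab: "0 < a" "a < b" and c: "c * c = 1"
  shows "(\<Prod>k<n. 1 + fps_const c * fps_X ^ (b * k + (b - a))) *
      (\<Prod>k<n. 1 + fps_const c * fps_X ^ (b * k + a)) =
    (\<Sum>j\<le>2*n. gauss_binom (fps_X ^ b) (2 * n) j *
       (fps_const (c ^ nat \<bar>int j - int n\<bar>) * fps_X ^ e (int j - int n)))"
proof -
  define C where "C = fps_const c"
  \<comment> \<open>The exponent of the monomial split off: \<open>a + b k\<close> from each factor
    of the first half, \<open>b n\<close> from each of the second.\<close>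
  define T where "T = (\<Sum>k<n. a + b * k) + b * n * n"
  have cC: "C * C = 1" using c by (simp add: C_def fps_const_mult flip: fps_const_1_eq_1)
  have "c \<noteq> 0" using c by auto
  then have C0: "C \<noteq> 0" by (simp add: C_def)
  have T2: "2 * int T = 2 * int a * int n + int b * int n * (int n - 1) + 2 * int b * int n * int n"
    unfolding T_def by (induction n) (auto simp: algebra_simps)
  have split: "(\<Prod>k<2*n. h k) = (\<Prod>k<n. h k) * (\<Prod>k<n. h (n + k))" for h :: "nat \<Rightarrow> 'a fps"
    using prod.atLeastLessThan_concat[of 0 n "2*n" h] prod.shift_bounds_nat_ivl[of h 0 n n]
    by (simp add: lessThan_atLeast0 mult_2 add.commute)
  \<comment> \<open>In the first half the lower power is \<open>q^(a + b k)\<close>; splitting it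
    off reverses the order of the factors, and \<open>C * C = 1\<close> moves \<open>C\<close> into
    the bracket.\<close>
  have f1: "fps_X ^ (b * n) + C * fps_X ^ a * (fps_X ^ b) ^ k =
      C * fps_X ^ (a + b * k) * (1 + C * fps_X ^ (b * (n - Suc k) + (b - a)))" if "k < n" for k
  proof -
    have "b * n = a + b * k + (b * (n - Suc k) + (b - a))"
    proof -
      have "n = Suc k + (n - Suc k)" using that by simp
      then have "b * n = b * (Suc k + (n - Suc k))" by simp
      then show ?thesis using ab by (simp add: algebra_simps)
    qed
    then have "fps_X ^ (b * n) =
        (C * C) * (fps_X ^ (a + b * k) * fps_X ^ (b * (n - Suc k) + (b - a)))"
      using cC by (simp add: power_add)
    then show ?thesis by (simp add: algebra_simps power_add power_mult)
  qed
  have f2: "fps_X ^ (b * n) + C * fps_X ^ a * (fps_X ^ b) ^ (n + k) =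
      fps_X ^ (b * n) * (1 + C * fps_X ^ (b * k + a))" for k
    by (simp add: algebra_simps power_add power_mult)
  have "(\<Prod>k<2*n. fps_X ^ (b * n) + C * fps_X ^ a * (fps_X ^ b) ^ k) =
     (\<Prod>k<n. C * fps_X ^ (a + b * k) * (1 + C * fps_X ^ (b * (n - Suc k) + (b - a)))) *
     (\<Prod>k<n. fps_X ^ (b * n) * (1 + C * fps_X ^ (b * k + a)))"
    unfolding split using f1 f2 by (intro arg_cong2[where f = "(*)"] prod.cong) auto
  also have "\<dots> = (C ^ n * fps_X ^ T) *
     ((\<Prod>k<n. 1 + C * fps_X ^ (b * (n - Suc k) + (b - a))) *
     (\<Prod>k<n. 1 + C * fps_X ^ (b * k + a)))"
  proof -
    have g1: "(\<Prod>k<n. C * fps_X ^ (a + b * k) * g k) =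
        C ^ n * fps_X ^ (\<Sum>k<n. a + b * k) * prod g {..<n}"
      for g :: "nat \<Rightarrow> 'a fps"
      by (simp only: prod.distrib power_sum) simp
    have g2: "(\<Prod>k<n. fps_X ^ (b * n) * g k) = fps_X ^ (b * n * n) * prod g {..<n}"
      for g :: "nat \<Rightarrow> 'a fps"
      by (simp only: prod.distrib power_mult) simp
    have "fps_X ^ T = fps_X ^ (\<Sum>k<n. a + b * k) * (fps_X ^ (b * n * n) :: 'a fps)"
      by (simp only: T_def power_add)
    then show ?thesis unfolding g1 g2 by (simp only: mult_ac)
  qed
  also have "(\<Prod>k<n. 1 + C * fps_X ^ (b * (n - Suc k) + (b - a))) =
      (\<Prod>k<n. 1 + C * fps_X ^ (b * k + (b - a)))"
    by (rule prod.nat_diff_reindex)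
  finally have L: "(\<Prod>k<2*n. fps_X ^ (b * n) + C * fps_X ^ a * (fps_X ^ b) ^ k) =
    (C ^ n * fps_X ^ T) * ((\<Prod>k<n. 1 + C * fps_X ^ (b * k + (b - a))) *
     (\<Prod>k<n. 1 + C * fps_X ^ (b * k + a)))" .
  have "(\<Prod>k<2*n. fps_X ^ (b * n) + C * fps_X ^ a * (fps_X ^ b) ^ k) =
    (\<Sum>j\<le>2*n. (fps_X ^ b) ^ (j choose 2) * gauss_binom (fps_X ^ b) (2*n) j *
       (C * fps_X ^ a) ^ j * (fps_X ^ (b * n)) ^ (2*n - j))"
    by (rule gauss_binomial_theorem)
  also have "\<dots> = (\<Sum>j\<le>2*n. (C ^ n * fps_X ^ T) * (gauss_binom (fps_X ^ b) (2*n) j *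
      (C ^ nat \<bar>int j - int n\<bar> * fps_X ^ e (int j - int n))))"
  proof (rule sum.cong)
    fix j assume j: "j \<in> {..2*n}"
    have ch: "2 * int (j choose 2) = int j * (int j - 1)"
      by (induction j) (auto simp: numeral_2_eq_2 algebra_simps)
    have "2 * int (b * (j choose 2) + a * j + b * n * (2*n - j)) =
        int b * (2 * int (j choose 2)) + 2 * int a * int j + 2 * int b * int n * (2 * int n - int
            j)"
    proof -
      have "int (2*n - j) = 2 * int n - int j" using j by simp
      then show ?thesis unfolding of_nat_add of_nat_mult by (simp add: algebra_simps)
    qed
    also have "\<dots> = 2 * int (T + e (int j - int n))"
      unfolding of_nat_add distrib_left e T2 ch by (simp add: algebra_simps)
    finally have ex: "b * (j choose 2) + a * j + b * n * (2*n - j) = T + e (int j - int n)"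
      by (simp only: mult_cancel_left of_nat_eq_iff) simp
    have cj: "C ^ j = C ^ n * C ^ nat \<bar>int j - int n\<bar>"
    proof (cases "n \<le> j")
      case True
      then have "j = n + nat \<bar>int j - int n\<bar>" by simp
      then show ?thesis by (metis power_add)
    next
      case False
      define d where "d = n - j"
      have nj: "n = j + d" using False by (simp add: d_def)
      have "C ^ d * C ^ d = 1" by (simp add: cC flip: power_mult_distrib)
      moreover have "nat \<bar>int j - int n\<bar> = d" by (simp add: nj)
      ultimately show ?thesis by (simp add: nj power_add mult.assoc)
    qed
    have "(fps_X ^ b) ^ (j choose 2) * gauss_binom (fps_X ^ b) (2*n) j *
       (C * fps_X ^ a) ^ j * (fps_X ^ (b * n)) ^ (2*n - j) =
       gauss_binom (fps_X ^ b) (2*n) j * (C ^ j * fps_X ^ (b * (j choose 2) + a * j + b * n * (2*n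
           - j)))"
      by (simp add: power_add power_mult power_mult_distrib)
    then show "(fps_X ^ b) ^ (j choose 2) * gauss_binom (fps_X ^ b) (2*n) j *
       (C * fps_X ^ a) ^ j * (fps_X ^ (b * n)) ^ (2*n - j) =
       (C ^ n * fps_X ^ T) * (gauss_binom (fps_X ^ b) (2*n) j *
      (C ^ nat \<bar>int j - int n\<bar> * fps_X ^ e (int j - int n)))"
      unfolding ex cj by (simp only: power_add mult_ac)
  qed simp
  finally have "(C ^ n * fps_X ^ T) * ((\<Prod>k<n. 1 + C * fps_X ^ (b * k + (b - a))) *
     (\<Prod>k<n. 1 + C * fps_X ^ (b * k + a))) = (C ^ n * fps_X ^ T) *
      (\<Sum>j\<le>2*n. gauss_binom (fps_X ^ b) (2*n) j *
      (C ^ nat \<bar>int j - int n\<bar> * fps_X ^ e (int j - int n)))"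
    by (simp add: L sum_distrib_left)
  then have "(\<Prod>k<n. 1 + C * fps_X ^ (b * k + (b - a))) * (\<Prod>k<n. 1 + C * fps_X ^ (b * k + a)) =
      (\<Sum>j\<le>2*n. gauss_binom (fps_X ^ b) (2*n) j *
      (C ^ nat \<bar>int j - int n\<bar> * fps_X ^ e (int j - int n)))"
    using C0 by simp
  then show ?thesis by (simp add: C_def fps_const_power)
qed

text \<open>Multiplication by \<open>eta b\<close> turns each Gaussian coefficient with index far
  from both ends into 1; the terms near the ends have exponents above \<open>M\<close>.\<close>

theorem jacobi_triple_product:
  fixes c :: "'a::field" and e :: "int \<Rightarrow> nat"
  assumes e: "\<And>i. 2 * int (e i) = int b * i * (i - 1) + 2 * int a * i"
    and ab: "0 < a" "a < b" and c: "c * c = 1" and n: "2 * M \<le> n"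
  shows "agree M (eta b * ((\<Prod>k<n. 1 + fps_const c * fps_X ^ (b * k + (b - a))) *
      (\<Prod>k<n. 1 + fps_const c * fps_X ^ (b * k + a)))) (theta_series e (\<lambda>i. c ^ nat \<bar>i\<bar>))"
proof -
  note bound = quadratic_exponent_bound[OF e ab]
  define t where "t i = fps_const (c ^ nat \<bar>i\<bar>) * fps_X ^ e i" for i
  have "eta b * ((\<Prod>k<n. 1 + fps_const c * fps_X ^ (b * k + (b - a))) *
      (\<Prod>k<n. 1 + fps_const c * fps_X ^ (b * k + a))) =
    (\<Sum>j\<le>2*n. (gauss_binom (fps_X ^ b) (2*n) j * eta b) * t (int j - int n))"
    unfolding jacobi_triple_product_finite[OF e ab c] t_def
    by (simp add: sum_distrib_left mult_ac)
  also have "agree M \<dots> (\<Sum>j\<le>2*n. t (int j - int n))"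
  proof (rule agree_sum)
    fix j assume j: "j \<in> {..2*n}"
    show "agree M (gauss_binom (fps_X ^ b) (2*n) j * eta b * t (int j - int n)) (t (int j - int n))"
    proof (cases "e (int j - int n) \<le> M")
      case True
      then have "\<bar>int j - int n\<bar> \<le> int M" using bound[of "int j - int n"] by linarith
      then have "M \<le> j" "j + M \<le> 2 * n" using n by linarith+
      then have "agree M (gauss_binom (fps_X ^ b) (2*n) j * eta b * t (int j - int n))
          (1 * t (int j - int n))"
        using ab by (intro agree_mult agree_gauss_binom_eta) auto
      then show ?thesis by simp
    next
      case False
      then have 0: "agree M (t (int j - int n)) 0"
        by (auto simp: agree_def t_def)
      have "agree M (gauss_binom (fps_X ^ b) (2*n) j * eta b * t (int j - int n))
          (gauss_binom (fps_X ^ b) (2*n) j * eta b * 0)"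
        by (intro agree_mult agree_refl 0)
      also have "agree M \<dots> (t (int j - int n))" using 0 by (simp add: agree_sym)
      finally show ?thesis .
    qed
  qed
  also have "(\<Sum>j\<le>2*n. t (int j - int n)) = (\<Sum>i\<in>{- int n..int n}. t i)"
    by (rule sum.reindex_bij_witness[of _ "\<lambda>i. nat (i + int n)" "\<lambda>j. int j - int n"]) auto
  also have "agree M \<dots> (theta_series e (\<lambda>i. c ^ nat \<bar>i\<bar>))"
    unfolding t_def
  proof (rule agree_theta_series)
    fix i assume "e i \<le> M"
    then show "i \<in> {- int n..int n}" using bound[of i] n by (auto simp: abs_le_iff)
  qed simp
  finally show ?thesis .
qed

section \<open>The series of Euler and Gauss\<close>

lemma fps_const_minus_one_mult: "fps_const (-1) * F = - (F :: 'a::comm_ring_1 fps)"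
  by (simp add: fps_eq_iff)

lemma eta_part_0 [simp]: "eta_part k 0 = 1"
  by (simp add: eta_part_def)

lemma eta_part_Suc: "eta_part k (Suc n) = eta_part k n * (1 - fps_X ^ (k * Suc n))"
  by (simp add: eta_part_def)

lemma eta_part_dissect_2:
  "eta_part k (2 * n) = eta_part (2 * k) n * (\<Prod>i<n. 1 - fps_X ^ (2 * k * i + k))"
proof (induction n)
  case (Suc n)
  have e1: "2 * Suc n = Suc (Suc (2 * n))" by simp
  have e2: "k * Suc (2 * n) = 2 * k * n + k" "k * Suc (Suc (2 * n)) = 2 * k * Suc n"
    by (simp_all add: algebra_simps)
  show ?case
    unfolding e1 eta_part_Suc e2 prod.lessThan_Suc Suc by (simp only: mult_ac)
qed simp

lemma eta_part_dissect_3: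
  "eta_part 1 (3 * n) =
    eta_part 3 n * ((\<Prod>k<n. 1 - fps_X ^ (3 * k + 2)) * (\<Prod>k<n. 1 - fps_X ^ (3 * k + 1)))"
proof (induction n)
  case (Suc n)
  have e1: "3 * Suc n = Suc (Suc (Suc (3 * n)))" by simp
  have e2: "1 * Suc (3 * n) = 3 * n + 1" "1 * Suc (Suc (3 * n)) = 3 * n + 2"
    "1 * Suc (Suc (Suc (3 * n))) = 3 * Suc n"
    by simp_all
  show ?case
    unfolding e1 eta_part_Suc e2 prod.lessThan_Suc Suc by (simp only: mult_ac)
qed simp

text \<open>The triple product with \<open>b = 3\<close>, \<open>a = 1\<close>,
  \<open>c = -1\<close>; the exponents 0, 2 and 1 modulo 3 together make up
  \<open>eta 1\<close>.\<close>

theorem pentagonal_number_theorem: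
  "eta 1 = theta_series (\<lambda>i::int. nat (i * (3 * i - 1) div 2)) (\<lambda>i. (-1 :: 'a::field) ^ nat \<bar>i\<bar>)"
proof (rule agree_eqI)
  fix M :: nat
  let ?e = "\<lambda>i::int. nat (i * (3 * i - 1) div 2)"
  have e: "2 * int (?e i) = int 3 * i * (i - 1) + 2 * int 1 * i" for i
  proof -
    have "even (i * (3 * i - 1))" by simp
    moreover have "0 \<le> i * (3 * i - 1)" by (auto simp: zero_le_mult_iff)
    ultimately show ?thesis by (simp add: algebra_simps)
  qed
  have "agree M (eta 1 :: 'a fps) (eta_part 1 (3 * (2 * M)))"
    by (rule agree_sym, rule agree_eta_part_eta) auto
  also have "eta_part 1 (3 * (2 * M)) = eta_part 3 (2 * M) *
     ((\<Prod>k<2*M. 1 - fps_X ^ (3 * k + 2)) * (\<Prod>k<2*M. 1 - fps_X ^ (3 * k + 1)) :: 'a fps)"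
    by (rule eta_part_dissect_3)
  also have "agree M \<dots> (eta 3 *
     ((\<Prod>k<2*M. 1 - fps_X ^ (3 * k + 2)) * (\<Prod>k<2*M. 1 - fps_X ^ (3 * k + 1))))"
    by (intro agree_mult agree_eta_part_eta agree_refl) auto
  also have "agree M \<dots> (theta_series ?e (\<lambda>i. (-1) ^ nat \<bar>i\<bar>))"
    using jacobi_triple_product[OF e, of "-1 :: 'a" M "2 * M"]
    by (simp add: fps_const_minus_one_mult)
  finally show "agree M (eta 1 :: 'a fps) (theta_series ?e (\<lambda>i. (-1) ^ nat \<bar>i\<bar>))" .
qed

text \<open>The triple product with \<open>b = 2\<close>, \<open>a = 1\<close>,
  \<open>c = -1\<close>: both products run over the odd exponents, and a second factor
  \<open>eta 2\<close> completes the square.\<close>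

theorem gauss_squares:
  "eta 2 * theta_series (\<lambda>i::int. nat (i ^ 2)) (\<lambda>i. (-1 :: 'a::field) ^ nat \<bar>i\<bar>) = eta 1 ^ 2"
proof (rule agree_eqI)
  fix M :: nat
  let ?O = "(\<Prod>k<2*M. 1 - fps_X ^ (2 * k + 1)) :: 'a fps"
  have e: "2 * int (nat (i ^ 2)) = int 2 * i * (i - 1) + 2 * int 1 * i" for i
    by (simp add: algebra_simps power2_eq_square)
  have "agree M (eta 2 * theta_series (\<lambda>i::int. nat (i ^ 2)) (\<lambda>i. (-1 :: 'a) ^ nat \<bar>i\<bar>))
     (eta_part 2 (2 * M) * (eta 2 * (?O * ?O)))"
    using jacobi_triple_product[OF e, of "-1 :: 'a" M "2 * M"] 
    by (intro agree_mult agree_sym[OF agree_eta_part_eta])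
      (auto intro: agree_sym simp: fps_const_minus_one_mult)
  also have "agree M \<dots> (eta_part 2 (2 * M) * (eta_part 2 (2 * M) * (?O * ?O)))"
    by (intro agree_mult agree_sym[OF agree_eta_part_eta] agree_refl) auto
  also have "\<dots> = eta_part 1 (2 * (2 * M)) ^ 2"
    unfolding eta_part_dissect_2[of 1] by (simp add: power2_eq_square mult_ac)
  also have "agree M \<dots> (eta 1 ^ 2)"
    by (intro agree_power agree_eta_part_eta) auto
  finally show "agree M (eta 2 * theta_series (\<lambda>i::int. nat (i ^ 2)) (\<lambda>i. (-1 :: 'a) ^ nat \<bar>i\<bar>))
      (eta 1 ^ 2)" .
qed

text \<open>By \<open>(1 - x) * (1 + x) = 1 - x ^ 2\<close>, the odd exponents turn into those
  congruent to 2 and 6 modulo 8, that is, to 2 modulo 4; the even factors form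
  \<open>eta_part 2\<close>.\<close>

lemma eta_part_dissect_4:
  "eta_part 1 (4 * n) * ((\<Prod>k<n. 1 + fps_X ^ (4 * k + 3)) * (\<Prod>k<n. 1 + fps_X ^ (4 * k + 1))) =
    (\<Prod>k<2*n. 1 - fps_X ^ (4 * k + 2)) * (eta_part 2 (2 * n) :: 'a::comm_ring_1 fps)"
proof (induction n)
  case (Suc n)
  define x where "x = (fps_X :: 'a fps) ^ (4 * n)"
  have x: "fps_X ^ (4 * n + r) = x * fps_X ^ r" "fps_X ^ (8 * n + r) = x * x * fps_X ^ r" for r
    by (simp_all only: x_def power_add[symmetric]) (simp_all add: add_ac)
  define X where "X = (fps_X :: 'a fps)"
  define A where "A = (eta_part 1 (4 * n) :: 'a fps)"
  define B where "B = (\<Prod>k<n. 1 + X ^ (4 * k + 3))"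
  define C where "C = (\<Prod>k<n. 1 + X ^ (4 * k + 1))"
  define D where "D = (\<Prod>k<2*n. 1 - X ^ (4 * k + 2))"
  define E where "E = (eta_part 2 (2 * n) :: 'a fps)"
  have IH: "A * (B * C) = D * E" using Suc by (simp add: A_def B_def C_def D_def E_def X_def)
  have h1: "eta_part 1 (4 * Suc n) =
      A * ((1 - x * X) * (1 - x * X^2) * (1 - x * X^3) * (1 - x * X^4))"
  proof -
    have e1: "4 * Suc n = Suc (Suc (Suc (Suc (4 * n))))" by simp
    have e2: "1 * Suc (4 * n) = 4 * n + 1" "1 * Suc (Suc (4 * n)) = 4 * n + 2"
      "1 * Suc (Suc (Suc (4 * n))) = 4 * n + 3" "1 * Suc (Suc (Suc (Suc (4 * n)))) = 4 * n + 4"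
      by simp_all
    have "eta_part 1 (4 * Suc n) =
        A * (1 - X ^ (4*n+1)) * (1 - X ^ (4*n+2)) * (1 - X ^ (4*n+3)) * (1 - X ^ (4*n+4))"
      unfolding e1 eta_part_Suc e2 A_def X_def ..
    then show ?thesis unfolding X_def x(1) by (simp add: mult_ac)
  qed
  have h2: "(\<Prod>k<Suc n. 1 + X ^ (4 * k + 3)) = B * (1 + x * X^3)"
    "(\<Prod>k<Suc n. 1 + X ^ (4 * k + 1)) = C * (1 + x * X)"
    unfolding B_def C_def X_def prod.lessThan_Suc x(1) by simp_all
  have h3: "(\<Prod>k<2*Suc n. 1 - X ^ (4 * k + 2)) = D * ((1 - x * x * X ^ 2) * (1 - x * x * X ^ 6))"
  proof -
    have e1: "2 * Suc n = Suc (Suc (2 * n))" by simp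
    have e2: "4 * (2 * n) + 2 = 8 * n + 2" "4 * Suc (2 * n) + 2 = 8 * n + 6" by simp_all
    have "(\<Prod>k<2*Suc n. 1 - X ^ (4 * k + 2)) = D * ((1 - X ^ (8*n+2)) * (1 - X ^ (8*n+6)))"
      unfolding e1 prod.lessThan_Suc e2 D_def by (simp only: mult_ac)
    then show ?thesis unfolding X_def x(2) .
  qed
  have h4: "eta_part 2 (2 * Suc n) = E * ((1 - x * X^2) * (1 - x * X^4))"
  proof -
    have e1: "2 * Suc n = Suc (Suc (2 * n))" by simp
    have e2: "2 * Suc (2 * n) = 4 * n + 2" "2 * Suc (Suc (2 * n)) = 4 * n + 4" by simp_all
    have "eta_part 2 (2 * Suc n) = E * ((1 - X ^ (4*n+2)) * (1 - X ^ (4*n+4)))"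
      unfolding e1 eta_part_Suc e2 E_def X_def by (simp only: mult_ac)
    then show ?thesis unfolding X_def x(1) .
  qed
  have h5: "A * ((1 - x * X) * (1 - x * X^2) * (1 - x * X^3) * (1 - x * X^4)) *
      (B * (1 + x * X^3) * (C * (1 + x * X))) =
     (A * (B * C)) * (((1 - x * X) * (1 + x * X)) * ((1 - x * X^3) * (1 + x * X^3)) * ((1 - x *
         X^2) * (1 - x * X^4)))"
    by (simp only: mult_ac)
  have h6: "(1 - x * X) * (1 + x * X) = 1 - x * x * X^2" "(1 - x * X^3) * (1 + x * X^3) =
      1 - x * x * X^6"
    by (simp_all add: algebra_simps power2_eq_square power3_eq_cube eval_nat_numeral)
  show ?case unfolding X_def[symmetric] h1 h2 h3 h4 h5 IH h6 by (simp only: mult_ac)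
qed (simp add: eta_part_def)

text \<open>The triple product with \<open>b = 4\<close>, \<open>a = 1\<close>,
  \<open>c = 1\<close>. Over the integers, \<open>i * (2 * i - 1)\<close> takes each triangular
  number exactly once.\<close>

theorem gauss_triangular:
  "eta 1 * theta_series (\<lambda>i::int. nat (i * (2 * i - 1))) (\<lambda>i. 1 :: 'a::field) = eta 2 ^ 2"
proof (rule agree_eqI)
  fix M :: nat
  let ?P = "(\<Prod>k<2*M. 1 + fps_X ^ (4 * k + 3)) * (\<Prod>k<2*M. 1 + fps_X ^ (4 * k + 1)) :: 'a fps"
  let ?D = "(\<Prod>k<2*(2*M). 1 - fps_X ^ (4 * k + 2)) :: 'a fps"
  have e: "2 * int (nat (i * (2 * i - 1))) = int 4 * i * (i - 1) + 2 * int 1 * i" for i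
  proof -
    have "0 \<le> i * (2 * i - 1)" by (auto simp: zero_le_mult_iff)
    then show ?thesis by (simp add: algebra_simps)
  qed
  have "agree M (eta 1 * theta_series (\<lambda>i::int. nat (i * (2 * i - 1))) (\<lambda>i. 1 :: 'a))
     (eta_part 1 (4 * (2 * M)) * (eta 4 * ?P))"
    using jacobi_triple_product[OF e, of "1 :: 'a" M "2 * M"] 
    by (intro agree_mult agree_sym[OF agree_eta_part_eta]) (auto intro: agree_sym)
  also have "agree M \<dots> (eta_part 1 (4 * (2 * M)) * (eta_part 4 (2 * (2 * M)) * ?P))"
    by (intro agree_mult agree_sym[OF agree_eta_part_eta] agree_refl) auto
  also have "\<dots> = eta_part 4 (2 * (2 * M)) * (eta_part 1 (4 * (2 * M)) * ?P)"
    by (simp only: mult_ac)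
  also have "\<dots> = eta_part 2 (2 * (2 * (2 * M))) * eta_part 2 (2 * (2 * M))"
    unfolding eta_part_dissect_4 eta_part_dissect_2[of 2 "2 * (2 * M)"] by (simp add: mult_ac)
  also have "agree M \<dots> (eta 2 * eta 2)"
    by (intro agree_mult agree_eta_part_eta) auto
  finally show "agree M (eta 1 * theta_series (\<lambda>i::int. nat (i * (2 * i - 1))) (\<lambda>i. 1 :: 'a))
      (eta 2 ^ 2)" by (simp add: power2_eq_square)
qed

section \<open>Jacobi's series for the cube\<close>

lemma gauss_binom_const_poly: "gauss_binom [:q:] n k = [:gauss_binom q n k:]"
  by (induction q n k rule: gauss_binom.induct) (simp_all add: poly_const_pow one_pCons)

text \<open>The product of \<open>X ^ n + z * X ^ k\<close> over \<open>k < 2 n + 1\<close> is a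
  polynomial in \<open>z\<close> that vanishes at \<open>z = -1\<close> through the factor
  \<open>k = n\<close>. Its derivative there is, up to sign and a power of q, the square of
  \<open>eta_part 1 n\<close>; the right-hand side is the derivative of the expanded form.\<close>

lemma jacobi_cube_finite:
  fixes n :: nat
  defines "g \<equiv> gauss_binom (fps_X :: 'a::field fps) (2 * n + 1)"
  shows "eta_part 1 n ^ 2 = (\<Sum>i\<le>n. (-1) ^ i * fps_X ^ (i * (i + 1) div 2) *
     (of_nat (n + 1 + i) * g (n + 1 + i) - of_nat (n - i) * g (n - i)))"
proof -
  define X where "X = (fps_X :: 'a fps)"
  define T where "T = n + \<Sum>{..<n} + n * n"
  define c where "c j = X ^ (j choose 2) * g j * X ^ (n * (2 * n + 1 - j))" for j
  have T2: "2 * T = 2 * n + n * (n - 1) + 2 * n * n"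
  proof -
    have "2 * \<Sum>{..<n} = n * (n - 1)"
      by (induction n) (auto simp: algebra_simps)
    then show ?thesis by (simp add: T_def)
  qed
  define P where "P = (\<Prod>k<2*n+1. [:X ^ n:] + [:0, 1:] * [:X:] ^ k)"
  have P1: "P = (\<Sum>j\<le>2*n+1. monom (c j) j)"
    unfolding P_def gauss_binomial_theorem
  proof (rule sum.cong)
    fix j assume "j \<in> {..2*n+1}"
    have "[:X:] ^ (j choose 2) * gauss_binom [:X:] (2 * n + 1) j * [:0, 1:] ^ j * [:X ^ n:] ^ (2 *
        n + 1 - j)
      = smult (c j) ([:0, 1:] ^ j)"
      by (simp add: c_def g_def X_def gauss_binom_const_poly poly_const_pow power_mult mult_ac)
    then show "[:X:] ^ (j choose 2) * gauss_binom [:X:] (2 * n + 1) j * [:0, 1:] ^ j * [:X ^ n:] ^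
        (2 * n + 1 - j)
      = monom (c j) j"
      by (simp add: monom_altdef)
  qed simp
  have ind: "{..<2*n+1} - {n} = {..<n} \<union> {n+1..<2*n+1}" by auto
  define Q where "Q = (\<Prod>k\<in>{..<2*n+1} - {n}. [:X ^ n, X ^ k:])"
  have lin: "[:X ^ n:] + [:0, 1:] * [:X:] ^ k = [:X ^ n, X ^ k:]" for k
    by (simp add: poly_const_pow)
  have P2: "P = [:X ^ n, X ^ n:] * Q"
    unfolding P_def Q_def lin by (rule prod.remove) auto
  have "poly (pderiv P) (-1) = X ^ n * poly Q (-1)"
    unfolding P2 pderiv_mult by (simp add: pderiv_pCons)
  also have "poly Q (-1) = (\<Prod>k<n. X ^ n - X ^ k) * (\<Prod>k\<in>{n+1..<2*n+1}. X ^ n - X ^ k)"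
    unfolding Q_def poly_prod ind by (subst prod.union_disjoint) auto
  also have "(\<Prod>k<n. X ^ n - X ^ k) = (\<Prod>k<n. (- 1) * X ^ k * (1 - X ^ Suc (n - Suc k)))"
  proof (rule prod.cong)
    fix k assume "k \<in> {..<n}"
    then have "X ^ n = X ^ k * X ^ Suc (n - Suc k)"
      by (simp flip: power_add power_Suc)
    then show "X ^ n - X ^ k = (- 1) * X ^ k * (1 - X ^ Suc (n - Suc k))"
      by (simp add: algebra_simps)
  qed simp
  also have "\<dots> = (-1) ^ n * X ^ \<Sum>{..<n} * (\<Prod>k<n. 1 - X ^ Suc (n - Suc k))"
    by (simp only: prod.distrib power_sum) simp
  also have "(\<Prod>k<n. 1 - X ^ Suc (n - Suc k)) = (\<Prod>k<n. 1 - X ^ Suc k)"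
    by (rule prod.nat_diff_reindex)
  also have "(\<Prod>k<n. 1 - X ^ Suc k) = eta_part 1 n"
    unfolding eta_part_def X_def by (simp add: prod.atLeast1_atMost_eq)
  also have "(\<Prod>k\<in>{n+1..<2*n+1}. X ^ n - X ^ k) = (\<Prod>k<n. X ^ n * (1 - X ^ Suc k))"
  proof (rule prod.reindex_bij_witness[of _ "\<lambda>k. n + Suc k" "\<lambda>k. k - Suc n"])
    fix k assume "k \<in> {n+1..<2*n+1}"
    then have "k = n + Suc (k - Suc n)" by simp
    then have "X ^ k = X ^ n * X ^ Suc (k - Suc n)" by (metis power_add)
    then show "X ^ n * (1 - X ^ Suc (k - Suc n)) = X ^ n - X ^ k" by (simp add: algebra_simps)
  qed auto
  also have "\<dots> = X ^ (n * n) * (\<Prod>k<n. 1 - X ^ Suc k)"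
    by (simp only: prod.distrib power_mult) simp
  also have "(\<Prod>k<n. 1 - X ^ Suc k) = eta_part 1 n"
    unfolding eta_part_def X_def by (simp add: prod.atLeast1_atMost_eq)
  finally have L: "poly (pderiv P) (-1) = (-1) ^ n * X ^ T * eta_part 1 n ^ 2"
    by (simp add: T_def power_add power2_eq_square mult_ac)
  define h where "h j = of_nat j * c j * (-1) ^ (j - 1)" for j
  have "poly (pderiv P) (-1) = (\<Sum>j\<le>2*n+1. h j)"
    unfolding P1 by (simp add: higher_pderiv_sum[of 1, simplified] pderiv_monom poly_sum poly_monom
        h_def del: sum.atMost_Suc)
  also have "{..2*n+1} = {..n} \<union> {n+1..2*n+1}" by auto
  also have "sum h \<dots> = (\<Sum>j\<le>n. h j) + (\<Sum>j\<in>{n+1..2*n+1}. h j)"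
    by (rule sum.union_disjoint) auto
  \<comment> \<open>The indices \<open>n - i\<close> and \<open>n + 1 + i\<close> carry the same
    power of q, so the sum is folded around its middle.\<close>
  also have "(\<Sum>j\<le>n. h j) = (\<Sum>i\<le>n. h (n - i))"
    by (rule sum.reindex_bij_witness[of _ "\<lambda>i. n - i" "\<lambda>i. n - i"]) auto
  also have "(\<Sum>j\<in>{n+1..2*n+1}. h j) = (\<Sum>i\<le>n. h (n + 1 + i))"
    by (rule sum.reindex_bij_witness[of _ "\<lambda>i. n + 1 + i" "\<lambda>j. j - (n + 1)"]) auto
  finally have R: "poly (pderiv P) (-1) = (\<Sum>i\<le>n. h (n - i) + h (n + 1 + i))"
    by (simp add: sum.distrib)
  have "h (n - i) + h (n + 1 + i) = (-1) ^ n * X ^ T * ((-1) ^ i * X ^ (i * (i + 1) div 2) *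
     (of_nat (n + 1 + i) * g (n + 1 + i) - of_nat (n - i) * g (n - i)))" if i: "i \<le> n" for i
  proof -
    define d where "d = n - i"
    have nd: "n = i + d" using i by (simp add: d_def)
    have ch: "2 * (j choose 2) = j * (j - 1)" for j :: nat
      by (induction j) (auto simp: numeral_2_eq_2 algebra_simps)
    have tr: "2 * (i * (i + 1) div 2) = i * (i + 1)" by simp
    have "2 * ((n - i choose 2) + n * (2 * n + 1 - (n - i))) = 2 * (T + i * (i + 1) div 2)"
      unfolding distrib_left[of 2] T2 tr ch unfolding nd
      by (cases d; cases i) (simp_all add: algebra_simps)
    then have e1: "(n - i choose 2) + n * (2 * n + 1 - (n - i)) = T + i * (i + 1) div 2"
      by simp
    have "2 * ((n + 1 + i choose 2) + n * (2 * n + 1 - (n + 1 + i))) = 2 * (T + i * (i + 1) div 2)"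
      unfolding distrib_left[of 2] T2 tr ch unfolding nd
      by (cases d; cases i) (simp_all add: algebra_simps)
    then have e2: "(n + 1 + i choose 2) + n * (2 * n + 1 - (n + 1 + i)) = T + i * (i + 1) div 2"
      by simp
    have "h (n + 1 + i) = (-1) ^ n * X ^ T * ((-1) ^ i * X ^ (i * (i + 1) div 2) *
       (of_nat (n + 1 + i) * g (n + 1 + i)))"
    proof -
      have "c (n + 1 + i) = X ^ (T + i * (i + 1) div 2) * g (n + 1 + i)"
        unfolding c_def e2[symmetric] by (simp only: power_add mult_ac)
      then show ?thesis unfolding h_def by (simp add: power_add mult_ac del: of_nat_add of_nat_Suc)
    qed
    moreover have "h (n - i) = (-1) ^ n * X ^ T * ((-1) ^ i * X ^ (i * (i + 1) div 2) *
       (- (of_nat (n - i) * g (n - i))))"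
    proof (cases "n = i")
      case False
      have "c (n - i) = X ^ (T + i * (i + 1) div 2) * g (n - i)"
        unfolding c_def e1[symmetric] by (simp only: power_add mult_ac)
      moreover have "(-1 :: 'a fps) ^ (n - i - 1) = - ((-1) ^ n * (-1) ^ i)"
      proof -
        define k where "k = n - i - 1"
        have "n = i + k + 1" using False i by (simp add: k_def)
        then show ?thesis by (simp add: power_add k_def[symmetric] flip: power_mult_distrib)
      qed
      ultimately show ?thesis unfolding h_def by (simp add: power_add mult_ac del: of_nat_diff)
    qed (simp add: h_def)
    ultimately show ?thesis by (simp add: right_diff_distrib del: of_nat_add of_nat_Suc of_nat_diff)
  qed
  then have "poly (pderiv P) (-1) = (-1) ^ n * X ^ T * (\<Sum>i\<le>n. (-1) ^ i * X ^ (i * (i + 1) div 2) *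
     (of_nat (n + 1 + i) * g (n + 1 + i) - of_nat (n - i) * g (n - i)))"
    unfolding R sum_distrib_left by (intro sum.cong) auto
  then show ?thesis using L by (simp add: X_def)
qed

text \<open>Multiplication by \<open>eta 1\<close> turns the Gaussian coefficients into 1 and leaves
  the weight \<open>(n + 1 + i) - (n - i) = 2 * i + 1\<close>.\<close>

theorem jacobi_cube:
  "eta 1 ^ 3 = theta_series (\<lambda>i::nat. i * (i + 1) div 2) (\<lambda>i. (-1) ^ i * of_nat (2 * i + 1) ::
      'a::field)"
proof (rule agree_eqI)
  fix M :: nat
  define n where "n = 2 * M"
  define g where "g = gauss_binom (fps_X :: 'a fps) (2 * n + 1)"
  have bound: "i \<le> i * (i + 1) div 2" for i :: nat
    by (cases i) (auto simp: algebra_simps)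
  have "agree M (eta 1 ^ 3) (eta 1 * eta_part 1 n ^ 2 :: 'a fps)"
    unfolding power3_eq_cube power2_eq_square mult.assoc
    by (intro agree_mult agree_refl agree_sym[OF agree_eta_part_eta]) (auto simp: n_def)
  also have "eta 1 * eta_part 1 n ^ 2 = (\<Sum>i\<le>n. (-1) ^ i * fps_X ^ (i * (i + 1) div 2) *
     (of_nat (n + 1 + i) * (g (n + 1 + i) * eta 1) - of_nat (n - i) * (g (n - i) * eta 1)))"
    unfolding jacobi_cube_finite g_def sum_distrib_left 
    by (intro sum.cong) (simp_all only: algebra_simps)
  also have "agree M \<dots> (\<Sum>i\<le>n. fps_const ((-1) ^ i * of_nat (2 * i + 1)) * fps_X ^ (i * (i + 1) div
      2))"
  proof (rule agree_sum)
    fix i assume i: "i \<in> {..n}"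
    let ?X = "fps_X ^ (i * (i + 1) div 2) :: 'a fps"
    let ?S = "of_nat (n + 1 + i) * (g (n + 1 + i) * eta 1) - of_nat (n - i) * (g (n - i) * eta 1)"
    have target: "fps_const ((-1) ^ i * of_nat (2 * i + 1)) * ?X =
        (-1) ^ i * ?X * of_nat (2 * i + 1)"
      by (simp add: fps_const_mult[symmetric] fps_const_power[symmetric] fps_of_nat 
          fps_const_neg[symmetric] mult_ac del: fps_const_mult fps_const_power fps_const_neg
              of_nat_add of_nat_Suc of_nat_mult)
    show "agree M ((-1) ^ i * ?X * ?S) (fps_const ((-1) ^ i * of_nat (2 * i + 1)) * ?X)"
    proof (cases "i \<le> M")
      case True
      have "agree M ?S (of_nat (n + 1 + i) * 1 - of_nat (n - i) * 1)"
      proof -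
        have "agree M (of_nat (n + 1 + i) * (g (n + 1 + i) * eta 1)) (of_nat (n + 1 + i) * 1)"
          using agree_gauss_binom_eta[of 1 M "n + 1 + i" "2 * n + 1", where 'a = 'a] True
          by (intro agree_mult agree_refl) (simp_all add: g_def n_def)
        moreover have "agree M (of_nat (n - i) * (g (n - i) * eta 1)) (of_nat (n - i) * 1)"
          using agree_gauss_binom_eta[of 1 M "n - i" "2 * n + 1", where 'a = 'a] True
          by (intro agree_mult agree_refl) (simp_all add: g_def n_def)
        ultimately show ?thesis unfolding agree_def by (simp del: of_nat_add of_nat_Suc)
      qed
      moreover have "of_nat (n + 1 + i) * 1 - of_nat (n - i) * 1 = (of_nat (2 * i + 1) :: 'a fps)"
        using i by (simp add: of_nat_diff)
      ultimately have "agree M ?S (of_nat (2 * i + 1))" by (simp only:)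
      then show ?thesis unfolding target by (intro agree_mult agree_refl)
    next
      case False
      then have "M < i * (i + 1) div 2" using bound[of i] by linarith
      then have X0: "agree M ?X 0" by (auto simp: agree_def)
      have "agree M ((-1) ^ i * ?X * ?S) ((-1) ^ i * 0 * ?S)"
        by (intro agree_mult agree_refl X0)
      also have "agree M \<dots> (fps_const ((-1) ^ i * of_nat (2 * i + 1)) * 0)" by simp
      also have "agree M \<dots> (fps_const ((-1) ^ i * of_nat (2 * i + 1)) * ?X)"
        by (intro agree_mult agree_refl agree_sym[OF X0])
      finally show ?thesis .
    qed
  qed
  also have "agree M \<dots> (theta_series (\<lambda>i::nat. i * (i + 1) div 2) (\<lambda>i. (-1) ^ i * of_nat (2 * i +
      1)))"
  proof (rule agree_theta_series)
    fix i :: nat assume "i * (i + 1) div 2 \<le> M"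
    then show "i \<in> {..n}" using bound[of i] by (simp add: n_def)
  qed simp
  finally show "agree M (eta 1 ^ 3) (theta_series (\<lambda>i::nat. i * (i + 1) div 2) (\<lambda>i. (-1) ^ i *
      of_nat (2 * i + 1) :: 'a))" .
qed

section \<open>Third order operators on theta series\<close>

text \<open>The derivation q d/dq as it acts on \<open>q^t * F\<close>. For theta series,
  \<open>t\<close> is the fractional power of q belonging to the eta quotient, reduced modulo 7:
  1/24 becomes 5 and 1/8 becomes 1.\<close>

definition euler_shift :: "'a::comm_ring_1 \<Rightarrow> 'a fps \<Rightarrow> 'a fps" where
  "euler_shift t F = euler F + fps_const t * F"

lemma euler_shift_nth: "fps_nth (euler_shift t F) m = (of_nat m + t) * fps_nth F m"
  by (simp add: euler_shift_def euler_nth algebra_simps)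

text \<open>In the applications \<open>\<rho>\<close> enumerates the indices whose exponent, after
  completing the square, comes from a multiple of 7; these terms reproduce the series in
  q^49.\<close>

lemma theta_series_dissect:
  fixes e :: "'i \<Rightarrow> nat" and s :: "'i \<Rightarrow> 'a::idom" and \<rho> :: "'i \<Rightarrow> 'i"
  assumes fin: "\<And>m. finite {i. e i = m}" and inj: "inj \<rho>"
    and e: "\<And>i. e (\<rho> i) = 49 * e i + d" and s: "\<And>i. s (\<rho> i) = c * s i"
  defines "F \<equiv> theta_series e s"
  shows "fps_nth (F - fps_const c * (fps_X ^ d * dil 49 F)) m = (\<Sum>i\<in>{i. e i = m} - range \<rho>. s i)"
proof -
  let ?S = "{i. e i = m}"
  have "sum s ?S = sum s (?S - range \<rho>) + sum s (?S \<inter> range \<rho>)"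
    using fin by (subst sum.union_disjoint[symmetric]) (auto intro: sum.cong)
  also have "?S \<inter> range \<rho> = \<rho> ` {i. 49 * e i + d = m}" using e by auto
  also have "sum s (\<rho> ` {i. 49 * e i + d = m}) = (\<Sum>i | 49 * e i + d = m. c * s i)"
    using inj s by (subst sum.reindex) (auto simp: inj_on_def)
  also have "\<dots> = c * (\<Sum>i | 49 * e i + d = m. s i)"
    by (simp add: sum_distrib_left)
  also have "(\<Sum>i | 49 * e i + d = m. s i) = fps_nth (fps_X ^ d * dil 49 F) m"
  proof (cases "d \<le> m \<and> 49 dvd m - d")
    case True
    then obtain l where l: "m - d = 49 * l" by auto
    then have "{i. 49 * e i + d = m} = {i. e i = l}" using True by auto
    then show ?thesis using True l
      by (simp add: fps_X_power_mult_nth dil_nth F_def theta_series_nth)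
  next
    case False
    then have "{i. 49 * e i + d = m} = {}" by auto
    then show ?thesis using False by (auto simp: fps_X_power_mult_nth dil_nth)
  qed
  finally show ?thesis by (simp add: F_def theta_series_nth)
qed

text \<open>Completing the square makes \<open>e i + t\<close> a constant times some
  \<open>y ^ 2\<close>. In characteristic seven its cube is constant for units \<open>y\<close>, by
  \<open>y ^ 6 = 1\<close>, and 0 for multiples of 7: these are the hypotheses \<open>out\<close>
  and \<open>inn\<close>.\<close>

lemma theta_series_euler_shift:
  fixes e :: "'i \<Rightarrow> nat" and s :: "'i \<Rightarrow> 'a::idom" and \<rho> :: "'i \<Rightarrow> 'i"
  assumes fin: "\<And>m. finite {i. e i = m}" and inj: "inj \<rho>"
    and e: "\<And>i. e (\<rho> i) = 49 * e i + d" and s: "\<And>i. s (\<rho> i) = c * s i"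
    and out: "\<And>i. i \<notin> range \<rho> \<Longrightarrow> (of_nat (e i) + t) ^ 3 = k"
    and inn: "\<And>i. of_nat (e (\<rho> i)) + t = 0"
  defines "F \<equiv> theta_series e s"
  shows "euler_shift t (euler_shift t (euler_shift t F)) =
    fps_const k * (F - fps_const c * (fps_X ^ d * dil 49 F))"
proof (rule fps_ext)
  fix m
  let ?S = "{i. e i = m}"
  have "fps_nth (euler_shift t (euler_shift t (euler_shift t F))) m = (of_nat m + t) ^ 3 * sum s ?S"
    by (simp add: euler_shift_nth F_def theta_series_nth power3_eq_cube mult.assoc)
  also have "\<dots> = (\<Sum>i\<in>?S. (of_nat (e i) + t) ^ 3 * s i)"
    by (simp add: sum_distrib_left)
  also have "\<dots> = (\<Sum>i\<in>?S - range \<rho>. (of_nat (e i) + t) ^ 3 * s i)"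
    using fin inn by (intro sum.mono_neutral_right) auto
  also have "\<dots> = (\<Sum>i\<in>?S - range \<rho>. k * s i)"
    using out by (intro sum.cong) auto
  also have "\<dots> = k * fps_nth (F - fps_const c * (fps_X ^ d * dil 49 F)) m"
    using theta_series_dissect[of e \<rho> d s c m] fin inj e s by (simp add: F_def sum_distrib_left)
  finally show "fps_nth (euler_shift t (euler_shift t (euler_shift t F))) m =
     fps_nth (fps_const k * (F - fps_const c * (fps_X ^ d * dil 49 F))) m"
    by simp
qed

lemma finite_int_fibre:
  assumes "\<And>i::int. \<bar>i\<bar> \<le> int (e i)"
  shows "finite {i. e i = m}"
proof (rule finite_subset)
  show "{i. e i = m} \<subseteq> {- int m..int m}"
  proof
    fix i assume "i \<in> {i. e i = m}"
    then show "i \<in> {- int m..int m}" using assms[of i] by auto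
  qed
qed simp

section \<open>Eta quotients\<close>

definition eta1 :: "'a::comm_ring_1 fps" where "eta1 = eta 1"

definition eta2 :: "'a::comm_ring_1 fps" where "eta2 = eta 2"

lemma eta1_nth_0 [simp]: "fps_nth eta1 0 = 1" and eta2_nth_0 [simp]: "fps_nth eta2 0 = 1"
  by (simp_all add: eta1_def eta2_def)

lemma eta1_nonzero [simp]: "(eta1 :: 'a::comm_ring_1 fps) \<noteq> 0"
  and eta2_nonzero [simp]: "(eta2 :: 'a::comm_ring_1 fps) \<noteq> 0"
  by (simp_all only: eta1_def eta2_def eta_nonzero not_False_eq_True)

lemma dil_2_eta1: "dil 2 eta1 = eta2"
  unfolding eta1_def eta2_def by (subst dil_eta) simp_all

text \<open>The constants \<open>5\<close> and \<open>3\<close> are \<open>1/24\<close> and \<open>1/12\<close> modulo \<open>7\<close>: in characteristic seven, \<open>p1\<close> and \<open>p2\<close> are the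
  logarithmic derivatives of \<open>\<eta>(\<tau>)\<close> and \<open>\<eta>(2\<tau>)\<close>, including the fractional powers of \<open>q\<close>.\<close>

definition p1 :: "'a::field fps" where
  "p1 = 5 + euler eta1 * inverse eta1"

definition p2 :: "'a::field fps" where
  "p2 = 3 + euler eta2 * inverse eta2"

text \<open>Gauss' series for \<open>eta1 ^ 2 / eta2\<close>; \<open>psi\<close> below is the one
  for \<open>eta2 ^ 2 / eta1\<close>.\<close>

definition phi :: "'a::field fps" where
  "phi = theta_series (\<lambda>i::int. nat (i ^ 2)) (\<lambda>i. (-1) ^ nat \<bar>i\<bar>)"

definition psi :: "'a::field fps" where
  "psi = theta_series (\<lambda>i::int. nat (i * (2 * i - 1))) (\<lambda>i. 1)"

lemma eta1_inverse [simp]: "eta1 * inverse eta1 = (1 :: 'a::field fps)"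
  and eta2_inverse [simp]: "eta2 * inverse eta2 = (1 :: 'a::field fps)"
  by (simp_all add: inverse_mult_eq_1')

lemma euler_eta1: "euler eta1 = (p1 - 5) * (eta1 :: 'a::field fps)"
  unfolding p1_def by (simp add: mult.assoc mult.commute[of "inverse _"])

lemma euler_eta2: "euler eta2 = (p2 - 3) * (eta2 :: 'a::field fps)"
  unfolding p2_def by (simp add: mult.assoc mult.commute[of "inverse _"])

lemma eta1_psi: "eta1 * psi = (eta2 ^ 2 :: 'a::field fps)"
  unfolding psi_def eta1_def eta2_def by (rule gauss_triangular)

lemma eta2_phi: "eta2 * phi = (eta1 ^ 2 :: 'a::field fps)"
  unfolding phi_def eta1_def eta2_def by (rule gauss_squares)

lemma phi_psi: "phi * psi = eta1 * (eta2 :: 'a::field fps)"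
proof -
  have "(eta1 * eta2) * (phi * psi) = (eta1 * eta2) * (eta1 * (eta2 :: 'a fps))"
    using eta1_psi[where 'a = 'a] eta2_phi[where 'a = 'a] by algebra
  then show ?thesis by simp
qed

lemma eta1_cube: "phi ^ 2 * psi = (eta1 ^ 3 :: 'a::field fps)"
  using phi_psi[where 'a = 'a] eta2_phi[where 'a = 'a] by algebra

lemma eta2_cube: "phi * psi ^ 2 = (eta2 ^ 3 :: 'a::field fps)"
  using phi_psi[where 'a = 'a] eta1_psi[where 'a = 'a] by algebra

lemma phi_nth_0: "fps_nth (phi :: 'a::field fps) 0 = 1"
  using arg_cong[OF eta2_phi, of "\<lambda>F. fps_nth F 0"] by (simp add: power2_eq_square)

lemma psi_nth_0: "fps_nth (psi :: 'a::field fps) 0 = 1"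
  using arg_cong[OF eta1_psi, of "\<lambda>F. fps_nth F 0"] by (simp add: power2_eq_square)

lemma phi_nonzero: "(phi :: 'a::field fps) \<noteq> 0" and psi_nonzero: "(psi :: 'a::field fps) \<noteq> 0"
  using phi_nth_0 psi_nth_0 by (metis fps_zero_nth zero_neq_one)+

text \<open>Logarithmic differentiation of \<open>eta1_psi\<close>; the constant is
  \<open>5 - 2 * 3\<close>, from the shifts in \<open>p1\<close> and \<open>p2\<close>.\<close>

lemma euler_psi: "euler psi = (2 * p2 - p1 - 1) * (psi :: 'a::field fps)"
proof -
  have "euler (eta1 * psi) = euler (eta2 ^ 2 :: 'a fps)" by (simp add: eta1_psi)
  then have "(p1 - 5) * eta1 * psi + eta1 * euler psi = 2 * (p2 - 3) * (eta2 ^ 2 :: 'a fps)"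
    unfolding power2_eq_square euler_mult euler_eta1 euler_eta2 by algebra
  then have "eta1 * (euler psi - (2 * p2 - p1 - 1) * (psi :: 'a fps)) = 0"
    unfolding eta1_psi[symmetric] by algebra
  then show ?thesis by simp
qed

lemma euler_phi: "euler phi = (2 * p1 - p2 - 7) * (phi :: 'a::field fps)"
proof -
  have "euler (eta2 * phi) = euler (eta1 ^ 2 :: 'a fps)" by (simp add: eta2_phi)
  then have "(p2 - 3) * eta2 * phi + eta2 * euler phi = 2 * (p1 - 5) * (eta1 ^ 2 :: 'a fps)"
    unfolding power2_eq_square euler_mult euler_eta1 euler_eta2 by algebra
  then have "eta2 * (euler phi - (2 * p1 - p2 - 7) * (phi :: 'a fps)) = 0"
    unfolding eta2_phi[symmetric] by algebra
  then show ?thesis by simp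
qed

lemma euler_shift_mult: "euler_shift t (G * F) = euler G * F + G * euler_shift t F"
  by (simp add: euler_shift_def euler_mult algebra_simps)

text \<open>Turns a third order linear equation for \<open>F\<close> into one for its logarithmic
  derivative \<open>L\<close>, to which polynomial algebra applies.\<close>

lemma euler_shift_cubed:
  assumes "euler_shift t F = L * F"
  shows "euler_shift t (euler_shift t (euler_shift t F)) =
    (euler (euler L) + 3 * L * euler L + L ^ 3) * F"
proof -
  have "euler_shift t (euler_shift t F) = (euler L + L * L) * F"
    unfolding assms euler_shift_mult[of t L F] by (simp add: algebra_simps)
  then have "euler_shift t (euler_shift t (euler_shift t F)) =
      euler (euler L + L * L) * F + (euler L + L * L) * (L * F)"
    by (simp only: assms euler_shift_mult[of t "euler L + L * L" F])
  then show ?thesis by (simp add: euler_add euler_mult algebra_simps power3_eq_cube)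
qed

lemma p2_eq: "p2 = 2 * dil 2 p1 - (7 :: 'a::field fps)"
proof -
  have "(p2 - 3) * eta2 = euler (dil 2 (eta1 :: 'a fps))"
    by (simp add: dil_2_eta1 flip: euler_eta2)
  also have "\<dots> = 2 * dil 2 (euler eta1)"
    by (simp add: euler_dil)
  also have "\<dots> = 2 * (dil 2 p1 - 5) * eta2"
    unfolding euler_eta1 by (simp add: dil_mult dil_diff dil_2_eta1)
  finally have "p2 - 3 = 2 * (dil 2 p1 - (5 :: 'a fps))" by simp
  then show ?thesis by (simp add: algebra_simps)
qed

lemma p1_nth_0: "fps_nth (p1 :: 'a::field fps) 0 = 5"
  by (simp add: p1_def euler_nth)

lemma p1_nth_1: "fps_nth (p1 :: 'a::field fps) 1 = -1"
proof -
  have f1: "fps_nth (eta1 :: 'a fps) 1 = -1" by (simp add: eta1_def eta_def eta_part_def)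
  have "fps_nth (euler eta1) 1 = fps_nth ((p1 - 5) * (eta1 :: 'a fps)) 1"
    by (simp only: euler_eta1)
  then show ?thesis using f1 p1_nth_0[where 'a = 'a]
    by (simp add: euler_nth fps_mult_nth fps_numeral_nth)
qed

section \<open>Modular forms of level two\<close>

text \<open>\<open>uu\<close> and \<open>vv\<close> have weight four. \<open>aa\<close> has weight
  eight, which counts as two in characteristic seven, where weights matter modulo six only;
  \<open>aa_eq\<close> identifies it with a multiple of \<open>p2 - p1\<close>.\<close>

definition uu :: "'a::field fps" where "uu = phi ^ 8"

definition vv :: "'a::field fps" where "vv = fps_X * psi ^ 8"

definition aa :: "'a::field fps" where "aa = uu ^ 2 - vv ^ 2"

lemma uu_nth_0: "fps_nth (uu :: 'a::field fps) 0 = 1"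
  by (simp add: uu_def fps_power_zeroth phi_nth_0)

lemma vv_nth_0: "fps_nth (vv :: 'a::field fps) 0 = 0"
  by (simp add: vv_def)

lemma aa_nth_0: "fps_nth (aa :: 'a::field fps) 0 = 1"
  by (simp add: aa_def fps_power_zeroth uu_nth_0 vv_nth_0)

lemma Delta_1: "fps_X * eta1 ^ 24 = uu ^ 2 * (vv :: 'a::field fps)"
proof -
  have "eta1 ^ 24 = (eta1 ^ 3 :: 'a fps) ^ 8" by (simp flip: power_mult)
  then show ?thesis unfolding eta1_cube[symmetric]
    by (simp add: uu_def vv_def power_mult_distrib flip: power_mult)
qed

lemma Delta_2: "fps_X ^ 2 * eta2 ^ 24 = uu * (vv :: 'a::field fps) ^ 2"
proof -
  have "eta2 ^ 24 = (eta2 ^ 3 :: 'a fps) ^ 8" by (simp flip: power_mult)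
  then show ?thesis unfolding eta2_cube[symmetric]
    by (simp add: uu_def vv_def power_mult_distrib flip: power_mult)
qed

lemma euler_uu: "euler uu = 8 * (2 * p1 - p2 - 7) * (uu :: 'a::field fps)"
proof -
  have "phi ^ 8 = phi * (phi ^ 7 :: 'a fps)" by (simp flip: power_Suc)
  then show ?thesis unfolding uu_def euler_power euler_phi by (simp add: mult_ac)
qed

lemma euler_vv: "euler vv = (16 * p2 - 8 * p1 - 7) * (vv :: 'a::field fps)"
proof -
  have "psi ^ 8 = psi * (psi ^ 7 :: 'a fps)" by (simp flip: power_Suc)
  then show ?thesis unfolding vv_def euler_mult euler_power euler_psi by (simp add: algebra_simps)
qed

lemma euler_shift_2_mult: "euler_shift 2 (F * G) = euler_shift 1 F * G + F * euler_shift 1 G"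
  by (simp add: euler_shift_def euler_mult algebra_simps numeral_fps_const[symmetric])

lemma euler_shift_add: "euler_shift t (F + G) = euler_shift t F + euler_shift t G"
  by (simp add: euler_shift_def euler_add algebra_simps)

lemma euler_shift_diff: "euler_shift t (F - G) = euler_shift t F - euler_shift t G"
  by (simp add: euler_shift_def euler_diff algebra_simps)

definition inv_gen :: "'a::field fps" where
  "inv_gen = inverse eta1 * inverse eta2 ^ 2"

lemma inv_gen_mult: "inv_gen * (eta1 * eta2 ^ 2) = (1 :: 'a::field fps)"
proof -
  have "inv_gen * (eta1 * eta2 ^ 2) = (eta1 * inverse eta1) * (eta2 * inverse (eta2 :: 'a fps)) ^ 2"
    unfolding inv_gen_def by algebra
  then show ?thesis by simp
qed

lemma euler_inv_gen: "euler inv_gen = (11 - p1 - 2 * p2) * (inv_gen :: 'a::field fps)"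
proof -
  have "euler (inv_gen * (eta1 * eta2 ^ 2)) = (0 :: 'a fps)" by (simp add: inv_gen_mult)
  then have "euler inv_gen * (eta1 * eta2 ^ 2) =
      (11 - p1 - 2 * p2) * inv_gen * (eta1 * (eta2 :: 'a fps) ^ 2)"
    unfolding power2_eq_square euler_mult euler_eta1 euler_eta2 by algebra
  then show ?thesis by simp
qed

lemma inv_gen_unique:
  assumes "F * (eta1 * eta2 ^ 2) = (1 :: 'b::field fps)"
  shows "F = inv_gen"
proof -
  have "F * (eta1 * eta2 ^ 2) = inv_gen * (eta1 * eta2 ^ 2)" using assms inv_gen_mult by metis
  then show ?thesis by simp
qed

section \<open>Residues of theta exponents modulo 7\<close>

text \<open>\<open>8 * m + 1\<close> is congruent to \<open>m + 1\<close>, and the nonzero squares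
  modulo 7 are 1, 2 and 4.\<close>

lemma quadratic_residue_mod_7:
  fixes m :: nat and y :: int
  assumes "8 * int m + 1 = y ^ 2" "\<not> 7 dvd y"
  shows "m mod 7 \<in> {0, 1, 3}"
proof -
  have "0 \<le> y mod 7" "y mod 7 < 7" "y mod 7 \<noteq> 0" using assms(2) by (auto simp: dvd_eq_mod_eq_0)
  then have "y mod 7 \<in> {1, 2, 3, 4, 5, 6}" by auto
  moreover have "(8 * int m + 1) mod 7 = (y mod 7) ^ 2 mod 7"
    unfolding assms(1) by (simp add: power_mod)
  ultimately have "(8 * int m + 1) mod 7 \<in> {1, 2, 4}" by auto
  moreover have "int (m mod 7) = ((8 * int m + 1) mod 7 + 6) mod 7"
  proof -
    have "((8 * int m + 1) mod 7 + 6) mod 7 = (int m + 7 * (int m + 1)) mod 7"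
      unfolding mod_add_left_eq by (simp add: algebra_simps)
    also have "\<dots> = int m mod 7" by (rule mod_mult_self2)
    finally show ?thesis by (simp add: zmod_int)
  qed
  ultimately have "int (m mod 7) \<in> {0, 1, 3}" by auto
  then show ?thesis by auto
qed

lemma theta_series_residues:
  fixes e :: "'i \<Rightarrow> nat" and s :: "'i \<Rightarrow> 'a::idom" and \<rho> :: "'i \<Rightarrow> 'i" and y :: "'i \<Rightarrow> int"
  assumes "\<And>m. finite {i. e i = m}" "inj \<rho>"
    and "\<And>i. e (\<rho> i) = 49 * e i + d" "\<And>i. s (\<rho> i) = c * s i"
    and y: "\<And>i. 8 * int (e i) + 1 = y i ^ 2" "\<And>i. 7 dvd y i \<Longrightarrow> i \<in> range \<rho>"
    and nz: "fps_nth (theta_series e s - fps_const c * (fps_X ^ d * dil 49 (theta_series e s))) m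
        \<noteq> 0"
  shows "m mod 7 \<in> {0, 1, 3}"
proof -
  have "(\<Sum>i\<in>{i. e i = m} - range \<rho>. s i) \<noteq> 0"
    using theta_series_dissect[of e \<rho> d s c m] assms(1-4) nz by simp
  then obtain i where "i \<in> {i. e i = m} - range \<rho>"
    by (rule sum.not_neutral_contains_not_neutral)
  then show ?thesis using y[of i] by (intro quadratic_residue_mod_7[of m "y i"]) auto
qed

lemma psi_residues:
  assumes "fps_nth (psi - fps_X ^ 6 * dil 49 psi :: 'a::field fps) m \<noteq> 0"
  shows "m mod 7 \<in> {0, 1, 3}"
proof -
  define e where "e = (\<lambda>i::int. nat (i * (2 * i - 1)))"
  have e2: "int (e i) = i * (2 * i - 1)" for i
  proof -
    have "0 \<le> i * (2 * i - 1)" by (auto simp: zero_le_mult_iff)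
    then show ?thesis by (simp add: e_def)
  qed
  have bound: "\<bar>i\<bar> \<le> int (e i)" for i
    by (intro quadratic_exponent_bound[of _ 4 1]) (simp_all only: e2, simp_all add: algebra_simps)
  show ?thesis
  proof (rule theta_series_residues[of e "\<lambda>i. 2 - 7 * i" 6 "\<lambda>i. 1 :: 'a" 1 "\<lambda>i. 4 * i - 1"])
    show "finite {i. e i = m}" for m by (rule finite_int_fibre[OF bound])
    show "e (2 - 7 * i) = 49 * e i + 6" for i
    proof -
      have "int (e (2 - 7 * i)) = int (49 * e i + 6)"
        using e2[of i] e2[of "2 - 7 * i"] by (simp add: algebra_simps)
      then show ?thesis by linarith
    qed
    show "8 * int (e i) + 1 = (4 * i - 1) ^ 2" for i
      unfolding e2 by (simp add: algebra_simps power2_eq_square)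
    show "i \<in> range (\<lambda>i. 2 - 7 * i)" if "7 dvd 4 * i - 1" for i :: int
    proof -
      have "\<exists>j. i = 2 - 7 * j" using that by presburger
      then show ?thesis by auto
    qed
    show "fps_nth (theta_series e (\<lambda>i. 1 :: 'a) - fps_const 1 *
        (fps_X ^ 6 * dil 49 (theta_series e (\<lambda>i. 1)))) m \<noteq> 0"
      using assms by (simp add: psi_def e_def)
  qed (auto simp: inj_def)
qed

text \<open>This holds over every field: for \<open>i = 7 * j + 3\<close> the weight
  \<open>2 * i + 1\<close> is \<open>7 * (2 * j + 1)\<close> and the sign is reversed, so these
  terms are -7 times a series in q^49. The factor 7 in \<open>sec_4_psi_eta2_cube\<close> originates
  here.\<close>

lemma eta1_cube_residues:
  assumes "fps_nth (eta1 ^ 3 + 7 * (fps_X ^ 6 * dil 49 (eta1 ^ 3)) :: 'a::field fps) m \<noteq> 0"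
  shows "m mod 7 \<in> {0, 1, 3}"
proof -
  define e where "e = (\<lambda>i::nat. i * (i + 1) div 2)"
  let ?s = "\<lambda>i::nat. (-1) ^ i * of_nat (2 * i + 1) :: 'a"
  have e2: "2 * e i = i * (i + 1)" for i by (simp add: e_def)
  have bound: "i \<le> e i" for i by (cases i) (auto simp: e_def algebra_simps)
  show ?thesis
  proof (rule theta_series_residues[of e "\<lambda>i. 7 * i + 3" 6 ?s "-7" "\<lambda>i. 2 * int i + 1"])
    show "finite {i. e i = m}" for m
      by (rule finite_subset[of _ "{..m}"]) (use bound in auto)
    show "e (7 * i + 3) = 49 * e i + 6" for i
    proof -
      have "2 * e (7 * i + 3) = 2 * (49 * e i + 6)"
        unfolding distrib_left[of 2] mult.left_commute[of 2 49] e2 by (simp add: algebra_simps)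
      then show ?thesis by (simp only: mult_cancel_left) simp
    qed
    show "?s (7 * i + 3) = -7 * ?s i" for i
    proof -
      have "(-1 :: 'a) ^ (7 * i + 3) = - ((-1) ^ i)" by (simp add: power_add power_mult)
      then show ?thesis by (simp add: algebra_simps)
    qed
    show "8 * int (e i) + 1 = (2 * int i + 1) ^ 2" for i
    proof -
      have "2 * int (e i) = int i * (int i + 1)"
        using e2[of i] by (metis of_nat_1 of_nat_add of_nat_mult of_nat_numeral)
      then show ?thesis by (simp add: algebra_simps power2_eq_square)
    qed
    show "i \<in> range (\<lambda>i. 7 * i + 3)" if "7 dvd 2 * int i + 1" for i
    proof -
      have "\<exists>j. i = 7 * j + 3" using that by presburger
      then show ?thesis by auto
    qed
    show "fps_nth (theta_series e ?s - fps_const (-7) * (fps_X ^ 6 * dil 49 (theta_series e ?s))) m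
        \<noteq> 0"
      using assms unfolding eta1_def jacobi_cube e_def[symmetric]
      by (simp add: numeral_fps_const flip: fps_const_neg)
  qed (auto simp: inj_def)
qed

lemma sec_mult_eq_0:
  fixes F G :: "'a::comm_ring_1 fps"
  assumes "\<And>m. fps_nth F m \<noteq> 0 \<Longrightarrow> m mod 7 \<in> R" "\<And>m. fps_nth G m \<noteq> 0 \<Longrightarrow> m mod 7 \<in> S"
    and "\<And>r s. r \<in> R \<Longrightarrow> s \<in> S \<Longrightarrow> (r + s) mod 7 \<noteq> 4"
  shows "sec 4 (F * G) = 0"
proof (rule fps_ext)
  fix n
  have "fps_nth F i * fps_nth G (7 * n + 4 - i) = 0" if "i \<le> 7 * n + 4" for i
  proof (rule ccontr)
    assume "fps_nth F i * fps_nth G (7 * n + 4 - i) \<noteq> 0"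
    then have "fps_nth F i \<noteq> 0" "fps_nth G (7 * n + 4 - i) \<noteq> 0" by auto
    then have "(i mod 7 + (7 * n + 4 - i) mod 7) mod 7 \<noteq> 4" using assms by blast
    moreover have "(i mod 7 + (7 * n + 4 - i) mod 7) mod 7 = 4"
      using that by (simp add: mod_add_eq)
    ultimately show False by simp
  qed
  then show "fps_nth (sec 4 (F * G)) n = fps_nth 0 n"
    by (simp add: fps_mult_nth)
qed

text \<open>The residues 0, 1, 3 of \<open>P\<close> and 0, 2, 6 of \<open>G\<close> never add up to
  4, nor do those of the mixed products. Only \<open>P0 * G0\<close>, with 6 + 5, lies in the class
  4.\<close>

lemma sec_4_psi_eta2_cube:
  "sec 4 (psi * eta2 ^ 3) = - 7 * (fps_X ^ 2 * dil 7 (psi * eta2 ^ 3 :: 'a::field fps))"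
proof -
  define P0 where "P0 = (fps_X ^ 6 * dil 49 psi :: 'a fps)"
  define P where "P = (psi - P0 :: 'a fps)"
  define G0 where "G0 = (- 7 * (fps_X ^ 12 * dil 49 (eta2 ^ 3)) :: 'a fps)"
  define G where "G = (eta2 ^ 3 - G0 :: 'a fps)"
  define H where "H = (eta1 ^ 3 + 7 * (fps_X ^ 6 * dil 49 (eta1 ^ 3)) :: 'a fps)"
  have comm: "dil 2 (dil 49 F) = dil 49 (dil 2 F)" for F :: "'a fps"
    by (simp add: dil_dil)
  have GH: "G = dil 2 H"
    by (simp add: G_def G0_def H_def dil_add dil_mult comm dil_X dil_power dil_2_eta1 flip:
        power_mult)
  have P: "m mod 7 \<in> {0, 1, 3}" if "fps_nth P m \<noteq> 0" for m
    using that psi_residues[of m, where 'a = 'a] by (simp add: P_def P0_def)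
  have G: "m mod 7 \<in> {0, 2, 6}" if "fps_nth G m \<noteq> 0" for m
  proof -
    have "even m" "fps_nth H (m div 2) \<noteq> 0"
      using that unfolding GH by (auto simp: dil_nth split: if_splits)
    then have "m div 2 mod 7 \<in> {0, 1, 3}" unfolding H_def by (intro eta1_cube_residues)
    moreover have "m mod 7 = (2 * (m div 2 mod 7)) mod 7"
      using \<open>even m\<close> by (simp add: mod_mult_right_eq)
    ultimately show ?thesis by auto
  qed
  have P0: "m mod 7 \<in> {6}" if "fps_nth P0 m \<noteq> 0" for m
  proof -
    have "6 \<le> m" "49 dvd m - 6"
      using that by (auto simp: P0_def fps_X_power_mult_nth dil_nth split: if_splits)
    then obtain l where "m = 7 * (7 * l) + 6" by (auto elim!: dvdE simp: le_iff_add)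
    then show ?thesis by (simp only: mod_mult_self4) simp
  qed
  have G0: "m mod 7 \<in> {5}" if "fps_nth G0 m \<noteq> 0" for m
  proof -
    have "12 \<le> m" "49 dvd m - 12"
      using that by (auto simp: G0_def fps_X_power_mult_nth dil_nth numeral_fps_const split:
          if_splits)
    then obtain l where "m = 7 * (7 * l + 1) + 5" by (auto elim!: dvdE simp: le_iff_add)
    then show ?thesis by (simp only: mod_mult_self4) simp
  qed
  have "psi * eta2 ^ 3 = P * G + P * G0 + P0 * G + P0 * G0"
    by (simp add: P_def G_def algebra_simps)
  then have "sec 4 (psi * eta2 ^ 3) =
      sec 4 (P * G) + sec 4 (P * G0) + sec 4 (P0 * G) + sec 4 (P0 * G0)"
    by (simp only: sec_add)
  also have "sec 4 (P * G) = 0" by (rule sec_mult_eq_0[OF P G]) auto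
  also have "sec 4 (P * G0) = 0" by (rule sec_mult_eq_0[OF P G0]) auto
  also have "sec 4 (P0 * G) = 0" by (rule sec_mult_eq_0[OF P0 G]) auto
  also have "P0 * G0 = (- 7 * fps_X ^ 18) * dil 7 (dil 7 (psi * eta2 ^ 3))"
  proof -
    have "dil 49 F = dil 7 (dil 7 F)" for F :: "'a fps" by (simp add: dil_dil)
    then show ?thesis by (simp add: P0_def G0_def dil_mult algebra_simps flip: power_add)
  qed
  also have "sec 4 \<dots> = sec 4 (- 7 * fps_X ^ 18) * dil 7 (psi * eta2 ^ 3)"
    by (rule sec_mult_dil) simp
  also have "sec 4 (- 7 * fps_X ^ 18) = (- 7 * fps_X ^ 2 :: 'a fps)"
    by (auto simp: fps_eq_iff numeral_fps_const)
  finally show ?thesis by (simp add: mult.assoc)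
qed

section \<open>Integral series over other rings\<close>

text \<open>Divisibility is a matter of integral series, the exact theta identity is used over the
  rationals, and the relations live in characteristic seven; this homomorphism links them.\<close>

definition of_int_fps :: "int fps \<Rightarrow> 'a::comm_ring_1 fps" where
  "of_int_fps F = Abs_fps (\<lambda>n. of_int (fps_nth F n))"

lemma of_int_fps_nth [simp]: "fps_nth (of_int_fps F) n = of_int (fps_nth F n)"
  by (simp add: of_int_fps_def)

lemma of_int_fps_add: "of_int_fps (F + G) = of_int_fps F + of_int_fps G"
  and of_int_fps_diff: "of_int_fps (F - G) = of_int_fps F - of_int_fps G"
  and of_int_fps_uminus: "of_int_fps (- F) = - of_int_fps F"
  by (simp_all add: fps_eq_iff)

lemma of_int_fps_mult: "of_int_fps (F * G) = of_int_fps F * of_int_fps G"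
  by (simp add: fps_eq_iff fps_mult_nth)

lemma of_int_fps_one [simp]: "of_int_fps 1 = 1"
  by (simp add: fps_eq_iff)

lemma of_int_fps_numeral [simp]: "of_int_fps (numeral n) = numeral n"
  by (simp add: fps_eq_iff fps_numeral_nth)

lemma of_int_fps_power: "of_int_fps (F ^ n) = of_int_fps F ^ n"
  by (induction n) (simp_all add: of_int_fps_mult)

lemma of_int_fps_X_power [simp]: "of_int_fps (fps_X ^ n) = fps_X ^ n"
  by (simp add: fps_eq_iff)

lemma of_int_fps_prod: "of_int_fps (prod f A) = (\<Prod>x\<in>A. of_int_fps (f x))"
  by (induction A rule: infinite_finite_induct) (simp_all add: of_int_fps_mult)

lemma of_int_fps_eta: "of_int_fps (eta k) = eta k"
proof -
  have "of_int_fps (eta_part k n) = (eta_part k n :: 'a fps)" for n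
    by (simp add: eta_part_def of_int_fps_prod of_int_fps_diff)
  then have "fps_nth (of_int_fps (eta_part k n) :: 'a fps) n = fps_nth (eta_part k n) n" for n
    by simp
  then show ?thesis by (simp add: fps_eq_iff eta_def)
qed

lemma of_int_fps_eta1 [simp]: "of_int_fps eta1 =
    eta1" and of_int_fps_eta2 [simp]: "of_int_fps eta2 = eta2"
  by (simp_all only: eta1_def eta2_def of_int_fps_eta)

lemma of_int_fps_dil: "k > 0 \<Longrightarrow> of_int_fps (dil k F) = dil k (of_int_fps F :: 'a::idom fps)"
  by (simp add: fps_eq_iff dil_nth)

lemma of_int_fps_euler: "of_int_fps (euler F) = euler (of_int_fps F)"
  by (simp add: fps_eq_iff euler_nth)

lemma of_int_fps_sec: "of_int_fps (sec r F) = sec r (of_int_fps F)"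
  by (simp add: fps_eq_iff)

lemma of_int_fps_inject: "of_int_fps F =
    (of_int_fps G :: 'a::{comm_ring_1,ring_char_0} fps) \<longleftrightarrow> F = G"
  by (simp add: fps_eq_iff)

text \<open>The coefficients solve a linear system over the field with seven elements. The solution is a
  Laurent polynomial in \<open>aa\<close>; it is multiplied here by \<open>aa\<^sup>2\<^sup>8\<close>, whose derivative vanishes.\<close>

definition cert :: "'a::field fps" where
  "cert = -2 * aa ^ 6 + 3 * aa ^ 9 + 2 * aa ^ 12 + aa ^ 15 + aa ^ 21 + aa ^ 24 + 3 * aa ^ 27
      - aa ^ 30 + 3 * aa ^ 33 + aa ^ 36 - 3 * aa ^ 39 + 3 * aa ^ 42 + aa ^ 51 - 2 * aa ^ 54
      + aa ^ 57 - 2 * aa ^ 60 - 3 * aa ^ 63 + aa ^ 66 - aa ^ 72"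

section \<open>Relations in characteristic seven\<close>

context
  assumes char7: "(7::'a::field) = 0"
begin

lemma char7_fps: "(7 :: 'a fps) = 0"
  using char7 by (simp add: numeral_fps_const)

lemma of_int_mod_7: "(of_int y :: 'a) = of_int (y mod 7)"
proof -
  have "(of_int y :: 'a) = of_int (7 * (y div 7) + y mod 7)" by simp
  then show ?thesis using char7 by (simp only: of_int_add of_int_mult) simp
qed

lemma of_int_eq_0: "7 dvd y \<Longrightarrow> (of_int y :: 'a) = 0"
  by (subst of_int_mod_7) auto

lemma char7_eqI: "x - y = 7 * z \<Longrightarrow> x = (y :: 'a)"
  using char7 by simp

text \<open>The method \<open>algebra\<close> does not know that \<open>7 = 0\<close>. Congruences
  are therefore proved as exact identities whose difference is an explicit multiple of 7; this is
  the origin of the long cofactors below.\<close>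

lemma char7_fps_eqI: "x - y = 7 * z \<Longrightarrow> x = (y :: 'a fps)"
  using char7_fps by simp

lemma of_int_power_6:
  assumes "\<not> 7 dvd y"
  shows "(of_int y :: 'a) ^ 6 = 1"
proof -
  have "y mod 7 \<in> {1, 2, 3, 4, 5, 6}" using assms by (simp add: dvd_eq_mod_eq_0) presburger
  moreover have "(2::'a) ^ 6 = 1" "(3::'a) ^ 6 = 1" "(4::'a) ^ 6 = 1" "(5::'a) ^ 6 =
      1" "(6::'a) ^ 6 = 1"
    \<comment> \<open>The cofactors are \<open>(y ^ 6 - 1) / 7\<close> for \<open>y\<close> from 2
      to 6.\<close>
    by (rule char7_eqI[of _ _ 9], simp, rule char7_eqI[of _ _ 104], simp, rule char7_eqI[of _ _
        585], simp,
        rule char7_eqI[of _ _ 2232], simp, rule char7_eqI[of _ _ 6665], simp)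
  ultimately show ?thesis by (subst of_int_mod_7) auto
qed

lemma of_int_0_imp_dvd:
  assumes "(of_int y :: 'a) = 0" shows "7 dvd y"
  using of_int_power_6[of y] assms by (auto simp: zero_power)

section \<open>Differential equations of the theta series modulo 7\<close>

text \<open>Since \<open>i * (3 * i - 1) / 2 + 1/24 = (6 * i - 1) ^ 2 / 24\<close> and 1/24 is 5
  modulo 7, the constant on the right is \<open>5 ^ 3 = -1\<close>; the exceptional indices are
  \<open>7 * j - 1\<close>.\<close>

lemma eta_euler: 
  "euler_shift 5 (euler_shift 5 (euler_shift 5 (eta 1))) =
      - (eta 1 + fps_X ^ 2 * dil 49 (eta 1 :: 'a fps))"
proof -
  define e where "e = (\<lambda>i::int. nat (i * (3 * i - 1) div 2))"
  have e2: "2 * int (e i) = i * (3 * i - 1)" for i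
  proof -
    have "even (i * (3 * i - 1))" by simp
    moreover have "0 \<le> i * (3 * i - 1)" by (auto simp: zero_le_mult_iff)
    ultimately show ?thesis by (simp add: e_def)
  qed
  have bound: "\<bar>i\<bar> \<le> int (e i)" for i
    using e2 by (intro quadratic_exponent_bound[of _ 3 1]) (simp_all add: algebra_simps)
  have sq: "of_nat (e i) + 5 = 5 * (of_int (6 * i - 1) :: 'a) ^ 2" for i
  proof -
    have "(of_nat (e i) :: 'a) + 5 - 5 * (of_int (6 * i - 1)) ^ 2
       = of_int (int (e i) + 5 - 5 * (6 * i - 1) ^ 2)" by simp
    also have "int (e i) + 5 - 5 * (6 * i - 1) ^ 2 = 7 * (- 17 * int (e i))"
      using e2[of i] by (simp add: algebra_simps power2_eq_square)
    also have "of_int (7 * (- 17 * int (e i))) = (0 :: 'a)" by (rule of_int_eq_0) simp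
    finally show ?thesis by (simp only: right_minus_eq)
  qed
  have "euler_shift 5 (euler_shift 5 (euler_shift 5 (theta_series e (\<lambda>i. (-1 :: 'a) ^ nat \<bar>i\<bar>)))) =
    fps_const (-1) * (theta_series e (\<lambda>i. (-1) ^ nat \<bar>i\<bar>) -
     fps_const (-1) * (fps_X ^ 2 * dil 49 (theta_series e (\<lambda>i. (-1) ^ nat \<bar>i\<bar>))))"
  proof (rule theta_series_euler_shift[where \<rho> = "\<lambda>i. 7 * i - 1"])
    show "finite {i. e i = m}" for m by (rule finite_int_fibre[OF bound])
    show "e (7 * i - 1) = 49 * e i + 2" for i
    proof -
      have "2 * int (e (7 * i - 1)) = 2 * int (49 * e i + 2)"
        using e2[of i] e2[of "7 * i - 1"] by (simp add: algebra_simps)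
      then show ?thesis by (simp only: mult_cancel_left of_nat_eq_iff) simp
    qed
    show "(-1 :: 'a) ^ nat \<bar>7 * i - 1\<bar> = -1 * (-1) ^ nat \<bar>i\<bar>" for i :: int
    proof -
      have "even (nat \<bar>7 * i - 1\<bar>) \<longleftrightarrow> odd (nat \<bar>i\<bar>)"
        by (simp add: even_nat_iff)
      then show ?thesis by (cases "even (nat \<bar>i\<bar>)") auto
    qed
    show "(of_nat (e i) + 5 :: 'a) ^ 3 = -1" if "i \<notin> range (\<lambda>i. 7 * i - 1)" for i
    proof -
      have "\<not> 7 dvd (6 * i - 1)"
      proof
        assume "7 dvd (6 * i - 1)"
        then have "\<exists>j. i = 7 * j - 1" by presburger
        then show False using that by auto
      qed
      then have "(of_int (6 * i - 1) :: 'a) ^ 6 = 1" by (rule of_int_power_6)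
      moreover have "(of_nat (e i) + 5 :: 'a) ^ 3 = 125 * (of_int (6 * i - 1) :: 'a) ^ 6"
        unfolding sq by (simp add: power_mult_distrib flip: power_mult)
      ultimately show ?thesis using char7_eqI[of 125 "-1" 18] by simp
    qed
    show "(of_nat (e (7 * i - 1)) + 5 :: 'a) = 0" for i
    proof -
      have "(of_int (6 * (7 * i - 1) - 1) :: 'a) = 0" by (rule of_int_eq_0) presburger
      then show ?thesis unfolding sq by (simp del: of_int_diff of_int_mult)
    qed
  qed (auto simp: inj_def)
  then show ?thesis
    unfolding e_def pentagonal_number_theorem[symmetric] by (simp add: fps_const_minus_one_mult)
qed

lemma phi_euler:
  defines "F \<equiv> theta_series (\<lambda>i::int. nat (i ^ 2)) (\<lambda>i. (-1 :: 'a) ^ nat \<bar>i\<bar>)"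
  shows "euler (euler (euler F)) = F - dil 49 F"
proof -
  let ?e = "\<lambda>i::int. nat (i ^ 2)"
  have bound: "\<bar>i\<bar> \<le> int (?e i)" for i
    by (intro quadratic_exponent_bound[of _ 2 1]) (simp_all add: algebra_simps power2_eq_square)
  have sq: "of_nat (?e i) = (of_int i :: 'a) ^ 2" for i by simp
  have "euler_shift 0 (euler_shift 0 (euler_shift 0 F)) =
    fps_const 1 * (F - fps_const 1 * (fps_X ^ 0 * dil 49 F))"
    unfolding F_def
  proof (rule theta_series_euler_shift[where \<rho> = "\<lambda>i. 7 * i"])
    show "finite {i. ?e i = m}" for m by (rule finite_int_fibre[OF bound])
    show "?e (7 * i) = 49 * ?e i + 0" for i
      by (simp add: power_mult_distrib nat_mult_distrib)
    show "(-1 :: 'a) ^ nat \<bar>7 * i\<bar> = 1 * (-1) ^ nat \<bar>i\<bar>" for i :: int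
    proof -
      have "even (nat \<bar>7 * i\<bar>) \<longleftrightarrow> even (nat \<bar>i\<bar>)" by (simp add: even_nat_iff)
      then show ?thesis by (cases "even (nat \<bar>i\<bar>)") auto
    qed
    show "(of_nat (?e i) + 0 :: 'a) ^ 3 = 1" if "i \<notin> range (\<lambda>i. 7 * i)" for i
    proof -
      have "\<not> 7 dvd i" using that by auto
      then show ?thesis using of_int_power_6[of i] unfolding sq by (simp flip: power_mult)
    qed
    show "(of_nat (?e (7 * i)) + 0 :: 'a) = 0" for i
      unfolding sq using of_int_eq_0[of "7 * i"] by (simp del: of_int_mult)
  qed (auto simp: inj_def)
  then show ?thesis by (simp add: euler_shift_def)
qed

text \<open>Here \<open>i * (2 * i - 1) + 1/8 = (4 * i - 1) ^ 2 / 8\<close>, and 8 is 1 modulo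
  7.\<close>

lemma psi_euler:
  defines "F \<equiv> theta_series (\<lambda>i::int. nat (i * (2 * i - 1))) (\<lambda>i. 1 :: 'a)"
  shows "euler_shift 1 (euler_shift 1 (euler_shift 1 F)) = F - fps_X ^ 6 * dil 49 F"
proof -
  define e where "e = (\<lambda>i::int. nat (i * (2 * i - 1)))"
  have e2: "int (e i) = i * (2 * i - 1)" for i
  proof -
    have "0 \<le> i * (2 * i - 1)" by (auto simp: zero_le_mult_iff)
    then show ?thesis by (simp add: e_def)
  qed
  have bound: "\<bar>i\<bar> \<le> int (e i)" for i
    by (intro quadratic_exponent_bound[of _ 4 1]) (simp_all only: e2, simp_all add: algebra_simps)
  have sq: "of_nat (e i) + 1 = (of_int (4 * i - 1) :: 'a) ^ 2" for i
  proof -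
    have "(of_nat (e i) :: 'a) + 1 - (of_int (4 * i - 1)) ^ 2
       = of_int (int (e i) + 1 - (4 * i - 1) ^ 2)" by simp
    also have "int (e i) + 1 - (4 * i - 1) ^ 2 = 7 * (- int (e i))"
      using e2[of i] by (simp add: algebra_simps power2_eq_square)
    also have "of_int (7 * (- int (e i))) = (0 :: 'a)" by (rule of_int_eq_0) simp
    finally show ?thesis by (simp only: right_minus_eq)
  qed
  have "euler_shift 1 (euler_shift 1 (euler_shift 1 F)) =
    fps_const 1 * (F - fps_const 1 * (fps_X ^ 6 * dil 49 F))"
    unfolding F_def e_def[symmetric]
  proof (rule theta_series_euler_shift[where \<rho> = "\<lambda>i. 2 - 7 * i"])
    show "finite {i. e i = m}" for m by (rule finite_int_fibre[OF bound])
    show "e (2 - 7 * i) = 49 * e i + 6" for i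
    proof -
      have "int (e (2 - 7 * i)) = int (49 * e i + 6)"
        using e2[of i] e2[of "2 - 7 * i"] by (simp add: algebra_simps)
      then show ?thesis by linarith
    qed
    show "(of_nat (e i) + 1 :: 'a) ^ 3 = 1" if "i \<notin> range (\<lambda>i. 2 - 7 * i)" for i
    proof -
      have "\<not> 7 dvd (4 * i - 1)"
      proof
        assume "7 dvd (4 * i - 1)"
        then have "\<exists>j. i = 2 - 7 * j" by presburger
        then show False using that by auto
      qed
      then show ?thesis using of_int_power_6[of "4 * i - 1"] unfolding sq 
        by (simp flip: power_mult)
    qed
    show "(of_nat (e (2 - 7 * i)) + 1 :: 'a) = 0" for i
    proof -
      have "(of_int (4 * (2 - 7 * i) - 1) :: 'a) = 0" by (rule of_int_eq_0) presburger
      then show ?thesis unfolding sq by (simp del: of_int_diff of_int_mult)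
    qed
  qed (auto simp: inj_def)
  then show ?thesis by simp
qed

text \<open>The weight \<open>2 * i + 1\<close> vanishes modulo 7 at the exceptional indices, so
  \<open>c = 0\<close> and no term in q^49 appears.\<close>

lemma eta_cube_euler:
  "euler_shift 1 (euler_shift 1 (euler_shift 1 (eta 1 ^ 3))) = (eta 1 ^ 3 :: 'a fps)"
proof -
  define e where "e = (\<lambda>i::nat. i * (i + 1) div 2)"
  let ?s = "\<lambda>i::nat. (-1) ^ i * of_nat (2 * i + 1) :: 'a"
  have e2: "2 * e i = i * (i + 1)" for i by (simp add: e_def)
  have bound: "i \<le> e i" for i by (cases i) (auto simp: e_def algebra_simps)
  have sq: "of_nat (e i) + 1 = (of_int (2 * int i + 1) :: 'a) ^ 2" for i
  proof -
    have "(of_nat (e i) :: 'a) + 1 - (of_int (2 * int i + 1)) ^ 2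
       = of_int (int (e i) + 1 - (2 * int i + 1) ^ 2)" by simp
    also have "int (e i) + 1 - (2 * int i + 1) ^ 2 = 7 * (- int (e i))"
    proof -
      have "2 * int (e i) = int i * (int i + 1)" using e2[of i]
          by (metis of_nat_1 of_nat_add of_nat_mult of_nat_numeral)
      then show ?thesis by (simp add: algebra_simps power2_eq_square)
    qed
    also have "of_int (7 * (- int (e i))) = (0 :: 'a)" by (rule of_int_eq_0) simp
    finally show ?thesis by (simp only: right_minus_eq)
  qed
  have "euler_shift 1 (euler_shift 1 (euler_shift 1 (theta_series e ?s))) =
    fps_const 1 * (theta_series e ?s - fps_const 0 * (fps_X ^ 6 * dil 49 (theta_series e ?s)))"
  proof (rule theta_series_euler_shift[where \<rho> = "\<lambda>i. 7 * i + 3"])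
    show "finite {i. e i = m}" for m
      by (rule finite_subset[of _ "{..m}"]) (use bound in auto)
    show "e (7 * i + 3) = 49 * e i + 6" for i
    proof -
      have "2 * e (7 * i + 3) = 2 * (49 * e i + 6)"
        unfolding distrib_left[of 2] mult.left_commute[of 2 49] e2 by (simp add: algebra_simps)
      then show ?thesis by (simp only: mult_cancel_left) simp
    qed
    show "?s (7 * i + 3) = 0 * ?s i" for i
    proof -
      have "(of_nat (2 * (7 * i + 3) + 1) :: 'a) = of_int (7 * (2 * int i + 1))" by simp
      also have "\<dots> = 0" by (rule of_int_eq_0) simp
      finally show ?thesis by simp
    qed
    show "(of_nat (e i) + 1 :: 'a) ^ 3 = 1" if "i \<notin> range (\<lambda>i. 7 * i + 3)" for i
    proof -
      have "\<not> 7 dvd (2 * int i + 1)"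
      proof
        assume "7 dvd (2 * int i + 1)"
        then have "\<exists>j. i = 7 * j + 3" by presburger
        then show False using that by auto
      qed
      then show ?thesis using of_int_power_6[of "2 * int i + 1"] unfolding sq 
        by (simp flip: power_mult)
    qed
    show "(of_nat (e (7 * i + 3)) + 1 :: 'a) = 0" for i
    proof -
      have "(of_int (2 * int (7 * i + 3) + 1) :: 'a) = 0" by (rule of_int_eq_0) presburger
      then show ?thesis unfolding sq by (simp del: of_int_add of_int_mult)
    qed
  qed (auto simp: inj_def)
  then show ?thesis unfolding e_def jacobi_cube[symmetric] by simp
qed

section \<open>Frobenius\<close>

lemma one_minus_power_7: "(1 - x) ^ 7 = 1 - (x :: 'a fps) ^ 7"
proof (rule char7_fps_eqI)
  show "(1 - x) ^ 7 - (1 - x ^ 7) = 7 * (- x + 3 * x^2 - 5 * x^3 + 5 * x^4 - 3 * x^5 + x^6)"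
    by (simp add: algebra_simps eval_nat_numeral)
qed

lemma eta_power_7:
  assumes "k \<ge> 1"
  shows "eta k ^ 7 = (eta (7 * k) :: 'a fps)"
proof (rule agree_eqI)
  fix M
  have "agree M (eta k ^ 7) (eta_part k M ^ 7 :: 'a fps)"
    using assms by (intro agree_power agree_sym[OF agree_eta_part_eta]) auto
  also have "eta_part k M ^ 7 = (eta_part (7 * k) M :: 'a fps)"
    unfolding eta_part_def prod_power_distrib one_minus_power_7
    by (simp add: mult_ac flip: power_mult)
  also have "agree M \<dots> (eta (7 * k))"
    using assms by (intro agree_eta_part_eta) auto
  finally show "agree M (eta k ^ 7) (eta (7 * k) :: 'a fps)" .
qed

lemma numeral_nonzero: "(2::'a) \<noteq> 0" "(3::'a) \<noteq> 0"
proof -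
  have "(7::'a) = 2 * 3 + 1" "(7::'a) = 3 * 2 + 1" by simp_all
  then show "(2::'a) \<noteq> 0" "(3::'a) \<noteq> 0" using char7 by force+
qed

lemma dil_7_eta1: "dil 7 eta1 = (eta1 ^ 7 :: 'a fps)"
  and dil_7_eta2: "dil 7 eta2 = (eta2 ^ 7 :: 'a fps)"
  unfolding eta1_def eta2_def by (subst dil_eta; simp add: eta_power_7)+

text \<open>Makes the terms in q^49 of the differential equations 49th powers, so that these
  equations can be divided by the theta series.\<close>

lemma eta_power_49: 
  assumes "k \<ge> 1"
  shows "dil 49 (eta k) = (eta k ^ 49 :: 'a fps)"
proof -
  have "eta k ^ 49 = ((eta k ^ 7) ^ 7 :: 'a fps)" by (simp flip: power_mult)
  also have "\<dots> = eta (7 * k) ^ 7"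
    using assms by (simp only: eta_power_7)
  also have "\<dots> = eta (7 * (7 * k))"
    using assms by (intro eta_power_7) simp
  finally show ?thesis using assms by (subst dil_eta) simp_all
qed

lemma dil_49_eta1: "dil 49 eta1 = (eta1 ^ 49 :: 'a fps)"
  and dil_49_eta2: "dil 49 eta2 = (eta2 ^ 49 :: 'a fps)"
  unfolding eta1_def eta2_def by (simp_all only: eta_power_49 le_refl one_le_numeral)

lemma dil_49_psi: "dil 49 psi = (psi ^ 49 :: 'a fps)"
proof -
  have "eta1 ^ 49 * dil 49 psi = dil 49 (eta1 * psi :: 'a fps)"
    by (simp add: dil_mult dil_49_eta1)
  also have "\<dots> = (eta2 ^ 49) ^ 2" unfolding eta1_psi by (simp add: dil_power dil_49_eta2)
  also have "\<dots> = (eta1 * psi) ^ 49" unfolding eta1_psi by (simp flip: power_mult)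
  finally show ?thesis by (simp add: power_mult_distrib)
qed

lemma dil_49_phi: "dil 49 phi = (phi ^ 49 :: 'a fps)"
proof -
  have "eta2 ^ 49 * dil 49 phi = dil 49 (eta2 * phi :: 'a fps)"
    by (simp add: dil_mult dil_49_eta2)
  also have "\<dots> = (eta1 ^ 49) ^ 2" unfolding eta2_phi by (simp add: dil_power dil_49_eta1)
  also have "\<dots> = (eta2 * phi) ^ 49" unfolding eta2_phi by (simp flip: power_mult)
  finally show ?thesis by (simp add: power_mult_distrib)
qed

section \<open>Algebraic relations of level one and level two\<close>

text \<open>The differential equations of \<open>\<eta>\<close> and \<open>\<eta>\<^sup>3\<close> determine the first two derivatives of \<open>p1\<close>; differentiating
  the first of these and comparing with the second leaves an algebraic relation that factors.\<close>

lemma level_1_relations: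
  fixes D :: "'a fps"
  defines "D \<equiv> fps_X * eta1 ^ 24"
  shows "p1 * euler p1 = 1 - D ^ 2 + p1 ^ 3"
    and "euler (euler p1) = 3 + 2 * D ^ 2 + 3 * p1 ^ 3"
    and "p1 ^ 3 = - ((1 - D) ^ 2)"
proof -
  define p where "p = (p1 :: 'a fps)"
  define q where "q = euler p"
  define r where "r = euler q"
  have "euler_shift 5 eta1 = p1 * (eta1 :: 'a fps)"
    by (simp add: euler_shift_def euler_eta1 numeral_fps_const[symmetric] algebra_simps)
  from euler_shift_cubed[OF this] eta_euler
  have "(r + 3 * p * q + p ^ 3) * eta1 = - (eta1 + fps_X ^ 2 * eta1 ^ 49)"
    by (simp only: p_def q_def r_def eta1_def[symmetric] dil_49_eta1)
  also have "\<dots> = (- (1 + D ^ 2)) * eta1"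
    by (simp add: D_def algebra_simps power_mult_distrib flip: power_mult power_Suc)
  finally have e1: "r + 3 * p * q + p ^ 3 = - (1 + D ^ 2)" by simp
  have "euler_shift 1 (eta1 ^ 3) = (3 * p1 - 14) * (eta1 ^ 3 :: 'a fps)"
    unfolding euler_shift_def euler_power euler_eta1 by (simp add: algebra_simps eval_nat_numeral)
  moreover have "3 * p1 - 14 = (3 * p1 :: 'a fps)" by (rule char7_fps_eqI[of _ _ "-2"]) simp
  ultimately have "euler_shift 1 (eta1 ^ 3) = (3 * p1) * (eta1 ^ 3 :: 'a fps)" by simp
  from euler_shift_cubed[OF this] eta_cube_euler
  have "(3 * r + 27 * p * q + 27 * p ^ 3) * eta1 ^ 3 = 1 * eta1 ^ 3"
    unfolding eta1_def[symmetric]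
        by (simp add: p_def q_def r_def euler_mult algebra_simps power_mult_distrib)
  then have e3: "3 * r + 27 * p * q + 27 * p ^ 3 = 1" by (simp only: mult_cancel_right) simp
  \<comment> \<open>\<open>e1\<close> and \<open>e3\<close> are linear in \<open>r\<close> and
    \<open>p * q\<close>, so they can be solved for both.\<close>
  have "p * q - (1 - D ^ 2 + p ^ 3) = 7 * (1 + D ^ 2 - 5 * p * q - 7 * p ^ 3)"
    using e1 e3 by algebra
  then have pq: "p * q = 1 - D ^ 2 + p ^ 3" by (rule char7_fps_eqI)
  then show "p1 * euler p1 = 1 - D ^ 2 + p1 ^ 3" by (simp add: p_def q_def)
  have "r - (3 + 2 * D ^ 2 + 3 * p ^ 3) = 7 * (-1 - p ^ 3)"
    using e1 pq by algebra
  then have r: "r = 3 + 2 * D ^ 2 + 3 * p ^ 3" by (rule char7_fps_eqI)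
  then show "euler (euler p1) = 3 + 2 * D ^ 2 + 3 * p1 ^ 3" by (simp add: p_def q_def r_def)
  have "euler D = D * (24 * p - 119)"
    unfolding D_def euler_mult euler_power euler_eta1 p_def[symmetric]
  proof -
    have "eta1 ^ 24 = eta1 * (eta1 ^ 23 :: 'a fps)" by (simp flip: power_Suc)
    then show "euler fps_X * eta1 ^ 24 + fps_X * (of_nat 24 * eta1 ^ (24 - 1) * ((p - 5) * eta1)) =
        fps_X * eta1 ^ 24 * (24 * p - 119)"
      by (simp add: algebra_simps)
  qed
  also have "\<dots> = 3 * p * D"
    by (rule char7_fps_eqI[of _ _ "3 * p * D - 17 * D"]) (simp add: algebra_simps)
  finally have D': "euler D = 3 * p * D" .
  have "euler (p * q) = euler (1 - D ^ 2 + p ^ 3)" by (simp add: pq)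
  then have "q * q + p * r = - (2 * D * (3 * p * D)) + 3 * p ^ 2 * q"
    unfolding euler_mult euler_add euler_diff euler_power D' q_def[symmetric] r_def[symmetric]
    by (simp add: q_def[symmetric])
  \<comment> \<open>After multiplication by \<open>p ^ 2\<close> only \<open>p * q\<close>,
    \<open>r\<close>, \<open>p ^ 3\<close> and \<open>D\<close> occur, and the relations found can
    be inserted.\<close>
  then have "(p * q) ^ 2 + p ^ 3 * r + 6 * p ^ 3 * D ^ 2 - 3 * p ^ 3 * (p * q) = 0"
    by algebra
  then have "(1 - D ^ 2 + p ^ 3) ^ 2 + p ^ 3 * (3 + 2 * D ^ 2 + 3 * p ^ 3) + 6 * p ^ 3 * D ^ 2
      - 3 * p ^ 3 * (1 - D ^ 2 + p ^ 3) = 0"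
    unfolding pq r .
  then have "(p ^ 3 + 1 + D ^ 2 - 2 * D) * (p ^ 3 + 1 + D ^ 2 + 2 * D) - 0 =
      7 * (- (p ^ 3 * D ^ 2))"
    by algebra
  then have prod: "(p ^ 3 + 1 + D ^ 2 - 2 * D) * (p ^ 3 + 1 + D ^ 2 + 2 * D) = 0"
      by (rule char7_fps_eqI)
  \<comment> \<open>Both factors have constant coefficient 0 modulo 7, so the coefficient of q
    decides; here it is \<open>3 * 25 * (-1) + 2\<close>.\<close>
  have "fps_nth (p ^ 3 + 1 + D ^ 2 + 2 * D) 1 = -73"
  proof -
    have "fps_nth D 0 = 0" "fps_nth D 1 = 1"
      by (simp_all add: D_def fps_mult_nth fps_power_zeroth)
    then show ?thesis using p1_nth_0[where 'a = 'a] p1_nth_1[where 'a = 'a]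
      by (simp add: p_def power3_eq_cube power2_eq_square fps_mult_nth fps_numeral_nth)
  qed
  moreover have "(-73 :: 'a) = -3" by (rule char7_eqI[of _ _ "-10"]) simp
  ultimately have "p ^ 3 + 1 + D ^ 2 + 2 * D \<noteq> 0"
    using numeral_nonzero by (metis fps_zero_nth neg_equal_0_iff_equal)
  with prod have "p ^ 3 + 1 + D ^ 2 - 2 * D = 0" by simp
  then have "p ^ 3 = - ((1 - D) ^ 2)" by algebra
  then show "p1 ^ 3 = - ((1 - D) ^ 2)" by (simp add: p_def)
qed

text \<open>Modulo 7, \<open>p2\<close> is twice the dilated \<open>p1\<close>, and each derivation
  of a dilation brings another 2. In all three relations these factors amount to 8, which is
  1.\<close>

lemma level_2_relations:
  fixes D :: "'a fps"
  defines "D \<equiv> fps_X ^ 2 * eta2 ^ 24"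
  shows "p2 * euler p2 = 1 - D ^ 2 + p2 ^ 3"
    and "euler (euler p2) = 3 + 2 * D ^ 2 + 3 * p2 ^ 3"
    and "p2 ^ 3 = - ((1 - D) ^ 2)"
proof -
  define P where "P = (dil 2 p1 :: 'a fps)"
  have p2: "p2 = 2 * P" unfolding p2_eq P_def by (rule char7_fps_eqI[of _ _ "-1"]) simp
  have DD: "dil 2 (fps_X * eta1 ^ 24) = D"
    by (simp add: D_def dil_mult dil_power dil_2_eta1 dil_X)
  have d1: "euler P = 2 * dil 2 (euler p1)" by (simp add: P_def euler_dil)
  have d2: "euler (euler P) = 4 * dil 2 (euler (euler p1))"
    by (simp add: d1 euler_mult euler_dil)
  have c: "dil 2 (p1 ^ 3) = P ^ 3" by (simp add: P_def dil_power)
  have "P * dil 2 (euler p1) = dil 2 (p1 * euler p1)" by (simp add: P_def dil_mult)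
  also have "\<dots> = 1 - D ^ 2 + P ^ 3"
    unfolding level_1_relations(1) dil_add dil_diff dil_one dil_power[OF zero_less_numeral, of _ _
        2] DD c ..
  finally have r1: "P * dil 2 (euler p1) = 1 - D ^ 2 + P ^ 3" .
  have r2: "dil 2 (euler (euler p1)) = 3 + 2 * D ^ 2 + 3 * P ^ 3"
    unfolding level_1_relations(2) by (simp add: dil_add dil_mult c dil_power[where n = 2] DD)
  have r3: "P ^ 3 = - ((1 - D) ^ 2)"
    unfolding c[symmetric] level_1_relations(3) by (simp add: dil_uminus dil_power[where n =
        2] dil_diff DD)
  have "p2 * euler p2 - (1 - D ^ 2 + p2 ^ 3) = 7 * (1 - D ^ 2)"
  proof -
    have "p2 * euler p2 = 8 * (P * dil 2 (euler p1))" by (simp add: p2 euler_mult d1)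
    then show ?thesis using r1 p2 by algebra
  qed
  then show "p2 * euler p2 = 1 - D ^ 2 + p2 ^ 3" by (rule char7_fps_eqI)
  have "euler (euler p2) - (3 + 2 * D ^ 2 + 3 * p2 ^ 3) = 7 * (3 + 2 * D ^ 2)"
    using r2 by (simp add: p2 euler_mult d2 algebra_simps power3_eq_cube)
  then show "euler (euler p2) = 3 + 2 * D ^ 2 + 3 * p2 ^ 3" by (rule char7_fps_eqI)
  have "p2 ^ 3 - (- ((1 - D) ^ 2)) = 7 * (- ((1 - D) ^ 2))"
    using r3 unfolding p2 by algebra
  then show "p2 ^ 3 = - ((1 - D) ^ 2)" by (rule char7_fps_eqI)
qed

text \<open>The equations of \<open>phi\<close> and \<open>psi\<close>, with derivatives removed by
  the relations of level one and two, yield an equality of cubes. The cube roots of unity modulo 7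
  are 1, 2, 4, and the constant coefficients select 1.\<close>

lemma aa_eq: "(aa :: 'a fps) = 3 * (p2 - p1)"
proof -
  define a b u v where "a = (p1 :: 'a fps)" and "b = (p2 :: 'a fps)"
    and "u = (uu :: 'a fps)" and "v = (vv :: 'a fps)"
  define a1 b1 a2 b2 where "a1 = euler a" and "b1 = euler b" and "a2 = euler a1" and "b2 = euler b1"
  note defs = a_def b_def u_def v_def a1_def b1_def a2_def b2_def
  have h1: "a * a1 = 1 - (u ^ 2 * v) ^ 2 + a ^ 3" and g1: "a2 = 3 + 2 * (u ^ 2 * v) ^ 2 + 3 * a ^ 3"
    using level_1_relations(1,2) by (simp_all only: defs Delta_1)
  have h2: "b * b1 = 1 - (u * v ^ 2) ^ 2 + b ^ 3" and g2: "b2 = 3 + 2 * (u * v ^ 2) ^ 2 + 3 * b ^ 3"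
    using level_2_relations(1,2) by (simp_all only: defs Delta_2)
  have "euler_shift 1 psi = (2 * b - a) * psi"
    unfolding euler_shift_def euler_psi a_def b_def by (simp add: algebra_simps)
  from euler_shift_cubed[OF this] psi_euler
  have "((2 * b2 - a2) + 3 * (2 * b - a) * (2 * b1 - a1) + (2 * b - a) ^ 3) * psi =
      psi - fps_X ^ 6 * psi ^ 49"
    unfolding psi_def[symmetric] dil_49_psi
    by (simp add: euler_diff euler_mult flip: a1_def b1_def a2_def b2_def)
  also have "\<dots> = (1 - v ^ 6) * psi"
    by (simp add: v_def vv_def power_mult_distrib algebra_simps flip: power_mult power_Suc)
  finally have e1: "(2 * b2 - a2) + 3 * (2 * b - a) * (2 * b1 - a1) + (2 * b - a) ^ 3 = 1 - v ^ 6"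
    using psi_nonzero[where 'a = 'a] by (simp only: mult_cancel_right) simp
  have "euler phi = (2 * a - b) * phi"
    unfolding euler_phi a_def b_def
        by (rule char7_fps_eqI[of _ _ "- phi"]) (simp add: algebra_simps)
  then have "euler_shift 0 phi = (2 * a - b) * phi" by (simp add: euler_shift_def)
  from euler_shift_cubed[OF this] phi_euler
  have "((2 * a2 - b2) + 3 * (2 * a - b) * (2 * a1 - b1) + (2 * a - b) ^ 3) * phi = phi - phi ^ 49"
    unfolding phi_def[symmetric] dil_49_phi
    by (simp add: euler_shift_def euler_diff euler_mult flip: a1_def b1_def a2_def b2_def)
  also have "\<dots> = (1 - u ^ 6) * phi"
    by (simp add: u_def uu_def algebra_simps flip: power_mult power_Suc)
  finally have e2: "(2 * a2 - b2) + 3 * (2 * a - b) * (2 * a1 - b1) + (2 * a - b) ^ 3 = 1 - u ^ 6"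
    using phi_nonzero[where 'a = 'a] by (simp only: mult_cancel_right) simp
  have "(3 * (b - a)) ^ 3 - (u ^ 2 - v ^ 2) ^ 3 = 7 * (-9 * a * b ^ 2 + 9 * a ^ 2 * b)"
    using e1 e2 h1 h2 g1 g2 by algebra
  then have cube: "(3 * (b - a)) ^ 3 = (u ^ 2 - v ^ 2) ^ 3" by (rule char7_fps_eqI)
  define A B where "A = 3 * (b - a)" and "B = u ^ 2 - v ^ 2"
  have "(A - B) * (A - 2 * B) * (A - 4 * B) - 0 = 7 * (2 * A * B ^ 2 - A ^ 2 * B - B ^ 3)"
    using cube unfolding A_def[symmetric] B_def[symmetric] by algebra
  then have "(A - B) * (A - 2 * B) * (A - 4 * B) = 0" by (rule char7_fps_eqI)
  moreover have "fps_nth A 0 = 1"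
  proof -
    have "fps_nth A 0 = -6"
      by (simp add: A_def a_def b_def p1_nth_0 p2_def euler_nth)
    also have "\<dots> = 1" by (rule char7_eqI[of _ _ "-1"]) simp
    finally show ?thesis .
  qed
  moreover have "fps_nth B 0 = 1"
    using aa_nth_0[where 'a = 'a] by (simp add: B_def aa_def u_def v_def)
  moreover have "A - 2 * B \<noteq> 0" "A - 4 * B \<noteq> 0"
  proof -
    have "fps_nth (A - 2 * B) 0 \<noteq> 0" using calculation by simp
    then show "A - 2 * B \<noteq> 0" by (metis fps_zero_nth)
    have "fps_nth (A - 4 * B) 0 = -3" using calculation by simp
    then have "fps_nth (A - 4 * B) 0 \<noteq> 0" using numeral_nonzero by simp
    then show "A - 4 * B \<noteq> 0" by (metis fps_zero_nth)
  qed
  ultimately have "A = B" by simp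
  then show ?thesis by (simp add: A_def B_def aa_def a_def b_def u_def v_def)
qed

text \<open>The series \<open>Q1\<close>, \<open>Q2\<close> below are the Eisenstein series of weight four at \<open>\<tau>\<close> and (up to a factor) \<open>2\<tau>\<close>.
  With \<open>Q2 - Q1 = k (uu - vv)\<close>, the differences of their squares and cubes force \<open>k = 3\<close>.\<close>

lemma uu_vv_relation: "(uu - vv) ^ 2 * (uu + vv) = (1 :: 'a fps)"
  and p1_uu_vv: "(p1 :: 'a fps) = 5 * (uu + 4 * vv) ^ 2" 
  and p2_uu_vv: "(p2 :: 'a fps) = 5 * (4 * uu + vv) ^ 2"
proof -
  \<comment> \<open>The factor 3 removes a sign, as \<open>3 ^ 3 = -1\<close> modulo 7, and makes
    \<open>n - m\<close> equal to \<open>aa\<close>.\<close>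
  define u v m n where "u = (uu :: 'a fps)" and "v = (vv :: 'a fps)"
    and "m = 3 * (p1 :: 'a fps)" and "n = 3 * (p2 :: 'a fps)"
  have u0: "fps_nth u 0 = 1" and v0: "fps_nth v 0 = 0"
    by (simp_all add: u_def v_def uu_nth_0 vv_nth_0)
  have mn: "n = m + (u ^ 2 - v ^ 2)"
    using aa_eq by (simp add: aa_def u_def v_def m_def n_def algebra_simps)
  have "p1 ^ 3 = - ((1 - u ^ 2 * v) ^ 2)"
    using level_1_relations(3) unfolding Delta_1 u_def v_def .
  then have "m ^ 3 - (1 - u ^ 2 * v) ^ 2 = 7 * (- 4 * (1 - u ^ 2 * v) ^ 2)"
    unfolding m_def by algebra
  then have m3: "m ^ 3 = (1 - u ^ 2 * v) ^ 2" by (rule char7_fps_eqI)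
  have "p2 ^ 3 = - ((1 - u * v ^ 2) ^ 2)"
    using level_2_relations(3) unfolding Delta_2 u_def v_def .
  then have "n ^ 3 - (1 - u * v ^ 2) ^ 2 = 7 * (- 4 * (1 - u * v ^ 2) ^ 2)"
    unfolding n_def by algebra
  then have n3: "n ^ 3 = (1 - u * v ^ 2) ^ 2" by (rule char7_fps_eqI)
  have m0: "fps_nth m 0 = 15" by (simp add: m_def p1_nth_0)
  have n0: "fps_nth n 0 = 9" by (simp add: n_def p2_def euler_nth)
  have c15: "(15::'a) = 1" by (rule char7_eqI[of _ _ 2]) simp
  have c9: "(9::'a) = 2" by (rule char7_eqI[of _ _ 1]) simp
  \<comment> \<open>Since \<open>m ^ 3 = (1 - u ^ 2 * v) ^ 2\<close>, this quotient is a square root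
    of \<open>m\<close> with cube \<open>1 - u ^ 2 * v\<close>; similarly for \<open>Q2\<close> and
    \<open>n\<close>.\<close>
  define Q1 Q2 where "Q1 = (1 - u ^ 2 * v) * inverse m" and "Q2 = (1 - u * v ^ 2) * inverse n"
  have Q1m: "Q1 * m = 1 - u ^ 2 * v"
    using m0 c15 by (simp add: Q1_def mult.assoc inverse_mult_eq_1)
  have Q2n: "Q2 * n = 1 - u * v ^ 2"
    using n0 c9 numeral_nonzero by (simp add: Q2_def mult.assoc inverse_mult_eq_1)
  have mne: "m \<noteq> 0" using m0 c15 by auto
  have nne: "n \<noteq> 0" using n0 c9 numeral_nonzero by auto
  have "m ^ 2 * (Q1 ^ 2 - m) = 0" using Q1m m3 by algebra
  then have Q1sq: "Q1 ^ 2 = m" using mne by simp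
  have "n ^ 2 * (Q2 ^ 2 - n) = 0" using Q2n n3 by algebra
  then have Q2sq: "Q2 ^ 2 = n" using nne by simp
  have Q10: "fps_nth Q1 0 = 1"
    using arg_cong[OF Q1m, of "\<lambda>F. fps_nth F 0"] by (simp add: m0 c15 u0 v0)
  have Q20: "fps_nth Q2 0 = 4"
  proof (rule char7_eqI)
    have "fps_nth Q2 0 * 9 = 1"
      using arg_cong[OF Q2n, of "\<lambda>F. fps_nth F 0"] by (simp add: n0 u0 v0)
    then have "fps_nth Q2 0 * 9 * 4 = 4" by (simp only:) simp
    then show "fps_nth Q2 0 - 4 = 7 * (-5 * fps_nth Q2 0)" by (simp add: algebra_simps)
  qed
  define a b where "a = u - v" and "b = u + v"
  have a0: "fps_nth a 0 = 1" and b0: "fps_nth b 0 = 1" by (simp_all add: a_def b_def u0 v0)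
  have ane: "a \<noteq> 0" using a0 by auto
  define k where "k = (Q2 - Q1) * inverse a"
  have ka: "k * a = Q2 - Q1"
    using a0 by (simp add: k_def mult.assoc inverse_mult_eq_1)
  have k0: "fps_nth k 0 = 3"
    using arg_cong[OF ka, of "\<lambda>F. fps_nth F 0"] by (simp add: a0 Q10 Q20)
  have "a * (k * (Q2 + Q1) - b) = 0"
    using ka Q1sq Q2sq mn unfolding a_def b_def by algebra
  then have ks: "k * (Q2 + Q1) = b" using ane by simp
  have "a * (k * (3 * (Q2 + Q1) ^ 2 + k ^ 2 * a ^ 2) - (b ^ 2 - a ^ 2)) = 0"
  proof -
    have "4 * (Q2 ^ 3 - Q1 ^ 3) = 4 * (u * v * a)"
    proof -
      have "Q1 ^ 3 = 1 - u ^ 2 * v" "Q2 ^ 3 = 1 - u * v ^ 2"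
        using Q1m Q2n unfolding Q1sq[symmetric] Q2sq[symmetric]
        by (simp_all add: power3_eq_cube power2_eq_square mult.assoc)
      then show ?thesis unfolding a_def by algebra
    qed
    moreover have "4 * (Q2 ^ 3 - Q1 ^ 3) = (Q2 - Q1) * (3 * (Q2 + Q1) ^ 2 + (Q2 - Q1) ^ 2)"
      by algebra
    moreover have "4 * (u * v * a) = a * (b ^ 2 - a ^ 2)" unfolding a_def b_def by algebra
    ultimately show ?thesis using ka by algebra
  qed
  then have "k * (3 * (Q2 + Q1) ^ 2 + k ^ 2 * a ^ 2) = b ^ 2 - a ^ 2" using ane by simp
  then have "3 * b ^ 2 + k ^ 4 * a ^ 2 - k * (b ^ 2 - a ^ 2) = 0" using ks by algebra
  \<comment> \<open>The coefficient of \<open>a ^ 2\<close> is \<open>k * (k ^ 3 + 1)\<close>, and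
    the cube roots of -1 modulo 7 are 3, 5 and 6.\<close>
  then have "(k - 3) * (a ^ 2 * k * (k - 5) * (k - 6) - b ^ 2) - 0 =
      7 * (-13 * a ^ 2 * k + 9 * a ^ 2 * k ^ 2 - 2 * a ^ 2 * k ^ 3)" by algebra
  then have kk: "(k - 3) * (a ^ 2 * k * (k - 5) * (k - 6) - b ^ 2) = 0" by (rule char7_fps_eqI)
  have "fps_nth (a ^ 2 * k * (k - 5) * (k - 6) - b ^ 2) 0 = 17"
    by (simp add: fps_power_zeroth a0 b0 k0)
  moreover have "(17::'a) = 3" by (rule char7_eqI[of _ _ 2]) simp
  ultimately have "a ^ 2 * k * (k - 5) * (k - 6) - b ^ 2 \<noteq> 0"
    using numeral_nonzero by (metis fps_zero_nth)
  then have k3: "k = 3" using kk by simp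
  have "Q1 - (u + 4 * v) = 7 * (Q1 + u - 2 * v)"
    using ka ks unfolding k3 a_def b_def by algebra
  then have Q1: "Q1 = u + 4 * v" by (rule char7_fps_eqI)
  have "Q2 - (4 * u + v) = 7 * (Q2 - 2 * u + v)"
    using ka ks unfolding k3 a_def b_def by algebra
  then have Q2: "Q2 = 4 * u + v" by (rule char7_fps_eqI)
  have "(u - v) ^ 2 * (u + v) - 1 = 7 * (-7 * u * v ^ 2 - 2 * u ^ 2 * v - 9 * v ^ 3)"
    using Q1m Q1sq unfolding Q1 by algebra
  then have "(u - v) ^ 2 * (u + v) = 1" by (rule char7_fps_eqI)
  then show "(uu - vv) ^ 2 * (uu + vv) = (1 :: 'a fps)" by (simp only: u_def v_def)
  have "p1 - 5 * (u + 4 * v) ^ 2 = 7 * (-2 * p1)"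
    using Q1sq unfolding Q1 m_def by algebra
  then have "p1 = 5 * (u + 4 * v) ^ 2" by (rule char7_fps_eqI)
  then show "(p1 :: 'a fps) = 5 * (uu + 4 * vv) ^ 2" by (simp only: u_def v_def)
  have "p2 - 5 * (4 * u + v) ^ 2 = 7 * (-2 * p2)"
    using Q2sq unfolding Q2 n_def by algebra
  then have "p2 = 5 * (4 * u + v) ^ 2" by (rule char7_fps_eqI)
  then show "(p2 :: 'a fps) = 5 * (4 * uu + vv) ^ 2" by (simp only: u_def v_def)
qed

section \<open>Laurent polynomials in aa\<close>

lemma aa_diff: "aa * (uu - vv) = (1 :: 'a fps)"
  using uu_vv_relation unfolding aa_def by algebra

lemma aa_square: "(aa :: 'a fps) ^ 2 = uu + vv"
  using uu_vv_relation unfolding aa_def by algebra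

text \<open>\<open>aa_diff\<close> and \<open>aa_square\<close> determine \<open>uu - vv\<close> and
  \<open>uu + vv\<close>; the factor 4 is 1/2 modulo 7.\<close>

lemma aa_uu: "aa * uu = 4 * (aa ^ 3 + 1 :: 'a fps)"
proof (rule char7_fps_eqI)
  show "aa * uu - 4 * (aa ^ 3 + 1) = 7 * (- (aa * uu) :: 'a fps)"
    using aa_diff aa_square by algebra
qed

lemma aa_vv: "aa * vv = 4 * (aa ^ 3 - 1 :: 'a fps)"
proof (rule char7_fps_eqI)
  show "aa * vv - 4 * (aa ^ 3 - 1) = 7 * (- (aa * vv) :: 'a fps)"
    using aa_diff aa_square by algebra
qed

text \<open>The derivative is first found as \<open>3 * uu * vv * aa\<close>. Then
  \<open>aa ^ 2 * uu * vv\<close> is a quarter of \<open>aa ^ 6 - 1\<close>, and 3/4 is -1 modulo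
  7.\<close>

lemma aa_euler_aa: "aa * euler aa = 1 - (aa :: 'a fps) ^ 6"
proof -
  have e0: "euler aa = 2 * uu * (8 * (2 * p1 - p2 - 7) * uu) - 2 * vv * ((16 * p2 - 8 * p1
      - 7) * (vv :: 'a fps))"
    unfolding aa_def euler_diff euler_power euler_uu euler_vv by simp
  have "euler (aa :: 'a fps) - 3 * uu * vv * aa =
      7 * (-91 * uu * vv ^ 3 - 16 * uu ^ 2 + 91 * uu ^ 3 * vv
      - 160 * uu ^ 4 + 2 * vv ^ 2 + 160 * vv ^ 4)"
    unfolding e0 p1_uu_vv p2_uu_vv unfolding aa_def by algebra
  then have e: "euler aa = 3 * uu * vv * (aa :: 'a fps)" by (rule char7_fps_eqI)
  have "aa * euler aa - (1 - aa ^ 6) = 7 * (uu * vv * (aa :: 'a fps) ^ 2)"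
    unfolding e using aa_diff aa_square by algebra
  then show ?thesis by (rule char7_fps_eqI)
qed

lemma euler_aa_power:
  assumes "k \<ge> 2"
  shows "euler (aa ^ k) = of_nat k * (aa ^ (k - 2) - (aa :: 'a fps) ^ (k + 4))"
proof -
  define j where "j = k - 2"
  have k: "k = j + 2" using assms by (simp add: j_def)
  have e: "k - 1 = j + 1" "k - 2 = j" "k + 4 = j + 6" by (simp_all add: k)
  have "euler (aa ^ k) = of_nat k * (aa ^ j * (aa * euler (aa :: 'a fps)))"
    unfolding euler_power e power_add by (simp only: power_one_right mult_ac)
  then show ?thesis
    unfolding aa_euler_aa e power_add by (simp only: right_diff_distrib mult_1_right)
qed

lemma aa_p2: "aa ^ 2 * p2 = 5 * ((aa :: 'a fps) ^ 3 + 2) ^ 2"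
proof (rule char7_fps_eqI)
  define y where "y = (aa :: 'a fps) ^ 3"
  have "aa * (4 * uu + vv) = 20 * y + (12 :: 'a fps)"
    using aa_uu aa_vv unfolding y_def by algebra
  then show "aa ^ 2 * p2 - 5 * (y + 2) ^ 2 = 7 * (100 + 340 * y + 285 * y ^ 2 :: 'a fps)"
    unfolding p2_uu_vv by algebra
qed

lemma aa_p1_p2: "aa ^ 2 * (p1 + 2 * p2) = (aa ^ 3) ^ 2 + 6 * aa ^ 3 + (4 :: 'a fps)"
proof (rule char7_fps_eqI)
  define y where "y = (aa :: 'a fps) ^ 3"
  have "aa * (4 * uu + vv) = 20 * y + (12 :: 'a fps)" "aa * (uu + 4 * vv) = 20 * y
      - (12 :: 'a fps)"
    using aa_uu aa_vv unfolding y_def by algebra+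
  then show "aa ^ 2 * (p1 + 2 * p2) - (y ^ 2 + 6 * y + 4) = 7 * (308 + 342 * y
      + 857 * y ^ 2 :: 'a fps)"
    unfolding p1_uu_vv p2_uu_vv by algebra
qed

text \<open>\<open>p2\<close> starts with \<open>aa\<close> to the power -2 and each derivation
  lowers exponents by 2. The factor \<open>aa ^ 14\<close>, a constant for the derivation, clears
  all negative exponents.\<close>

lemma euler_5_p2:
  "aa ^ 14 * euler (euler (euler (euler (euler p2)))) = -3 * aa ^ 2 + aa ^ 8 - aa ^ 14
      + 2 * aa ^ 17 + 2 * aa ^ 20 + aa ^ 26 + 3 * aa ^ 32 - 2 * aa ^ 35 - 3 * aa ^ 38
      + (0 :: 'a fps)"
proof -
  have c: "aa ^ 14 * euler F = euler (aa ^ 14 * F :: 'a fps)" for F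
  proof -
    have "euler (aa ^ 14 :: 'a fps) = 0"
      by (rule char7_fps_eqI[of _ _ "2 * (aa ^ 12 - aa ^ 18)"]) (simp add: euler_aa_power)
    then show ?thesis by (simp add: euler_mult)
  qed
  have e0: "aa ^ 14 * p2 = -1 * aa ^ 12 - aa ^ 15 - 2 * aa ^ 18 + (0 :: 'a fps)"
    by (rule char7_fps_eqI[of _ _ "3 * aa ^ 12 + 3 * aa ^ 15 + aa ^ 18"]) (use aa_p2 in algebra)
  have e1: "euler (-1 * aa ^ 12 - aa ^ 15 - 2 * aa ^ 18 :: 'a fps) = 2 * aa ^ 10 - aa ^ 13
      - 3 * aa ^ 16 + aa ^ 19 + aa ^ 22"
    by (rule char7_fps_eqI[of _ _ "-2 * aa ^ 10 - 2 * aa ^ 13 - 3 * aa ^ 16 + 2 * aa ^ 19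
        + 5 * aa ^ 22"])
      (simp add: euler_add euler_diff euler_uminus euler_mult euler_aa_power algebra_simps)
  have e2: "euler (2 * aa ^ 10 - aa ^ 13 - 3 * aa ^ 16 + aa ^ 19 + aa ^ 22 :: 'a fps) =
      -1 * aa ^ 8 + aa ^ 11 + 2 * aa ^ 14 - 3 * aa ^ 17 + 2 * aa ^ 23 - aa ^ 26"
    by (rule char7_fps_eqI[of _ _ "3 * aa ^ 8 - 2 * aa ^ 11 - 10 * aa ^ 14 + 5 * aa ^ 17
        + 10 * aa ^ 20 - 3 * aa ^ 23 - 3 * aa ^ 26"])
      (simp add: euler_add euler_diff euler_uminus euler_mult euler_aa_power algebra_simps)
  have e3: "euler (-1 * aa ^ 8 + aa ^ 11 + 2 * aa ^ 14 - 3 * aa ^ 17 + 2 * aa ^ 23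
      - aa ^ 26 :: 'a fps) = -1 * aa ^ 6 - 3 * aa ^ 9 + aa ^ 12 + aa ^ 15 - aa ^ 21
      + 2 * aa ^ 24 + 3 * aa ^ 27 - 2 * aa ^ 30"
    by (rule char7_fps_eqI[of _ _ "-1 * aa ^ 6 + 2 * aa ^ 9 + 5 * aa ^ 12 - 9 * aa ^ 15 - 4 * aa ^
        18
        + 14 * aa ^ 21 - 4 * aa ^ 24 - 7 * aa ^ 27 + 4 * aa ^ 30"])
      (simp add: euler_add euler_diff euler_uminus euler_mult euler_aa_power algebra_simps)
  have e4: "euler (-1 * aa ^ 6 - 3 * aa ^ 9 + aa ^ 12 + aa ^ 15 - aa ^ 21 + 2 * aa ^ 24
      + 3 * aa ^ 27 - 2 * aa ^ 30 :: 'a fps) = aa ^ 4 + aa ^ 7 - 3 * aa ^ 10 + 2 * aa ^ 16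
      - aa ^ 19 - aa ^ 22 - 3 * aa ^ 25 - 3 * aa ^ 28 + 3 * aa ^ 31 - 3 * aa ^ 34"
    by (rule char7_fps_eqI[of _ _ "-1 * aa ^ 4 - 4 * aa ^ 7 + 3 * aa ^ 10 + 6 * aa ^ 13 - 2 * aa ^
        16
        - 5 * aa ^ 19 + 7 * aa ^ 22 + 15 * aa ^ 25 - 15 * aa ^ 28 - 12 * aa ^ 31 + 9 * aa ^ 34"])
      (simp add: euler_add euler_diff euler_uminus euler_mult euler_aa_power algebra_simps)
  have e5: "euler (aa ^ 4 + aa ^ 7 - 3 * aa ^ 10 + 2 * aa ^ 16 - aa ^ 19 - aa ^ 22
      - 3 * aa ^ 25 - 3 * aa ^ 28 + 3 * aa ^ 31 - 3 * aa ^ 34 :: 'a fps) = -3 * aa ^ 2 + aa ^ 8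
      - aa ^ 14 + 2 * aa ^ 17 + 2 * aa ^ 20 + aa ^ 26 + 3 * aa ^ 32 - 2 * aa ^ 35 - 3 * aa ^ 38"
    by (rule char7_fps_eqI[of _ _ "aa ^ 2 + aa ^ 5 - 5 * aa ^ 8 - aa ^ 11 + 9 * aa ^ 14 - 3 * aa ^
        17
        - 8 * aa ^ 20 - 8 * aa ^ 23 - 9 * aa ^ 26 + 24 * aa ^ 29 - 3 * aa ^ 32 - 13 * aa ^ 35
        + 15 * aa ^ 38"])
      (simp add: euler_add euler_diff euler_uminus euler_mult euler_aa_power algebra_simps)
  show ?thesis
    unfolding c e0 add_0_right e1 e2 e3 e4 e5 ..
qed

lemma power_7_add_one: "(y + 1) ^ 7 = y ^ 7 + (1 :: 'a fps)"
  using one_minus_power_7[of "- y"] by (simp add: add.commute)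

lemma power_7_diff_one: "(y - 1) ^ 7 = y ^ 7 - (1 :: 'a fps)"
proof -
  have "(y - 1) ^ 7 = - ((1 - y) ^ 7)"
    using power_minus_odd[of 7 "1 - y"] by simp
  then show ?thesis using one_minus_power_7[of y] by simp
qed

text \<open>Splitting off seventh powers by \<open>20 = 14 + 6\<close> and
  \<open>18 = 14 + 4\<close> leaves the same factor \<open>(y + 1) ^ 6 * (y - 1) ^ 4\<close> in both
  terms.\<close>

lemma uu_vv_expansion:
  fixes y :: "'a fps"
  defines "y \<equiv> aa ^ 3"
  shows "aa ^ 24 * (5 * uu ^ 20 * vv ^ 4 + 6 * uu ^ 6 * vv ^ 18) = (1 + 2 * y - 3 * y ^ 2
      - y ^ 3 + 2 * y ^ 4 - 2 * y ^ 5 + 2 * y ^ 6 - y ^ 7 - 3 * y ^ 8 + 2 * y ^ 9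
      + y ^ 10) * (4 * y ^ 14 + 5 * y ^ 7 + 4)"
proof -
  have c4: "(4 :: 'a fps) ^ 24 = 1"
  proof -
    have "(4 :: 'a fps) ^ 3 = 1" by (rule char7_fps_eqI[of _ _ 9]) simp
    then have "((4 :: 'a fps) ^ 3) ^ 8 = 1" by (simp only: power_one)
    then show ?thesis by (simp only: power_mult[symmetric]) simp
  qed
  have "aa ^ 24 * (uu ^ 20 * vv ^ 4) = (aa * uu) ^ 20 * ((aa * vv) ^ 4 :: 'a fps)"
    by (simp add: power_mult_distrib mult_ac flip: power_add)
  also have "\<dots> = 4 ^ 24 * ((y + 1) ^ 20 * (y - 1) ^ 4)"
    unfolding aa_uu aa_vv y_def[symmetric] power_mult_distrib
    by (simp add: mult_ac)
  also have "\<dots> = (((y + 1) ^ 7) ^ 2 * (y + 1) ^ 6) * (y - 1) ^ 4"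
    unfolding c4 by (simp flip: power_mult power_add)
  finally have s1: "aa ^ 24 * (uu ^ 20 * vv ^ 4) = (y ^ 7 + 1) ^ 2 * ((y + 1) ^ 6 * (y - 1) ^ 4)"
    unfolding power_7_add_one by (simp only: mult_ac)
  have "aa ^ 24 * (uu ^ 6 * vv ^ 18) = (aa * uu) ^ 6 * ((aa * vv) ^ 18 :: 'a fps)"
    by (simp add: power_mult_distrib mult_ac flip: power_add)
  also have "\<dots> = 4 ^ 24 * ((y + 1) ^ 6 * (y - 1) ^ 18)"
    unfolding aa_uu aa_vv y_def[symmetric] power_mult_distrib
    by (simp add: mult_ac)
  also have "\<dots> = (y + 1) ^ 6 * (((y - 1) ^ 7) ^ 2 * (y - 1) ^ 4)"
    unfolding c4 by (simp flip: power_mult power_add)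
  finally have s2: "aa ^ 24 * (uu ^ 6 * vv ^ 18) = (y ^ 7 - 1) ^ 2 * ((y + 1) ^ 6 * (y - 1) ^ 4)"
    unfolding power_7_diff_one by (simp only: mult_ac)
  have c: "(y + 1) ^ 6 * (y - 1) ^ 4 = 1 + 2 * y - 3 * y ^ 2 - y ^ 3 + 2 * y ^ 4 - 2 * y ^ 5
      + 2 * y ^ 6 - y ^ 7 - 3 * y ^ 8 + 2 * y ^ 9 + y ^ 10"
    by (rule char7_fps_eqI[of _ _ "-1 * y ^ 3 + 2 * y ^ 5 - y ^ 7"]) algebra
  have "5 * (y ^ 7 + 1) ^ 2 + 6 * (y ^ 7 - 1) ^ 2 = 4 * y ^ 14 + 5 * y ^ 7 + 4"
    by (rule char7_fps_eqI[of _ _ "y ^ 14 - y ^ 7 + 1"]) algebra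
  moreover have "aa ^ 24 * (5 * uu ^ 20 * vv ^ 4 + 6 * uu ^ 6 * vv ^ 18) =
      5 * (aa ^ 24 * (uu ^ 20 * vv ^ 4)) + 6 * (aa ^ 24 * (uu ^ 6 * (vv :: 'a fps) ^ 18))"
    by (simp add: algebra_simps)
  ultimately show ?thesis unfolding s1 s2 c by algebra
qed

lemma aa_euler_cert:
  fixes y :: "'a fps"
  defines "y \<equiv> aa ^ 3"
  shows "aa ^ 2 * euler cert = 2 * y ^ 2 - y ^ 3 + y ^ 4 + 2 * y ^ 5 - 3 * y ^ 6 - y ^ 7
      + 3 * y ^ 8 - 3 * y ^ 9 + 2 * y ^ 10 - 3 * y ^ 11 + 3 * y ^ 12 + y ^ 13 - y ^ 14
      - 2 * y ^ 15 + 2 * y ^ 17 - 3 * y ^ 18 - y ^ 19 + 2 * y ^ 20 - y ^ 21 - 3 * y ^ 22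
      + 2 * y ^ 24 + 2 * y ^ 26"
proof (rule char7_fps_eqI)
  have p: "aa ^ 2 * euler (aa ^ k) = of_nat k * (aa ^ k - (aa :: 'a fps) ^ (k
      + 6))" if "k \<ge> 2" for k
  proof -
    have "2 + (k - 2) = k" "2 + (k + 4) = k + 6" using that by auto
    then have "aa ^ 2 * aa ^ (k - 2) = (aa :: 'a fps) ^ k" "aa ^ 2 * aa ^ (k + 4) =
        (aa :: 'a fps) ^ (k + 6)"
      by (metis power_add)+
    then show ?thesis using that by (simp add: euler_aa_power algebra_simps)
  qed
  have m: "aa ^ 2 * (numeral c * F) = numeral c * (aa ^ 2 * F)" for c and F :: "'a fps"
    by (simp only: mult_ac)
  have "aa ^ 2 * euler (cert :: 'a fps) = (-2) * (6 * (aa ^ 6 - aa ^ 12)) + 3 * (9 * (aa ^ 9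
      - aa ^ 15)) + 2 * (12 * (aa ^ 12 - aa ^ 18)) + 1 * (15 * (aa ^ 15 - aa ^ 21))
      + 1 * (21 * (aa ^ 21 - aa ^ 27)) + 1 * (24 * (aa ^ 24 - aa ^ 30)) + 3 * (27 * (aa ^ 27
      - aa ^ 33)) + (-1) * (30 * (aa ^ 30 - aa ^ 36)) + 3 * (33 * (aa ^ 33 - aa ^ 39))
      + 1 * (36 * (aa ^ 36 - aa ^ 42)) + (-3) * (39 * (aa ^ 39 - aa ^ 45)) + 3 * (42 * (aa ^ 42
      - aa ^ 48)) + 1 * (51 * (aa ^ 51 - aa ^ 57)) + (-2) * (54 * (aa ^ 54 - aa ^ 60))
      + 1 * (57 * (aa ^ 57 - aa ^ 63)) + (-2) * (60 * (aa ^ 60 - aa ^ 66))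
      + (-3) * (63 * (aa ^ 63 - aa ^ 69)) + 1 * (66 * (aa ^ 66 - aa ^ 72))
      + (-1) * (72 * (aa ^ 72 - aa ^ 78))"
    unfolding cert_def
    by (simp add: euler_add euler_diff euler_uminus euler_mult distrib_left right_diff_distrib p m)
  then show "aa ^ 2 * euler cert - (2 * y ^ 2 - y ^ 3 + y ^ 4 + 2 * y ^ 5 - 3 * y ^ 6 - y ^ 7
      + 3 * y ^ 8 - 3 * y ^ 9 + 2 * y ^ 10 - 3 * y ^ 11 + 3 * y ^ 12 + y ^ 13 - y ^ 14
      - 2 * y ^ 15 + 2 * y ^ 17 - 3 * y ^ 18 - y ^ 19 + 2 * y ^ 20 - y ^ 21 - 3 * y ^ 22
      + 2 * y ^ 24 + 2 * y ^ 26) = 7 * (-2 * y ^ 2 + 4 * y ^ 3 + 5 * y ^ 4 - 2 * y ^ 5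
      - 3 * y ^ 6 + y ^ 7 + 3 * y ^ 8 + 9 * y ^ 9 - 8 * y ^ 10 + 3 * y ^ 11 + 9 * y ^ 12
      - 31 * y ^ 13 + 13 * y ^ 14 + 17 * y ^ 15 - 18 * y ^ 16 + 7 * y ^ 17 - 15 * y ^ 18
      + y ^ 19 - 2 * y ^ 20 - 35 * y ^ 21 + 27 * y ^ 22 + 27 * y ^ 23 - 20 * y ^ 24
      + 10 * y ^ 26)"
    unfolding y_def by algebra
qed

text \<open>Up to a constant, \<open>p1 + 2 * p2\<close> is minus the logarithmic derivative of
  \<open>inv_gen\<close>, so multiplication by \<open>inv_gen\<close> turns the \<open>cert\<close>
  terms into a shifted derivative. The exponents 20, 4 and 6, 18 make the other terms, times
  \<open>inv_gen\<close>, eta quotients in q^7 up to powers of q.\<close>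

theorem cert_identity:
  "aa ^ 28 * euler (euler (euler (euler (euler p2)))) = aa ^ 28 * (5 * uu ^ 20 * vv ^ 4
      + 6 * uu ^ 6 * vv ^ 18) + euler cert - (p1 + 2 * p2) * (cert :: 'a fps)"
proof -
  define y where "y = (aa :: 'a fps) ^ 3"
  define E where "E = euler (euler (euler (euler (euler (p2 :: 'a fps)))))"
  define C where "C = 1 + 2 * y - 3 * y ^ 2 - y ^ 3 + 2 * y ^ 4 - 2 * y ^ 5 + 2 * y ^ 6 - y ^ 7
      - 3 * y ^ 8 + 2 * y ^ 9 + y ^ 10"
  have E: "aa ^ 30 * E = -3 * y ^ 6 + y ^ 8 - y ^ 10 + 2 * y ^ 11 + 2 * y ^ 12 + y ^ 14
      + 3 * y ^ 16 - 2 * y ^ 17 - 3 * y ^ 18"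
    using euler_5_p2 unfolding E_def[symmetric] y_def by algebra
  have Z: "cert = -2 * y ^ 2 + 3 * y ^ 3 + 2 * y ^ 4 + y ^ 5 + y ^ 7 + y ^ 8 + 3 * y ^ 9
      - y ^ 10 + 3 * y ^ 11 + y ^ 12 - 3 * y ^ 13 + 3 * y ^ 14 + y ^ 17 - 2 * y ^ 18 + y ^ 19
      - 2 * y ^ 20 - 3 * y ^ 21 + y ^ 22 - y ^ 24"
    unfolding cert_def y_def by (simp flip: power_mult)
  have U: "aa ^ 30 * (5 * uu ^ 20 * vv ^ 4 + 6 * uu ^ 6 * vv ^ 18) = y ^ 2 * (C * (4 * y ^ 14
      + 5 * y ^ 7 + 4))"
    using uu_vv_expansion unfolding C_def y_def[symmetric] unfolding y_def by algebra
  have eZ: "aa ^ 2 * euler cert = 2 * y ^ 2 - y ^ 3 + y ^ 4 + 2 * y ^ 5 - 3 * y ^ 6 - y ^ 7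
      + 3 * y ^ 8 - 3 * y ^ 9 + 2 * y ^ 10 - 3 * y ^ 11 + 3 * y ^ 12 + y ^ 13 - y ^ 14
      - 2 * y ^ 15 + 2 * y ^ 17 - 3 * y ^ 18 - y ^ 19 + 2 * y ^ 20 - y ^ 21 - 3 * y ^ 22
      + 2 * y ^ 24 + 2 * y ^ 26"
    using aa_euler_cert unfolding y_def .
  have pZ: "aa ^ 2 * ((p1 + 2 * p2) * cert) = (y ^ 2 + 6 * y + 4) * cert"
    using aa_p1_p2 unfolding y_def by algebra
  have "aa ^ 30 * E = aa ^ 30 * (5 * uu ^ 20 * vv ^ 4 + 6 * uu ^ 6 * vv ^ 18)
      + aa ^ 2 * euler cert - aa ^ 2 * ((p1 + 2 * p2) * cert)"
    unfolding E U eZ pZ unfolding Z C_def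
    by (rule char7_fps_eqI[of _ _ "-2 * y ^ 2 - y ^ 3 + 5 * y ^ 4 + 3 * y ^ 5 + 2 * y ^ 7 + 3 * y ^
        9
        + 2 * y ^ 10 + 3 * y ^ 11 + 3 * y ^ 12 - 2 * y ^ 13 + y ^ 14 + y ^ 15 + y ^ 16 + y ^ 17
        - y ^ 19 - 2 * y ^ 20 - 2 * y ^ 21 - 3 * y ^ 22 + y ^ 23 + y ^ 24 - 2 * y ^ 25
        - y ^ 26"]) algebra
  then have "aa ^ 2 * (aa ^ 28 * E) = aa ^ 2 * (aa ^ 28 * (5 * uu ^ 20 * vv ^ 4
      + 6 * uu ^ 6 * vv ^ 18) + euler cert - (p1 + 2 * p2) * cert)"
    by algebra
  moreover have "(aa :: 'a fps) ^ 2 \<noteq> 0" using aa_nth_0[where 'a = 'a] by auto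
  ultimately show ?thesis unfolding E_def by (metis mult_left_cancel)
qed

section \<open>Vanishing sections\<close>

lemma of_nat_mult_7: "of_nat (7 * n) = (0 :: 'a)"
  using char7 by simp

lemma sec_4_euler_shift: "sec 4 (euler_shift (-4) F) = (0 :: 'a fps)"
  using of_nat_mult_7 by (simp add: fps_eq_iff euler_shift_nth del: of_nat_mult)

lemma sec_5_euler_shift: "sec 5 (euler_shift 2 F) = (0 :: 'a fps)"
proof -
  have "of_nat (7 * n + 5) + 2 = (0 :: 'a)" for n
    using of_nat_mult_7[of "n + 1"] by simp
  then show ?thesis by (simp add: fps_eq_iff euler_shift_nth del: of_nat_add of_nat_mult)
qed

lemma sec_5_eta1_power_6: "sec 5 (eta1 ^ 6) = (0 :: 'a fps)"
proof -
  define G where "G = (eta1 ^ 3 :: 'a fps)"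
  define G1 where "G1 = euler_shift 1 G"
  define G2 where "G2 = euler_shift 1 G1"
  have G3: "euler_shift 1 G2 = G"
    using eta_cube_euler by (simp only: G_def G1_def G2_def eta1_def)
  \<comment> \<open>Since the shifted derivation has order three on \<open>G\<close>, twice \<open>G\<^sup>2\<close> is a derivative.\<close>
  have "euler_shift 2 (G * G2 + G * G2 - G1 * G1) = 2 * (G * G)"
    unfolding euler_shift_diff euler_shift_add euler_shift_2_mult G3 G1_def[symmetric]
        G2_def[symmetric]
    by (simp add: algebra_simps)
  then have "2 * sec 5 (G * G) = 0"
    using sec_5_euler_shift by (metis sec_mult_numeral)
  moreover have "(2 :: 'a fps) \<noteq> 0"
    using numeral_nonzero(1) by (simp add: numeral_fps_const)
  moreover have "G * G = eta1 ^ 6" by (simp add: G_def flip: power_add)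
  ultimately show ?thesis by simp
qed

text \<open>For \<open>n = 2 * j + 1\<close> the index is \<open>2 * (7 * j + 5) + 2\<close>, which
  leads back to \<open>eta1 ^ 6\<close>; for even \<open>n\<close> it is odd, while only even
  exponents occur.\<close>

lemma sec_5_eta2_power_6: "sec 5 (fps_X ^ 2 * eta2 ^ 6) = (0 :: 'a fps)"
proof (rule fps_ext)
  fix n
  have d: "eta2 ^ 6 = (dil 2 (eta1 ^ 6) :: 'a fps)" by (simp add: dil_power dil_2_eta1)
  show "fps_nth (sec 5 (fps_X ^ 2 * eta2 ^ 6)) n = fps_nth (0 :: 'a fps) n"
  proof (cases "even (7 * n + 3)")
    case True
    then obtain j where "n = 2 * j + 1" by (metis even_add even_mult_iff odd_numeral oddE)
    then have n: "7 * n + 5 = 2 * (7 * j + 5) + 2" by simp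
    have x: "fps_nth (fps_X ^ 2 * F) (k + 2) = fps_nth F k" for k and F :: "'a fps"
      by (simp add: fps_X_power_mult_nth)
    have "fps_nth (eta1 ^ 6) (7 * j + 5) = (0 :: 'a)"
      using arg_cong[OF sec_5_eta1_power_6, of "\<lambda>F. fps_nth F j"] by simp
    then show ?thesis unfolding d sec_nth n x dil_nth_mult[OF zero_less_numeral] by simp
  next
    case False
    then show ?thesis unfolding d by (simp add: fps_X_power_mult_nth dil_nth)
  qed
qed

lemma dil_7_inverse_eta1: "dil 7 (inverse eta1) = (inverse eta1 ^ 7 :: 'a fps)"
  and dil_7_inverse_eta2: "dil 7 (inverse eta2) = (inverse eta2 ^ 7 :: 'a fps)"
proof -
  have "eta1 ^ 7 * dil 7 (inverse eta1) = dil 7 (eta1 * inverse eta1 :: 'a fps)"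
    by (simp only: dil_mult zero_less_numeral dil_7_eta1)
  also have "\<dots> = (eta1 * inverse eta1) ^ 7" by simp
  also have "\<dots> = eta1 ^ 7 * inverse eta1 ^ 7" by (rule power_mult_distrib)
  finally show "dil 7 (inverse eta1) = (inverse eta1 ^ 7 :: 'a fps)" by simp
  have "eta2 ^ 7 * dil 7 (inverse eta2) = dil 7 (eta2 * inverse eta2 :: 'a fps)"
    by (simp only: dil_mult zero_less_numeral dil_7_eta2)
  also have "\<dots> = (eta2 * inverse eta2) ^ 7" by simp
  also have "\<dots> = eta2 ^ 7 * inverse eta2 ^ 7" by (rule power_mult_distrib)
  finally show "dil 7 (inverse eta2) = (inverse eta2 ^ 7 :: 'a fps)" by simp
qed

lemma sec_4_X_power_mult_dil: "sec 4 (fps_X ^ (7 * k + 4) * dil 7 G) = fps_X ^ k * (G :: 'a fps)"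
proof -
  have "sec 4 (fps_X ^ (7 * k + 4) :: 'a fps) = fps_X ^ k" by (auto simp: fps_eq_iff)
  then show ?thesis by (simp add: sec_mult_dil)
qed

lemma sec_5_sec_4_main:
  "sec 5 (sec 4 (inv_gen * euler (euler (euler (euler (euler p2)))))) = (0 :: 'a fps)"
proof -
  define i1 i2 where "i1 = inverse (eta1 :: 'a fps)" and "i2 = inverse (eta2 :: 'a fps)"
  have i: "eta1 * i1 = 1" "eta2 * i2 = 1" by (simp_all add: i1_def i2_def)
  define E where "E = euler (euler (euler (euler (euler (p2 :: 'a fps)))))"
  define U where "U = 5 * uu ^ 20 * vv ^ 4 + 6 * uu ^ 6 * (vv :: 'a fps) ^ 18"
  \<comment> \<open>The inverse of a seventh power has derivative 0, so \<open>b\<close> can be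
    moved through the derivation.\<close>
  define b where "b = inverse ((aa :: 'a fps) ^ 28)"
  have ab: "aa ^ 28 * b = 1"
    unfolding b_def by (rule inverse_mult_eq_1') (simp add: fps_power_zeroth aa_nth_0)
  have "euler ((aa :: 'a fps) ^ 28) = 0"
    by (rule char7_fps_eqI[of _ _ "4 * aa ^ 27 * euler aa"]) (simp add: euler_power)
  moreover have "euler (aa ^ 28 * b) = 0" by (simp add: ab)
  ultimately have "aa ^ 28 * euler b = 0" by (simp add: euler_mult)
  then have eb: "euler b = 0" using ab by auto
  have key: "aa ^ 28 * E = aa ^ 28 * U + euler cert - (p1 + 2 * p2) * cert"
    unfolding E_def U_def by (rule cert_identity)
  have q: "(eta1 :: 'a fps) ^ 41 = eta1 ^ 6 * eta1 ^ 35" "(eta2 :: 'a fps) ^ 34 =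
      eta2 ^ 6 * eta2 ^ 28"
    by (simp_all flip: power_add)
  \<comment> \<open>The constant 11 in \<open>euler_inv_gen\<close> is 4 modulo 7; hence the shift
    by -4, which \<open>sec 4\<close> annihilates.\<close>
  have "inv_gen * E = inv_gen * U + euler_shift (-4) (inv_gen * cert * b)"
  proof (rule char7_fps_eqI)
    have "euler_shift (-4) (inv_gen * cert * b) =
        inv_gen * b * ((11 - p1 - 2 * p2) * cert + euler cert - 4 * cert)"
      unfolding euler_shift_def euler_mult euler_inv_gen eb
      by (simp add: algebra_simps numeral_fps_const[symmetric] fps_const_neg[symmetric] del:
          fps_const_neg)
    then show "inv_gen * E - (inv_gen * U + euler_shift (-4) (inv_gen * cert * b)) =
        7 * (- (inv_gen * b * cert))"
      using key ab by algebra
  qed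
  then have "sec 4 (inv_gen * E) = sec 4 (inv_gen * U)"
    by (simp add: sec_add sec_4_euler_shift)
  \<comment> \<open>Expressing \<open>phi\<close> and \<open>psi\<close> by \<open>eta1\<close> and
    \<open>eta2\<close> gives \<open>eta1 ^ 287 / eta2 ^ 98\<close> and
    \<open>eta2 ^ 238 / eta1 ^ 49\<close>, whose exponents are 7 times 41, 14, 34 and 7.\<close>
  also have "inv_gen * U = 5 * (fps_X ^ (7 * 0 + 4) * dil 7 (eta1 ^ 41 * i2 ^ 14)) +
      6 * (fps_X ^ (7 * 2 + 4) * dil 7 (eta2 ^ 34 * i1 ^ 7))"
  proof -
    have ph: "phi = eta1 ^ 2 * i2" using eta2_phi[where 'a = 'a] i by algebra
    have ps: "psi = eta2 ^ 2 * i1" using eta1_psi[where 'a = 'a] i by algebra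
    have q: "(eta1 :: 'a fps) ^ 320 = eta1 ^ 33 * eta1 ^ 287" "i1 ^ 33 = i1 * i1 ^ 32"
        "i2 ^ 160 = i2 ^ 98 * i2 ^ 62" "i2 ^ 64 = i2 ^ 2 * i2 ^ 62"
        "(eta2 :: 'a fps) ^ 288 = eta2 ^ 238 * eta2 ^ 50" "i1 ^ 144 = i1 ^ 48 * i1 ^ 96"
        "i1 ^ 145 = i1 * (i1 ^ 48 * i1 ^ 96)" "i2 ^ 50 = i2 ^ 2 * i2 ^ 48"
      by (simp_all flip: power_add power_Suc)
    have "inv_gen * (uu ^ 20 * vv ^ 4) =
        fps_X ^ 4 * (eta1 ^ 287 * i2 ^ 98) * ((eta1 * i1) ^ 33 * (eta2 * i2) ^ 64)"
      unfolding inv_gen_def uu_def vv_def ph ps i1_def[symmetric] i2_def[symmetric]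
      by (simp add: power_mult_distrib flip: power_mult) (simp only: q mult_ac simp_thms)
    moreover have "dil 7 (eta1 ^ 41 * i2 ^ 14) = eta1 ^ 287 * i2 ^ 98"
      by (simp add: dil_mult dil_power dil_7_eta1 dil_7_inverse_eta2 i2_def flip: power_mult)
    moreover have "inv_gen * (uu ^ 6 * vv ^ 18) =
        fps_X ^ 18 * (eta2 ^ 238 * i1 ^ 49) * ((eta1 * i1) ^ 96 * (eta2 * i2) ^ 50)"
      unfolding inv_gen_def uu_def vv_def ph ps i1_def[symmetric] i2_def[symmetric]
      by (simp add: power_mult_distrib flip: power_mult) (simp only: q mult_ac simp_thms)
    moreover have "dil 7 (eta2 ^ 34 * i1 ^ 7) = eta2 ^ 238 * i1 ^ 49"
      by (simp add: dil_mult dil_power dil_7_eta2 dil_7_inverse_eta1 i1_def flip: power_mult)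
    moreover have "inv_gen * U =
        5 * (inv_gen * (uu ^ 20 * vv ^ 4)) + 6 * (inv_gen * (uu ^ 6 * vv ^ 18))"
      unfolding U_def by (simp add: algebra_simps)
    ultimately show ?thesis by (simp add: i)
  qed
  also have "sec 4 \<dots> =
      5 * (fps_X ^ 0 * (eta1 ^ 41 * i2 ^ 14)) + 6 * (fps_X ^ 2 * (eta2 ^ 34 * i1 ^ 7))"
    unfolding sec_add sec_mult_numeral sec_4_X_power_mult_dil ..
  \<comment> \<open>By \<open>41 = 6 + 35\<close> and \<open>34 = 6 + 28\<close>, only sixth powers
    remain next to series in q^7, and \<open>sec 5\<close> annihilates them.\<close>
  also have "\<dots> = 5 * (eta1 ^ 6 * dil 7 (eta1 ^ 5 * i2 ^ 2)) + 6 * (fps_X ^ 2 * eta2 ^ 6 * dil 7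
      (eta2 ^ 4 * i1))"
  proof -
    have "dil 7 (eta1 ^ 5 * i2 ^ 2) = eta1 ^ 35 * i2 ^ 14"
      by (simp add: dil_mult dil_power dil_7_eta1 dil_7_inverse_eta2 i2_def flip: power_mult)
    moreover have "dil 7 (eta2 ^ 4 * i1) = eta2 ^ 28 * i1 ^ 7"
      by (simp add: dil_mult dil_power dil_7_eta2 dil_7_inverse_eta1 i1_def flip: power_mult)
    ultimately show ?thesis unfolding q by (simp only: power_0 mult_1_left mult_ac)
  qed
  finally have "sec 5 (sec 4 (inv_gen * E)) = 0"
    by (simp add: sec_add sec_mult_numeral sec_mult_dil sec_5_eta1_power_6 sec_5_eta2_power_6)
  then show ?thesis by (simp add: E_def)
qed

section \<open>From divisibility by 7 to divisibility by 49\<close>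

lemma of_int_fps_eq_0_imp_dvd:
  assumes "of_int_fps F = (0 :: 'a fps)"
  shows "\<exists>G. F = 7 * G"
proof
  have "7 dvd fps_nth F n" for n
    using arg_cong[OF assms, of "\<lambda>F. fps_nth F n"] of_int_0_imp_dvd by simp
  then show "F = 7 * Abs_fps (\<lambda>n. fps_nth F n div 7)"
    by (simp add: fps_eq_iff numeral_fps_const)
qed

lemma euler_dil_7: "euler (dil 7 F) = (0 :: 'a fps)"
  using char7_fps by (simp add: euler_dil)

text \<open>Since \<open>n ^ 6 = 1\<close> for units, six derivations fix the terms with exponent
  prime to 7 and kill the others.\<close>

lemma diff_euler_6: "\<exists>t. s - euler (euler (euler (euler (euler (euler s))))) = dil 7 (t :: 'a fps)"
proof
  show "s - euler (euler (euler (euler (euler (euler s))))) =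
      dil 7 (Abs_fps (\<lambda>n. fps_nth s (7 * n)))"
  proof (rule fps_ext)
    fix n
    have e: "fps_nth (euler (euler (euler (euler (euler (euler s)))))) n =
        of_int (int n) ^ 6 * fps_nth s n"
      by (simp add: euler_nth eval_nat_numeral mult_ac)
    show "fps_nth (s - euler (euler (euler (euler (euler (euler s)))))) n =
        fps_nth (dil 7 (Abs_fps (\<lambda>n. fps_nth s (7 * n)))) n"
    proof (cases "7 dvd n")
      case True
      then have "(of_int (int n) :: 'a) = 0" by (intro of_int_eq_0) presburger
      then show ?thesis using True unfolding fps_sub_nth e by (simp add: dil_nth)
    next
      case False
      then have "(of_int (int n) :: 'a) ^ 6 = 1" by (intro of_int_power_6) presburger
      then show ?thesis using False unfolding fps_sub_nth e by (simp add: dil_nth)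
    qed
  qed
qed

lemma eta2_power_7_int:
  obtains S where "eta2 ^ 7 = dil 7 eta2 + 7 * (S :: int fps)"
proof -
  have "of_int_fps (eta2 ^ 7 - dil 7 eta2) = (0 :: 'a fps)"
    by (simp add: of_int_fps_diff of_int_fps_power of_int_fps_dil dil_7_eta2)
  from of_int_fps_eq_0_imp_dvd[OF this] obtain S where "eta2 ^ 7 - dil 7 eta2 = 7 * (S :: int fps)"
    by blast
  then have "eta2 ^ 7 = dil 7 eta2 + 7 * S" by (simp add: algebra_simps)
  then show ?thesis by (rule that)
qed

text \<open>One factor 7 comes from \<open>sec 4 A = 7 * R\<close>, the other from
  \<open>sec 5\<close> of \<open>R\<close> vanishing in characteristic seven.\<close>

theorem dvd_coefficient:
  fixes A :: "int fps"
  assumes A: "A * (eta1 * eta2 ^ 2) = 1"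
  shows "49 dvd fps_nth A (49 * n + 39)"
proof -
  obtain S :: "int fps" where S: "eta2 ^ 7 = dil 7 eta2 + 7 * S" by (rule eta2_power_7_int)
  define H where "H = A * eta2 ^ 7"
  define V where "V = fps_X ^ 2 * dil 7 H"
  have ofA: "of_int_fps A = (inv_gen :: 'b::field fps)"
  proof (rule inv_gen_unique)
    show "of_int_fps A * (eta1 * eta2 ^ 2) = (1 :: 'b fps)"
      using arg_cong[OF A, of "of_int_fps :: _ \<Rightarrow> 'b fps"] 
      by (simp add: of_int_fps_mult of_int_fps_power)
  qed
  \<comment> \<open>Proved over the rationals, where \<open>psi\<close> is available, and pulled
    back to the integers by injectivity.\<close>
  have secH: "sec 4 H = - 7 * V"
  proof -
    have "of_int_fps H * (eta1 * eta2 ^ 2) = eta2 ^ 7 * (inv_gen * (eta1 * eta2 ^ 2) :: rat fps)"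
      unfolding H_def of_int_fps_mult of_int_fps_power of_int_fps_eta2 ofA by (simp only: mult_ac)
    also have "\<dots> = eta2 ^ 7" by (simp only: inv_gen_mult mult_1_right)
    also have "\<dots> = psi * eta2 ^ 3 * (eta1 * eta2 ^ 2)"
    proof -
      have "psi * eta2 ^ 3 * (eta1 * eta2 ^ 2) = (eta1 * psi) * (eta2 ^ 3 * eta2 ^ 2 :: rat fps)"
        by (simp only: mult_ac)
      then show ?thesis unfolding eta1_psi by (simp flip: power_add)
    qed
    finally have oH: "of_int_fps H = (psi * eta2 ^ 3 :: rat fps)" by simp
    have "of_int_fps (sec 4 H) = (of_int_fps (- 7 * V) :: rat fps)"
      by (simp add: V_def oH of_int_fps_sec of_int_fps_mult of_int_fps_uminus of_int_fps_dil
          sec_4_psi_eta2_cube)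
    then show ?thesis by (simp only: of_int_fps_inject)
  qed
  \<comment> \<open>The square of \<open>dil 7 eta2 = eta2 ^ 7 - 7 * S\<close> is expanded, with
    \<open>A * eta2 ^ 7\<close> collected into \<open>H\<close>.\<close>
  have "A * dil 7 eta2 ^ 2 = H * dil 7 eta2 - 7 * (S * H) + 7 * (7 * (S ^ 2 * A))"
    using S unfolding H_def by algebra
  then have "A * dil 7 (eta2 ^ 2) = H * dil 7 eta2 - 7 * (S * H) + 7 * (7 * (S ^ 2 * A))"
    by (simp add: dil_power)
  then have *: "sec 4 (A * dil 7 (eta2 ^ 2)) =
      sec 4 (H * dil 7 eta2 - 7 * (S * H) + 7 * (7 * (S ^ 2 * A)))"
    by (rule arg_cong)
  have sA: "sec 4 A * eta2 ^ 2 = 7 * (- V * eta2 - sec 4 (S * H) + 7 * sec 4 (S ^ 2 * A))"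
  proof -
    have "sec 4 (F * dil 7 G) = sec 4 F * G" for F G :: "int fps" by (rule sec_mult_dil) simp
    with * have "sec 4 A * eta2 ^ 2 =
        - 7 * V * eta2 - 7 * sec 4 (S * H) + 7 * (7 * sec 4 (S ^ 2 * A))"
      by (simp only: sec_add sec_diff sec_mult_numeral secH)
    then show ?thesis by algebra
  qed
  \<comment> \<open>The constant coefficient is 1, so an inverse exists over the integers and
    \<open>R\<close> stays integral.\<close>
  define I where "I = fps_left_inverse (eta2 ^ 2 :: int fps) 1"
  have I: "I * eta2 ^ 2 = 1"
    unfolding I_def by (rule fps_left_inverse) (simp add: fps_power_zeroth)
  define R where "R = (- V * eta2 - sec 4 (S * H) + 7 * sec 4 (S ^ 2 * A)) * I"
  have R: "sec 4 A = 7 * R" using sA I unfolding R_def by algebra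
  have R': "R * eta2 ^ 2 = - V * eta2 - sec 4 (S * H) + 7 * sec 4 (S ^ 2 * A)"
    using I unfolding R_def by algebra

  define s where "s = (of_int_fps S * inverse eta2 ^ 7 :: 'a fps)"
  have inv7: "eta2 ^ 7 * inverse eta2 ^ 7 = (1 :: 'a fps)"
    by (simp flip: power_mult_distrib)
  have Ss: "of_int_fps S = s * (eta2 ^ 7 :: 'a fps)"
    using inv7 unfolding s_def by algebra
  \<comment> \<open>The derivative is taken over the integers, where a common factor 7 can be
    cancelled; reduction modulo 7 comes afterwards.\<close>
  have "euler (eta2 ^ 7) = euler (dil 7 eta2 + 7 * S)" by (simp add: S)
  then have "7 * euler S = 7 * (eta2 ^ 6 * euler eta2 - dil 7 (euler eta2))"
    by (simp add: euler_power euler_add euler_mult euler_dil algebra_simps)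
  moreover have "(7 :: int fps) \<noteq> 0" by simp
  ultimately have "euler S = eta2 ^ 6 * euler eta2 - dil 7 (euler eta2)"
    using mult_left_cancel by blast
  from arg_cong[OF this, of "of_int_fps :: _ \<Rightarrow> 'a fps"]
  have "euler (of_int_fps S) = eta2 ^ 6 * euler eta2 - dil 7 (euler eta2 :: 'a fps)"
    by (simp add: of_int_fps_diff of_int_fps_mult of_int_fps_power of_int_fps_dil of_int_fps_euler)
  then have eS: "euler (of_int_fps S) = ((p2 - 3) - dil 7 (p2 - 3)) * (eta2 ^ 7 :: 'a fps)"
    unfolding euler_eta2 dil_mult[OF zero_less_numeral] dil_7_eta2 by algebra
  have "euler (eta2 ^ 7 :: 'a fps) = 0"
    by (simp add: euler_dil_7 flip: dil_7_eta2)
  then have "euler s * eta2 ^ 7 = ((p2 - 3) - dil 7 (p2 - 3)) * (eta2 ^ 7 :: 'a fps)"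
    using eS unfolding Ss by (simp add: euler_mult)
  then have es: "euler s = (p2 - 3) - dil 7 (p2 - 3)" by simp
  have es2: "euler (euler s) = euler p2"
    unfolding es by (simp add: euler_diff euler_dil_7)
  obtain t where "s - euler (euler (euler (euler (euler (euler s))))) = dil 7 t"
    using diff_euler_6 by blast
  \<comment> \<open>By \<open>es2\<close> the sixth derivative of \<open>s\<close> is the fifth
    derivative of \<open>p2\<close>.\<close>
  then have st: "s = euler (euler (euler (euler (euler p2)))) + dil 7 t"
    unfolding es2 by (simp add: algebra_simps)

  \<comment> \<open>As this section vanishes modulo 7, the unspecified series \<open>t\<close>
    contributes nothing.\<close>
  have "sec 4 inv_gen = (of_int_fps (7 * R) :: 'a fps)"
    by (simp add: of_int_fps_sec ofA flip: R)
  also have "\<dots> = 0" using char7_fps by (simp add: of_int_fps_mult)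
  finally have si: "sec 4 inv_gen = (0 :: 'a fps)" .
  have "of_int_fps (S * H) = inv_gen * s * dil 7 (eta2 ^ 2 :: 'a fps)"
    unfolding H_def of_int_fps_mult of_int_fps_power of_int_fps_eta2 ofA Ss
      dil_power[OF zero_less_numeral] dil_7_eta2
    by (simp only: power2_eq_square mult_ac)
  then have "of_int_fps (sec 4 (S * H)) = sec 4 (inv_gen * s) * (eta2 ^ 2 :: 'a fps)"
    by (simp add: of_int_fps_sec sec_mult_dil)
  also have "sec 4 (inv_gen * s) = sec 4 (inv_gen * euler (euler (euler (euler (euler p2)))))"
    by (subst st) (simp add: distrib_left sec_add sec_mult_dil si)
  finally have SH: "of_int_fps (sec 4 (S * H)) =
    sec 4 (inv_gen * euler (euler (euler (euler (euler p2))))) * (eta2 ^ 2 :: 'a fps)" .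
  define E where "E = sec 4 (inv_gen * euler (euler (euler (euler (euler (p2 :: 'a fps))))))"
  define h where "h = (of_int_fps H :: 'a fps)"
  have "of_int_fps (R * eta2 ^ 2) = - (fps_X ^ 2 * dil 7 h) * eta2 - E * eta2 ^ 2 + 0"
    unfolding R' using char7_fps
    by (simp add: of_int_fps_add of_int_fps_diff of_int_fps_mult of_int_fps_uminus SH V_def
        of_int_fps_dil E_def h_def)
  then have "of_int_fps R * eta2 ^ 2 = - (fps_X ^ 2 * dil 7 h) * eta2 - E * (eta2 ^ 2 :: 'a fps)"
    by (simp add: of_int_fps_mult of_int_fps_power)
  \<comment> \<open>Writing \<open>eta2\<close> as \<open>eta2 ^ 6 * eta2 ^ 2 / eta2 ^ 7\<close>,
    with \<open>eta2 ^ 7\<close> a series in q^7, isolates \<open>fps_X ^ 2 * eta2 ^ 6\<close>,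
    which \<open>sec 5\<close> annihilates.\<close>
  also have "\<dots> = (- (fps_X ^ 2 * eta2 ^ 6) * dil 7 (h * inverse eta2) - E) * eta2 ^ 2"
  proof -
    have "eta2 = eta2 ^ 6 * (inverse eta2 ^ 7 * (eta2 ^ 2 :: 'a fps))"
    proof -
      have "eta2 ^ 6 * (inverse eta2 ^ 7 * eta2 ^ 2) =
          eta2 * (eta2 ^ 7 * inverse eta2 ^ 7 :: 'a fps)"
        by algebra
      then show ?thesis using inv7 by simp
    qed
    then have "dil 7 h * eta2 = dil 7 (h * inverse eta2) * (eta2 ^ 6 * (eta2 ^ 2 :: 'a fps))"
      unfolding dil_mult[OF zero_less_numeral] dil_7_inverse_eta2 by algebra
    then show ?thesis by algebra
  qed
  finally have "of_int_fps R = - (fps_X ^ 2 * eta2 ^ 6) * dil 7 (h * inverse eta2) - E" by simp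
  then have "of_int_fps R = - ((fps_X ^ 2 * eta2 ^ 6) * dil 7 (h * inverse eta2)) - E" by simp
  moreover have "sec 5 (- F) = - sec 5 F" for F :: "'a fps" by (simp add: fps_eq_iff)
  ultimately have "sec 5 (of_int_fps R) = (0 :: 'a fps)"
    by (simp add: sec_diff sec_mult_dil sec_5_eta2_power_6 E_def sec_5_sec_4_main)
  then have "of_int (fps_nth R (7 * n + 5)) = (0 :: 'a)"
    by (metis fps_zero_nth of_int_fps_nth sec_nth)
  then have "7 dvd fps_nth R (7 * n + 5)" by (rule of_int_0_imp_dvd)
  moreover have "fps_nth A (49 * n + 39) = 7 * fps_nth R (7 * n + 5)"
  proof -
    have "fps_nth A (7 * (7 * n + 5) + 4) = 7 * fps_nth R (7 * n + 5)"
      using arg_cong[OF R, of "\<lambda>F. fps_nth F (7 * n + 5)"]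
          by (simp add: numeral_fps_const del: distrib_left_numeral)
    moreover have "7 * (7 * n + 5) + 4 = 49 * n + 39" by simp
    ultimately show ?thesis by (simp only:)
  qed
  ultimately show ?thesis by auto
qed

end

section \<open>The field with seven elements and the theorem\<close>

text \<open>A concrete field satisfying \<open>char7\<close>, at which
  \<open>dvd_coefficient\<close> is instantiated.\<close>

typedef gf7 = "{0..<7::int}"
  by (rule exI[of _ 0]) simp

definition to_gf7 :: "int \<Rightarrow> gf7" where "to_gf7 x = Abs_gf7 (x mod 7)"

lemma Rep_to_gf7 [simp]: "Rep_gf7 (to_gf7 x) = x mod 7"
  by (simp add: to_gf7_def Abs_gf7_inverse)

lemma Rep_gf7_mod [simp]: "Rep_gf7 x mod 7 = Rep_gf7 x"
  using Rep_gf7[of x] by simp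

instantiation gf7 :: field
begin

definition "0 = to_gf7 0"
definition "1 = to_gf7 1"
definition "x + y = to_gf7 (Rep_gf7 x + Rep_gf7 y)"
definition "- x = to_gf7 (- Rep_gf7 x)"
definition "x - y = to_gf7 (Rep_gf7 x - Rep_gf7 y)"
definition "x * y = to_gf7 (Rep_gf7 x * Rep_gf7 y)"
text \<open>Nonzero elements have sixth power 1, so the fifth power inverts them; it also sends 0 to
  0.\<close>

definition "inverse x = to_gf7 (Rep_gf7 x ^ 5)"
definition "x div y = to_gf7 (Rep_gf7 x * Rep_gf7 y ^ 5)"

lemmas gf7_defs = zero_gf7_def one_gf7_def plus_gf7_def uminus_gf7_def minus_gf7_def
  times_gf7_def inverse_gf7_def divide_gf7_def

instance
proof
  fix x y z :: gf7
  show "x * y * z = x * (y * z)"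
    unfolding Rep_gf7_inject[symmetric] by (simp add: gf7_defs mod_simps mult.assoc)
  show "x * y = y * x"
    by (simp add: gf7_defs mult.commute)
  show "1 * x = x"
    unfolding Rep_gf7_inject[symmetric] by (simp add: gf7_defs)
  show "x + y + z = x + (y + z)"
    unfolding Rep_gf7_inject[symmetric] by (simp add: gf7_defs mod_simps add.assoc)
  show "x + y = y + x"
    by (simp add: gf7_defs add.commute)
  show "0 + x = x"
    unfolding Rep_gf7_inject[symmetric] by (simp add: gf7_defs)
  show "- x + x = 0"
    unfolding Rep_gf7_inject[symmetric] by (simp add: gf7_defs mod_simps)
  show "x - y = x + - y"
    unfolding Rep_gf7_inject[symmetric] by (simp add: gf7_defs mod_simps)
  show "(x + y) * z = x * z + y * z"
    unfolding Rep_gf7_inject[symmetric] by (simp add: gf7_defs mod_simps distrib_right)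
  show "(0::gf7) \<noteq> 1"
    unfolding Rep_gf7_inject[symmetric] by (simp add: gf7_defs)
  show "x div y = x * inverse y"
    unfolding Rep_gf7_inject[symmetric] by (simp add: gf7_defs mod_simps)
  show "inverse (0::gf7) = 0"
    unfolding Rep_gf7_inject[symmetric] by (simp add: gf7_defs)
  assume "x \<noteq> 0"
  then have "Rep_gf7 x \<noteq> 0"
    unfolding Rep_gf7_inject[symmetric] by (simp add: gf7_defs)
  moreover have "0 \<le> Rep_gf7 x" "Rep_gf7 x < 7" using Rep_gf7[of x] by auto
  ultimately have "Rep_gf7 x \<in> {1, 2, 3, 4, 5, 6}" by auto
  then have "Rep_gf7 x ^ 5 * Rep_gf7 x mod 7 = 1" by auto
  then show "inverse x * x = 1"
    unfolding Rep_gf7_inject[symmetric] by (simp add: gf7_defs mod_simps)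
qed

end

lemma gf7_char: "(7 :: gf7) = 0"
proof -
  have "of_nat n = to_gf7 (int n)" for n
  proof (induction n)
    case 0
    then show ?case by (simp add: zero_gf7_def)
  next
    case (Suc n)
    then show ?case
      unfolding Rep_gf7_inject[symmetric] by (simp add: gf7_defs mod_simps add.commute)
  qed
  from this[of 7] show ?thesis unfolding Rep_gf7_inject[symmetric] by (simp add: zero_gf7_def)
qed

theorem theorem1p2:
  fixes n :: nat
  shows "\<exists>m::int. a_gen 3 (7^2 * n + 39) = of_int (7^2 * m)"
proof -
  \<comment> \<open>The inverse is formed over the integers first; uniqueness of inverses identifies
    its image with the rational series in \<open>a_gen\<close>.\<close>
  define A where "A = fps_left_inverse (eta1 * eta2 ^ 2 :: int fps) 1"
  have A: "A * (eta1 * eta2 ^ 2) = 1"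
    unfolding A_def by (rule fps_left_inverse) (simp add: fps_power_zeroth)
  obtain m where m: "fps_nth A (49 * n + 39) = 49 * m"
    using dvd_coefficient[OF gf7_char A, of n] by (auto simp: dvd_def)
  have "of_int_fps A * (eta1 * eta2 ^ 2) = (1 :: rat fps)"
    using arg_cong[OF A, of "of_int_fps :: _ \<Rightarrow> rat fps"]
    by (simp add: of_int_fps_mult of_int_fps_power)
  then have "inverse (eta1 * eta2 ^ 2) = (of_int_fps A :: rat fps)"
    by (intro fps_inverse_unique) (simp add: mult.commute)
  then have "a_gen 3 (49 * n + 39) = of_int (fps_nth A (49 * n + 39))"
    unfolding a_gen_def eta_f_eq_eta eta1_def[symmetric] eta2_def[symmetric] by simp
  then have "a_gen 3 (7^2 * n + 39) = of_int (7^2 * m)" using m by simp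
  then show ?thesis ..
qed

end
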